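(* Let $\Pi$ be the preprojective algebra of type $A_n$ and $W=\mathfrak S_{n+1}$. Let $w=[i_1,\ldots,i_{n+1}]\in W$ be a join-irreducible element of type $\ell$. Then $J(w)$ is the factor module of $P_\ell$ which has the form $$J(w)=\begin{array}{|cccccccc|}\hline \ell&\ell-1&\ell-2&\cdots&\cdots&\cdots&\cdots&i_{\ell+1}\\ \hline \ell+1&\ell&\ell-1&\cdots&\cdots&\cdots&i_{\ell+2}&\\ \hline \ell+2&\ell+1&\ell&\cdots&\cdots&i_{\ell+3}&&\\ \hline \vdots&\vdots&\vdots&\vdots&\vdots&&&\\ \hline n-1&\cdots&\cdots&i_n&&&&\\ \hline n&\cdots&i_{n+1}&&&&&\\ \hline\end{array}$$ that is, for each $m\in\{\ell+1,\ldots,n+1\}$ the row starting at $m-1$ of $J(w)$ consists of the entries $m-1,m-2,\ldots,i_m$ of the corresponding row of $P_\ell$ (this row is empty if $i_m=m$). In particular, any nonzero factor module of $P_\ell$ is indecomposable $\tau^-$-rigid.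
   Context: $\Pi$ is the preprojective algebra of type $A_n$ over a field $k$: the path algebra of the quiver with vertices $1,\ldots,n$ and arrows $x_i:i\to i+1$ ($1\le i\le n-1$), $y_i:i\to i-1$ ($2\le i\le n$), with relations (paths read from left to right) $x_1y_2=0$, $x_iy_{i+1}=y_ix_{i-1}$ for $2\le i\le n-1$, $y_nx_{n-1}=0$. Modules are finite-dimensional left modules, viewed as representations of this quiver with relations. $e_i$ is the idempotent at vertex $i$, $S_\ell$ the simple module at $\ell$, and $P_\ell=\Pi e_\ell$ its projective cover. $W=\mathfrak S_{n+1}$, with product $(ww')(i)=w(w'(i))$, simple reflections $s_i=(i\ \,i+1)$, one-line notation $w=[w(1),\ldots,w(n+1)]$, and right weak order ($u\ge v$ iff $\ell(u)=\ell(v)+\ell(v^{-1}u)$ for the length function $\ell(\cdot)$). $w=[i_1,\ldots,i_{n+1}]$ is join-irreducible (covers exactly one element) iff there is $\ell\in\{1,\ldots,n\}$ with $i_1<\cdots<i_\ell>i_{\ell+1}<\cdots<i_{n+1}$; then $w$ is said to be of type $\ell$, and the unique element covered by $w$ is $ws_\ell$. Necessarily $i_m\le m$ for $m\in\{\ell+1,\ldots,n+1\}$. Let $I_i=\Pi(1-e_i)\Pi$ and, for a reduced word $w=s_{i_1}\cdots s_{i_m}$, $I(w)=I_{i_1}\cdots I_{i_m}$ (independent of the reduced word). For $w$ join-irreducible of type $\ell$, $J(w):=(\Pi/I(w))e_\ell$. $P_\ell$ is represented by an array with rows $r=0,\ldots,n-\ell$ and columns $c=0,\ldots,\ell-1$,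 whose $(r,c)$ entry is the number $\ell+r-c$. This means $P_\ell$ has a basis $b_{r,c}$ indexed by the array, with $b_{r,c}$ lying on the vertex $\ell+r-c$, the generator being $b_{0,0}$, and the arrow $x$ (resp. $y$) starting at that vertex sends $b_{r,c}$ to $b_{r+1,c}$ (resp. $b_{r,c+1}$), interpreted as $0$ if outside the array. Factor modules of $P_\ell$ correspond to subarrays closed under predecessors (if $(r,c)$ is in it then so are $(r-1,c)$ and $(r,c-1)$ whenever they are in the array): the factor module is the quotient by the span of the $b_{r,c}$ not in the subarray. A module $M$ is $\tau^-$-rigid if $\mathrm{Hom}_\Pi(\tau^-M,M)=0$, with $\tau^-$ the inverse Auslander–Reiten translation. *)

theory Defs
  imports Complex_Main "HOL-Combinatorics.Permutations" "HOL-Algebra.Algebra"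
begin

section \<open>Left modules over a not necessarily commutative ring\<close>

text \<open>The locale \<^locale>\<open>module\<close> of HOL-Algebra requires a commutative ring, so left modules over
  an arbitrary ring are axiomatised here on the same record type. Its fields \<^const>\<open>monoid.mult\<close> and
  \<^const>\<open>monoid.one\<close> play no role for modules and are left unspecified in the constructions
  below. Submodules are those of the library locale \<^locale>\<open>submodule\<close>, which does not refer to
  commutativity.\<close>

locale left_module = R?: ring R + M?: abelian_group M
    for R :: "('a, 'r) ring_scheme" (structure) and M :: "('a, 'm, 'q) module_scheme" (structure) +
  assumes smult_closed:
      "\<lbrakk>a \<in> carrier R; x \<in> carrier M\<rbrakk> \<Longrightarrow> a \<odot>\<^bsub>M\<^esub> x \<in> carrier M"
    and smult_l_distr:
      "\<lbrakk>a \<in> carrier R; b \<in> carrier R; x \<in> carrier M\<rbrakk> \<Longrightarrow>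
        (a \<oplus> b) \<odot>\<^bsub>M\<^esub> x = a \<odot>\<^bsub>M\<^esub> x \<oplus>\<^bsub>M\<^esub> b \<odot>\<^bsub>M\<^esub> x"
    and smult_r_distr:
      "\<lbrakk>a \<in> carrier R; x \<in> carrier M; y \<in> carrier M\<rbrakk> \<Longrightarrow>
        a \<odot>\<^bsub>M\<^esub> (x \<oplus>\<^bsub>M\<^esub> y) = a \<odot>\<^bsub>M\<^esub> x \<oplus>\<^bsub>M\<^esub> a \<odot>\<^bsub>M\<^esub> y"
    and smult_assoc1:
      "\<lbrakk>a \<in> carrier R; b \<in> carrier R; x \<in> carrier M\<rbrakk> \<Longrightarrow>
        (a \<otimes> b) \<odot>\<^bsub>M\<^esub> x = a \<odot>\<^bsub>M\<^esub> (b \<odot>\<^bsub>M\<^esub> x)"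
    and smult_one: "x \<in> carrier M \<Longrightarrow> \<one> \<odot>\<^bsub>M\<^esub> x = x"

text \<open>Homomorphisms are taken to be undefined outside the carrier, so that a homomorphism is
  determined by its values on the carrier and Hom-sets can serve as carriers.\<close>

definition left_hom ::
  "('a, 'r) ring_scheme \<Rightarrow> ('a, 'm) module \<Rightarrow> ('a, 'n) module \<Rightarrow> ('m \<Rightarrow> 'n) set" where
  "left_hom R M N = {f \<in> carrier M \<rightarrow>\<^sub>E carrier N.
     (\<forall>x \<in> carrier M. \<forall>y \<in> carrier M. f (x \<oplus>\<^bsub>M\<^esub> y) = f x \<oplus>\<^bsub>N\<^esub> f y) \<and>
     (\<forall>a \<in> carrier R. \<forall>x \<in> carrier M. f (a \<odot>\<^bsub>M\<^esub> x) = a \<odot>\<^bsub>N\<^esub> f x)}"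

definition left_iso ::
  "('a, 'r) ring_scheme \<Rightarrow> ('a, 'm) module \<Rightarrow> ('a, 'n) module \<Rightarrow> ('m \<Rightarrow> 'n) set" where
  "left_iso R M N = {f \<in> left_hom R M N. bij_betw f (carrier M) (carrier N)}"

definition hom_vanishes ::
  "('a, 'r) ring_scheme \<Rightarrow> ('a, 'm) module \<Rightarrow> ('a, 'n) module \<Rightarrow> bool" where
  "hom_vanishes R M N \<longleftrightarrow> (\<forall>f \<in> left_hom R M N. \<forall>x \<in> carrier M. f x = \<zero>\<^bsub>N\<^esub>)"

definition quot_module :: "('a, 'm) module \<Rightarrow> 'm set \<Rightarrow> ('a, 'm set) module" where
  "quot_module M U =
    \<lparr>carrier = a_rcosets\<^bsub>M\<^esub> U, monoid.mult = undefined, monoid.one = undefined, ring.zero = U, ring.add = set_add M,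
     smult = (\<lambda>a C. \<Union>x\<in>C. U +>\<^bsub>M\<^esub> (a \<odot>\<^bsub>M\<^esub> x))\<rparr>"

definition regular_module :: "'a ring \<Rightarrow> ('a, 'a) module" where
  "regular_module R =
    \<lparr>carrier = carrier R, monoid.mult = undefined, monoid.one = undefined, ring.zero = \<zero>\<^bsub>R\<^esub>, ring.add = (\<oplus>\<^bsub>R\<^esub>),
     smult = (\<otimes>\<^bsub>R\<^esub>)\<rparr>"

definition free_module :: "'a ring \<Rightarrow> nat \<Rightarrow> ('a, nat \<Rightarrow> 'a) module" where
  "free_module R m =
    \<lparr>carrier = {..<m} \<rightarrow>\<^sub>E carrier R, monoid.mult = undefined, monoid.one = undefined,
     ring.zero = (\<lambda>i\<in>{..<m}. \<zero>\<^bsub>R\<^esub>), ring.add = (\<lambda>u v. \<lambda>i\<in>{..<m}. u i \<oplus>\<^bsub>R\<^esub> v i),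
     smult = (\<lambda>a u. \<lambda>i\<in>{..<m}. a \<otimes>\<^bsub>R\<^esub> u i)\<rparr>"

definition indecomposable_module :: "'a ring \<Rightarrow> ('a, 'm) module \<Rightarrow> bool" where
  "indecomposable_module R M \<longleftrightarrow> carrier M \<noteq> {\<zero>\<^bsub>M\<^esub>} \<and>
    (\<forall>U V. submodule U R M \<and> submodule V R M \<and> U \<inter> V = {\<zero>\<^bsub>M\<^esub>} \<and> U <+>\<^bsub>M\<^esub> V = carrier M
       \<longrightarrow> U = {\<zero>\<^bsub>M\<^esub>} \<or> V = {\<zero>\<^bsub>M\<^esub>})"

section \<open>The inverse Auslander-Reiten translation\<close>

text \<open>Right modules over \<open>R\<close> are left modules over the opposite ring.\<close>

definition op_ring :: "'a ring \<Rightarrow> 'a ring" where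
  "op_ring R = R\<lparr>monoid.mult := (\<lambda>a b. b \<otimes>\<^bsub>R\<^esub> a)\<rparr>"

text \<open>Finitely generated projective modules: direct summands of \<open>R\<^sup>m\<close>.\<close>

definition fg_projective :: "'a ring \<Rightarrow> ('a, 'p) module \<Rightarrow> bool" where
  "fg_projective R P \<longleftrightarrow> left_module R P \<and>
    (\<exists>m. \<exists>s \<in> left_hom R P (free_module R m). \<exists>p \<in> left_hom R (free_module R m) P.
       \<forall>x \<in> carrier P. p (s x) = x)"

definition superfluous :: "'a ring \<Rightarrow> ('a, 'm) module \<Rightarrow> 'm set \<Rightarrow> bool" where
  "superfluous R M K \<longleftrightarrow> submodule K R M \<and>
    (\<forall>U. submodule U R M \<and> U <+>\<^bsub>M\<^esub> K = carrier M \<longrightarrow> U = carrier M)"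

definition hom_kernel :: "('a, 'm) module \<Rightarrow> ('a, 'n) module \<Rightarrow> ('m \<Rightarrow> 'n) \<Rightarrow> 'm set" where
  "hom_kernel M N f = {x \<in> carrier M. f x = \<zero>\<^bsub>N\<^esub>}"

text \<open>An exact sequence \<open>P1 \<rightarrow> P0 \<rightarrow> N \<rightarrow> 0\<close> in which \<open>\<pi> : P0 \<rightarrow> N\<close> and \<open>d : P1 \<rightarrow> ker \<pi>\<close> are
  projective covers.\<close>

definition min_proj_presentation ::
  "'a ring \<Rightarrow> ('a, 'p) module \<Rightarrow> ('a, 'q) module \<Rightarrow> ('p \<Rightarrow> 'q) \<Rightarrow> ('q \<Rightarrow> 'm) \<Rightarrow> ('a, 'm) module \<Rightarrow> bool"
  where
  "min_proj_presentation R P1 P0 d \<pi> N \<longleftrightarrow>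
     fg_projective R P1 \<and> fg_projective R P0 \<and>
     d \<in> left_hom R P1 P0 \<and> \<pi> \<in> left_hom R P0 N \<and>
     \<pi> ` carrier P0 = carrier N \<and>
     d ` carrier P1 = hom_kernel P0 N \<pi> \<and>
     superfluous R P0 (hom_kernel P0 N \<pi>) \<and>
     superfluous R P1 (hom_kernel P1 P0 d)"

text \<open>\<open>Hom\<^sub>R(P, R)\<close> with \<open>(f a)(x) = f(x) a\<close>; a left module over \<open>op_ring R\<close>.\<close>

definition ring_dual :: "'a ring \<Rightarrow> ('a, 'p) module \<Rightarrow> ('a, 'p \<Rightarrow> 'a) module" where
  "ring_dual R P =
    \<lparr>carrier = left_hom R P (regular_module R), monoid.mult = undefined, monoid.one = undefined,
     ring.zero = (\<lambda>x\<in>carrier P. \<zero>\<^bsub>R\<^esub>), ring.add = (\<lambda>f g. \<lambda>x\<in>carrier P. f x \<oplus>\<^bsub>R\<^esub> g x),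
     smult = (\<lambda>a f. \<lambda>x\<in>carrier P. f x \<otimes>\<^bsub>R\<^esub> a)\<rparr>"

text \<open>\<open>T = Tr N\<close> is the cokernel of \<open>Hom\<^sub>R(d, R) : Hom\<^sub>R(P0, R) \<rightarrow> Hom\<^sub>R(P1, R)\<close>. It is determined by
  \<open>N\<close> up to isomorphism only, hence a relation. The terms of a presentation can be taken as
  submodules of free modules \<open>R\<^sup>m\<close>, so fixing their element type to \<open>nat \<Rightarrow> 'a\<close> loses nothing.\<close>

definition is_transpose ::
  "'a ring \<Rightarrow> ('a, 'm) module \<Rightarrow> ('a, ((nat \<Rightarrow> 'a) \<Rightarrow> 'a) set) module \<Rightarrow> bool" where
  "is_transpose R N T \<longleftrightarrow>
    (\<exists>(P1 :: ('a, nat \<Rightarrow> 'a) module) (P0 :: ('a, nat \<Rightarrow> 'a) module) d \<pi>.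
       min_proj_presentation R P1 P0 d \<pi> N \<and>
       T = quot_module (ring_dual R P1)
             ((\<lambda>f. compose (carrier P1) f d) ` carrier (ring_dual R P0)))"

text \<open>\<open>D M = Hom\<^sub>k(M, k)\<close> with \<open>(\<phi> a)(m) = \<phi>(a m)\<close>; a left module over the opposite of the algebra.
  Here \<open>\<eta> : k \<rightarrow> R\<close> is the structure map of the algebra, through which \<open>k\<close> acts on modules.\<close>

definition k_dual :: "('k::field \<Rightarrow> 'a) \<Rightarrow> ('a, 'm) module \<Rightarrow> ('a, 'm \<Rightarrow> 'k) module" where
  "k_dual \<eta> M =
    \<lparr>carrier = {\<phi> \<in> extensional (carrier M).
       (\<forall>x \<in> carrier M. \<forall>y \<in> carrier M. \<phi> (x \<oplus>\<^bsub>M\<^esub> y) = \<phi> x + \<phi> y) \<and>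
       (\<forall>c. \<forall>x \<in> carrier M. \<phi> (\<eta> c \<odot>\<^bsub>M\<^esub> x) = c * \<phi> x)},
     monoid.mult = undefined, monoid.one = undefined,
     ring.zero = (\<lambda>x\<in>carrier M. 0), ring.add = (\<lambda>\<phi> \<psi>. \<lambda>x\<in>carrier M. \<phi> x + \<psi> x),
     smult = (\<lambda>a \<phi>. \<lambda>x\<in>carrier M. \<phi> (a \<odot>\<^bsub>M\<^esub> x))\<rparr>"

text \<open>\<open>\<tau>\<^sup>- M = Tr D M\<close>, again up to isomorphism. In the definition of rigidity the choice
  of the representative \<open>T\<close> is irrelevant.\<close>

definition is_tau_inverse ::
  "'a ring \<Rightarrow> ('k::field \<Rightarrow> 'a) \<Rightarrow> ('a, 'm) module
     \<Rightarrow> ('a, ((nat \<Rightarrow> 'a) \<Rightarrow> 'a) set) module \<Rightarrow> bool" where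
  "is_tau_inverse R \<eta> M T \<longleftrightarrow> is_transpose (op_ring R) (k_dual \<eta> M) T"

definition tau_inverse_rigid ::
  "'a ring \<Rightarrow> ('k::field \<Rightarrow> 'a) \<Rightarrow> ('a, 'm) module \<Rightarrow> bool" where
  "tau_inverse_rigid R \<eta> M \<longleftrightarrow> (\<exists>T. is_tau_inverse R \<eta> M T \<and> hom_vanishes R T M)"

section \<open>The preprojective algebra of type A\<close>

text \<open>\<open>ArrX i\<close> is the arrow \<open>x\<^sub>i : i \<rightarrow> i + 1\<close> and \<open>ArrY i\<close> the arrow \<open>y\<^sub>i : i \<rightarrow> i - 1\<close>.\<close>

datatype arrow = ArrX nat | ArrY nat

fun source :: "arrow \<Rightarrow> nat" where
  "source (ArrX i) = i"
| "source (ArrY i) = i"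

fun target :: "arrow \<Rightarrow> nat" where
  "target (ArrX i) = i + 1"
| "target (ArrY i) = i - 1"

definition arrows :: "nat \<Rightarrow> arrow set" where
  "arrows n = ArrX ` {1..<n} \<union> ArrY ` {2..n}"

text \<open>A path is its start vertex together with the list of its arrows in the order in which they
  are traversed (that is, read from left to right).\<close>

type_synonym path = "nat \<times> arrow list"

fun is_path :: "nat \<Rightarrow> path \<Rightarrow> bool" where
  "is_path n (i, []) \<longleftrightarrow> 1 \<le> i \<and> i \<le> n"
| "is_path n (i, a # as) \<longleftrightarrow> a \<in> arrows n \<and> source a = i \<and> is_path n (target a, as)"

definition path_end :: "path \<Rightarrow> nat" where
  "path_end p = (if snd p = [] then fst p else target (last (snd p)))"

definition path_vec :: "path \<Rightarrow> path \<Rightarrow> 'k::field" where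
  "path_vec p = (\<lambda>q. if q = p then 1 else 0)"

text \<open>The product \<open>f g\<close> of two paths is the path \<open>g\<close> followed by the path \<open>f\<close>. With this convention a
  left module is the same thing as a representation of the quiver: an arrow \<open>a : i \<rightarrow> j\<close> acts as a
  map \<open>e\<^sub>i M \<rightarrow> e\<^sub>j M\<close>. Since interchanging \<open>x\<^sub>i\<close> and \<open>y\<^bsub>i+1\<^esub>\<close> is an anti-automorphism of the
  preprojective algebra fixing all \<open>e\<^sub>i\<close>, the opposite convention gives an isomorphic algebra, with
  the same idempotents.\<close>

definition path_algebra :: "nat \<Rightarrow> (path \<Rightarrow> 'k::field) ring" where
  "path_algebra n =
    \<lparr>carrier = {f. finite {p. f p \<noteq> 0} \<and> {p. f p \<noteq> 0} \<subseteq> {p. is_path n p}},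
     monoid.mult = (\<lambda>f g p. \<Sum>j\<le>length (snd p).
        f (path_end (fst p, take j (snd p)), drop j (snd p)) * g (fst p, take j (snd p))),
     monoid.one = (\<lambda>p. if snd p = [] \<and> 1 \<le> fst p \<and> fst p \<le> n then 1 else 0),
     ring.zero = (\<lambda>p. 0),
     ring.add = (\<lambda>f g p. f p + g p)\<rparr>"

text \<open>For \<open>n = 1\<close> there are no arrows and hence no relations.\<close>

definition preproj_relations :: "nat \<Rightarrow> (path \<Rightarrow> 'k::field) set" where
  "preproj_relations n =
     (if n \<ge> 2 then {path_vec (1, [ArrX 1, ArrY 2]), path_vec (n, [ArrY n, ArrX (n - 1)])} else {}) \<union>
     {(\<lambda>p. path_vec (i, [ArrX i, ArrY (i + 1)]) p - path_vec (i, [ArrY i, ArrX (i - 1)]) p)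
        | i. 2 \<le> i \<and> i \<le> n - 1}"

definition relation_ideal :: "nat \<Rightarrow> (path \<Rightarrow> 'k::field) set" where
  "relation_ideal n = genideal (path_algebra n) (preproj_relations n)"

type_synonym 'k preproj_elem = "(path \<Rightarrow> 'k) set"

definition preproj :: "nat \<Rightarrow> 'k::field preproj_elem ring" where
  "preproj n = path_algebra n Quot relation_ideal n"

definition residue_class :: "nat \<Rightarrow> (path \<Rightarrow> 'k::field) \<Rightarrow> 'k preproj_elem" where
  "residue_class n f = relation_ideal n +>\<^bsub>path_algebra n\<^esub> f"

definition idem :: "nat \<Rightarrow> nat \<Rightarrow> 'k::field preproj_elem" where
  "idem n i = residue_class n (path_vec (i, []))"

definition arrow_elem :: "nat \<Rightarrow> arrow \<Rightarrow> 'k::field preproj_elem" where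
  "arrow_elem n a = residue_class n (path_vec (source a, [a]))"

definition scalar_elem :: "nat \<Rightarrow> 'k::field \<Rightarrow> 'k preproj_elem" where
  "scalar_elem n c = residue_class n (\<lambda>p. c * monoid.one (path_algebra n) p)"

definition proj_module :: "nat \<Rightarrow> nat \<Rightarrow> ('k::field preproj_elem, 'k preproj_elem) module" where
  "proj_module n l =
    (regular_module (preproj n))\<lparr>carrier := {a \<otimes>\<^bsub>preproj n\<^esub> idem n l | a. a \<in> carrier (preproj n)}\<rparr>"

section \<open>The symmetric group and the weak order\<close>

text \<open>Permutations of \<open>{1..n + 1}\<close> are functions on \<^typ>\<open>nat\<close> that are the identity elsewhere; the
  product is composition.\<close>

definition word_perm :: "nat list \<Rightarrow> nat \<Rightarrow> nat" where
  "word_perm is = foldr (\<lambda>i u. transpose i (i + 1) \<circ> u) is id"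

definition coxeter_length :: "nat \<Rightarrow> (nat \<Rightarrow> nat) \<Rightarrow> nat" where
  "coxeter_length n w = (LEAST m. \<exists>is. set is \<subseteq> {1..n} \<and> length is = m \<and> word_perm is = w)"

definition reduced_word :: "nat \<Rightarrow> nat list \<Rightarrow> (nat \<Rightarrow> nat) \<Rightarrow> bool" where
  "reduced_word n is w \<longleftrightarrow>
     set is \<subseteq> {1..n} \<and> word_perm is = w \<and> length is = coxeter_length n w"

definition weak_ge :: "nat \<Rightarrow> (nat \<Rightarrow> nat) \<Rightarrow> (nat \<Rightarrow> nat) \<Rightarrow> bool" where
  "weak_ge n u v \<longleftrightarrow> u permutes {1..n + 1} \<and> v permutes {1..n + 1} \<and>
     coxeter_length n u = coxeter_length n v + coxeter_length n (inv_into UNIV v \<circ> u)"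

definition weak_covers :: "nat \<Rightarrow> (nat \<Rightarrow> nat) \<Rightarrow> (nat \<Rightarrow> nat) \<Rightarrow> bool" where
  "weak_covers n u v \<longleftrightarrow> weak_ge n u v \<and> u \<noteq> v \<and>
     (\<forall>t. weak_ge n u t \<and> weak_ge n t v \<longrightarrow> t = u \<or> t = v)"

definition join_irreducible_perm :: "nat \<Rightarrow> (nat \<Rightarrow> nat) \<Rightarrow> bool" where
  "join_irreducible_perm n w \<longleftrightarrow> w permutes {1..n + 1} \<and> (\<exists>!v. weak_covers n w v)"

definition of_type :: "nat \<Rightarrow> (nat \<Rightarrow> nat) \<Rightarrow> nat \<Rightarrow> bool" where
  "of_type n w l \<longleftrightarrow> l \<in> {1..n} \<and>
     strict_mono_on {1..l} w \<and> w l > w (l + 1) \<and> strict_mono_on {l + 1..n + 1} w"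

section \<open>The ideals \<open>I(w)\<close> and the modules \<open>J(w)\<close>\<close>

definition vertex_ideal :: "nat \<Rightarrow> nat \<Rightarrow> 'k::field preproj_elem set" where
  "vertex_ideal n i = genideal (preproj n) {\<one>\<^bsub>preproj n\<^esub> \<ominus>\<^bsub>preproj n\<^esub> idem n i}"

definition word_ideal :: "nat \<Rightarrow> nat list \<Rightarrow> 'k::field preproj_elem set" where
  "word_ideal n is =
     foldr (\<lambda>i K. ideal_prod (preproj n) (vertex_ideal n i) K) is (carrier (preproj n))"

text \<open>The ideal does not depend on the choice of the reduced word.\<close>

definition perm_ideal :: "nat \<Rightarrow> (nat \<Rightarrow> nat) \<Rightarrow> 'k::field preproj_elem set" where
  "perm_ideal n w = word_ideal n (SOME is. reduced_word n is w)"

text \<open>\<open>(\<Pi>/I(w)) e\<^sub>l\<close>, on which \<open>\<Pi>\<close> acts through \<open>\<Pi> \<rightarrow> \<Pi>/I(w)\<close>.\<close>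

definition J_module ::
  "nat \<Rightarrow> (nat \<Rightarrow> nat) \<Rightarrow> nat \<Rightarrow> ('k::field preproj_elem, 'k preproj_elem set) module" where
  "J_module n w l =
    (let A = preproj n; I = perm_ideal n w; B = A Quot I
     in \<lparr>carrier = {C \<otimes>\<^bsub>B\<^esub> (I +>\<^bsub>A\<^esub> idem n l) | C. C \<in> carrier B},
         monoid.mult = undefined, monoid.one = undefined, ring.zero = \<zero>\<^bsub>B\<^esub>, ring.add = (\<oplus>\<^bsub>B\<^esub>),
         smult = (\<lambda>a C. (I +>\<^bsub>A\<^esub> a) \<otimes>\<^bsub>B\<^esub> C)\<rparr>)"

section \<open>Arrays\<close>

definition proj_array :: "nat \<Rightarrow> nat \<Rightarrow> (nat \<times> nat) set" where
  "proj_array n l = {(r, c). r \<le> n - l \<and> c < l}"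

text \<open>The basis vector \<open>b\<^bsub>r,c\<^esub>\<close> of \<open>P\<^sub>l\<close>: the class of the path starting at \<open>l\<close> that traverses \<open>c\<close>
  arrows \<open>y\<close> and then \<open>r\<close> arrows \<open>x\<close>, ending at \<open>l + r - c\<close>.\<close>

definition array_vec :: "nat \<Rightarrow> nat \<Rightarrow> nat \<times> nat \<Rightarrow> 'k::field preproj_elem" where
  "array_vec n l = (\<lambda>(r, c). residue_class n (path_vec
     (l, map (\<lambda>j. ArrY (l - j)) [0..<c] @ map (\<lambda>j. ArrX (l - c + j)) [0..<r])))"

definition pred_closed_subarray :: "nat \<Rightarrow> nat \<Rightarrow> (nat \<times> nat) set \<Rightarrow> bool" where
  "pred_closed_subarray n l Y \<longleftrightarrow> Y \<subseteq> proj_array n l \<and>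
     (\<forall>r c. (r + 1, c) \<in> Y \<longrightarrow> (r, c) \<in> Y) \<and> (\<forall>r c. (r, c + 1) \<in> Y \<longrightarrow> (r, c) \<in> Y)"

definition k_span ::
  "('k::field \<Rightarrow> 'a) \<Rightarrow> ('a, 'm) module \<Rightarrow> 'i set \<Rightarrow> ('i \<Rightarrow> 'm) \<Rightarrow> 'm set" where
  "k_span \<eta> M S b = {(\<Oplus>\<^bsub>M\<^esub>s\<in>S. \<eta> (c s) \<odot>\<^bsub>M\<^esub> b s) | c. True}"

definition is_k_basis ::
  "('k::field \<Rightarrow> 'a) \<Rightarrow> ('a, 'm) module \<Rightarrow> 'i set \<Rightarrow> ('i \<Rightarrow> 'm) \<Rightarrow> bool" where
  "is_k_basis \<eta> M S b \<longleftrightarrow> finite S \<and> b ` S \<subseteq> carrier M \<and>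
     (\<forall>x \<in> carrier M. \<exists>!c. c \<in> S \<rightarrow>\<^sub>E UNIV \<and> x = (\<Oplus>\<^bsub>M\<^esub>s\<in>S. \<eta> (c s) \<odot>\<^bsub>M\<^esub> b s))"

text \<open>The kernel of the projection from \<open>P\<^sub>l\<close> onto its factor module given by the subarray \<open>Y\<close>.\<close>

definition array_kernel :: "nat \<Rightarrow> nat \<Rightarrow> (nat \<times> nat) set \<Rightarrow> 'k::field preproj_elem set" where
  "array_kernel n l Y =
     k_span (scalar_elem n) (proj_module n l) (proj_array n l - Y) (array_vec n l)"

definition array_factor ::
  "nat \<Rightarrow> nat \<Rightarrow> (nat \<times> nat) set \<Rightarrow> ('k::field preproj_elem, 'k preproj_elem set) module" where
  "array_factor n l Y = quot_module (proj_module n l) (array_kernel n l Y)"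

text \<open>The module \<open>M\<close> is represented by the subarray \<open>Y\<close> (of the array of \<open>P\<^sub>l\<close>) by means of the
  basis \<open>b\<close>.\<close>

definition represented_by_array ::
  "nat \<Rightarrow> nat \<Rightarrow> (nat \<times> nat) set \<Rightarrow> ('k::field preproj_elem, 'm) module \<Rightarrow> (nat \<times> nat \<Rightarrow> 'm) \<Rightarrow> bool"
  where
  "represented_by_array n l Y M b \<longleftrightarrow>
     is_k_basis (scalar_elem n :: 'k \<Rightarrow> 'k preproj_elem) M Y b \<and>
     (\<forall>r c. (r, c) \<in> Y \<longrightarrow>
        (let v = l + r - c in
           idem n v \<odot>\<^bsub>M\<^esub> b (r, c) = b (r, c) \<and>
           (v < n \<longrightarrow> arrow_elem n (ArrX v) \<odot>\<^bsub>M\<^esub> b (r, c) =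
              (if (r + 1, c) \<in> Y then b (r + 1, c) else \<zero>\<^bsub>M\<^esub>)) \<and>
           (1 < v \<longrightarrow> arrow_elem n (ArrY v) \<odot>\<^bsub>M\<^esub> b (r, c) =
              (if (r, c + 1) \<in> Y then b (r, c + 1) else \<zero>\<^bsub>M\<^esub>))))"

text \<open>The row \<open>r\<close> starts at \<open>m - 1\<close> for \<open>m = l + 1 + r\<close>; its entries \<open>m - 1 - c\<close> are kept as long as
  they are at least \<open>w m\<close>.\<close>

definition J_array :: "nat \<Rightarrow> nat \<Rightarrow> (nat \<Rightarrow> nat) \<Rightarrow> (nat \<times> nat) set" where
  "J_array n l w =
     {(m - 1 - l, c) | m c. m \<in> {l + 1..n + 1} \<and> c < l \<and> w m \<le> m - 1 - c}"

end

theory Submission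
  imports Defs
begin

text \<open>The algebra \<open>\<Pi>\<close> has a basis of monomials, one for each vertex \<open>s\<close> and each position \<open>(a, b)\<close> in the
  array of \<open>P\<^sub>s\<close>; products of basis elements are basis elements or zero. In these coordinates \<open>I\<^sub>i\<close> is the
  set of elements with vanishing coefficient at \<open>e\<^sub>i\<close>, so multiplying a monomial ideal by \<open>I\<^sub>i\<close> adds to
  the corresponding arrays the addable boxes at the vertex \<open>i\<close>. The boundary path of such an array is a subset of
  \<open>{1, \<dots>, n + 1}\<close>, on which adding boxes at \<open>i\<close> is a 0-Hecke operator; along a reduced word of \<open>w\<close> the
  subset \<open>{l + 1, \<dots>, n + 1}\<close> is therefore carried to its image under \<open>w\<close>, which is the array claimed for \<open>J(w)\<close>.

  Every submodule of \<open>P\<^sub>l\<close> is spanned by basis elements, because the part of \<open>P\<^sub>l\<close> at a vertex is uniserial over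
  the polynomials in \<open>xy\<close>. So a factor module \<open>M\<close> is given by a staircase with corners
  \<open>\<kappa>\<^sub>1, \<dots>, \<kappa>\<^sub>p\<close>. The dual \<open>D M\<close> has the minimal presentation \<open>P1 \<rightarrow> P0 \<rightarrow> D M\<close> with one
  generator for each corner and one relation for each addable box, which identifies the multiples of two neighbouring corners.
  A homomorphism from \<open>\<tau>\<^sup>- M\<close> to \<open>M\<close> is a family of elements \<open>m\<^sub>i\<close> of \<open>M\<close> at the vertices of the addable boxes
  with \<open>y\<^sup>b m\<^bsub>j + 1\<^esub> = x\<^sup>a m\<^sub>j\<close> for every corner, with exponents read off the staircase. There is no room for \<open>m\<^sub>0\<close>, and the power of \<open>y\<close>
  acts injectively, so all \<open>m\<^sub>i\<close> vanish.\<close>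



section \<open>The path algebra\<close>

text \<open>That the monomials span \<open>\<Pi>\<close> is a rewriting argument; the obstacle is
  their independence, since the ideal of relations is known only by generators. It is met by an
  invariant: for a start vertex \<open>s\<close>, the sum of the coefficients of all paths with
  \<open>a\<close> arrows x and \<open>b\<close> arrows y. For \<open>s + a \<le> n\<close> and
  \<open>b < s\<close> these sums multiply by convolution and kill the relations, hence the ideal.
  Elements of \<open>\<Pi>\<close> thereby become functions on a finite set of triples. Rigidity is
  stated through a minimal projective presentation. One presentation is enough, because the
  definition asks for some representative of tau^- M, but it should not depend on the position of
  the staircase in the array of P_l. So every addable box contributes a summand to P1, including the
  two on the axes; when such a box lies outside of the array, the summand is zero. Exactness at P0
  then splits into one question for each position of the plane: a finite sequence of coefficients
  has to be written as a sequence of differences.\<close>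

definition single :: "'k::field \<Rightarrow> path \<Rightarrow> path \<Rightarrow> 'k" where
  "single c p = (\<lambda>q. if q = p then c else 0)"

lemma path_vec_single: "path_vec p = single 1 p"
  by (simp add: path_vec_def single_def)

lemma path_end_Nil [simp]: "path_end (i, []) = i"
  by (simp add: path_end_def)

lemma path_end_Cons [simp]: "path_end (i, a # as) = path_end (target a, as)"
  by (simp add: path_end_def)

lemma path_end_append: "path_end (i, as @ bs) = path_end (path_end (i, as), bs)"
  by (induction as arbitrary: i) auto

lemma is_path_append:
  "is_path n (i, as @ bs) \<longleftrightarrow> is_path n (i, as) \<and> is_path n (path_end (i, as), bs)"
proof (induction as arbitrary: i)
  case Nil
  have "is_path n (i, bs) \<Longrightarrow> 1 \<le> i \<and> i \<le> n"
    by (cases bs) (auto simp: arrows_def)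
  then show ?case by auto
qed auto

lemma is_path_start: "is_path n (i, as) \<Longrightarrow> 1 \<le> i \<and> i \<le> n"
  by (cases as) (auto simp: arrows_def)

lemma is_path_arrows: "is_path n (i, as) \<Longrightarrow> set as \<subseteq> arrows n"
  by (induction as arbitrary: i) auto

lemma is_path_end: "is_path n (i, as) \<Longrightarrow> 1 \<le> path_end (i, as) \<and> path_end (i, as) \<le> n"
  by (induction as arbitrary: i) (auto dest: is_path_start)

lemma single_mult:
  "single c p \<otimes>\<^bsub>path_algebra n\<^esub> single d q =
     (if path_end q = fst p then single (c * d) (fst q, snd q @ snd p) else (\<lambda>_. 0))" (is "?l = ?r")
proof
  fix r :: path
  obtain i as where r: "r = (i, as)" by (cases r)
  obtain pi ps where p: "p = (pi, ps)" by (cases p)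
  obtain qi qs where q: "q = (qi, qs)" by (cases q)
  define m where "m = length qs"
  let ?f = "\<lambda>j. single c p (path_end (i, take j as), drop j as) * single d q (i, take j as)"
  \<comment> \<open>The second factor is non-zero only if the first \<open>j\<close> arrows of the
    path are \<open>qs\<close>, so the cut can only be at \<open>m = length qs\<close>.\<close>
  have "?f j = (if j = m then ?f m else 0)" if "j \<le> length as" for j
    using that by (auto simp: single_def q m_def)
  then have "(\<Sum>j\<le>length as. ?f j) = (\<Sum>j\<le>length as. if j = m then ?f m else 0)"
    by (intro sum.cong) auto
  also have "\<dots> = (if m \<le> length as then ?f m else 0)" by simp
  also have "\<dots> = ?r r"
    by (auto simp: single_def p q r m_def) (metis append_take_drop_id)+
  finally show "?l r = ?r r" by (simp add: path_algebra_def r)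
qed

lemma path_algebra_simps:
  "carrier (path_algebra n) = {f. finite {p. f p \<noteq> 0} \<and> {p. f p \<noteq> 0} \<subseteq> {p. is_path n p}}"
  "\<zero>\<^bsub>path_algebra n\<^esub> = (\<lambda>p. 0)"
  "f \<oplus>\<^bsub>path_algebra n\<^esub> g = (\<lambda>p. f p + g p)"
  "\<one>\<^bsub>path_algebra n\<^esub> = (\<lambda>p. if snd p = [] \<and> 1 \<le> fst p \<and> fst p \<le> n then 1 else 0)"
  by (simp_all add: path_algebra_def)

lemma single_carrier: "is_path n p \<or> c = 0 \<Longrightarrow> single c p \<in> carrier (path_algebra n)"
  by (auto simp: path_algebra_simps single_def)

lemma zero_carrier: "(\<lambda>p. 0) \<in> carrier (path_algebra n)"
  by (auto simp: path_algebra_simps)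

lemma add_carrier:
  assumes "f \<in> carrier (path_algebra n)" "g \<in> carrier (path_algebra n)"
  shows "(\<lambda>p. f p + g p) \<in> carrier (path_algebra n)"
proof -
  have "{p. f p + g p \<noteq> 0} \<subseteq> {p. f p \<noteq> 0} \<union> {p. g p \<noteq> 0}" by auto
  then show ?thesis using assms by (auto simp: path_algebra_simps intro: finite_subset)
qed

text \<open>An element is a finite sum of scaled paths, so statements that are additive in an
  argument need only be checked on \<open>single c p\<close>. The induction runs over the
  support.\<close>

lemma path_algebra_induct [consumes 1, case_names zero add]:
  fixes f :: "path \<Rightarrow> 'k::field"
  assumes f: "f \<in> carrier (path_algebra n)"
    and zero: "P (\<lambda>p. 0)"
    and add: "\<And>c p g. is_path n p \<Longrightarrow> g \<in> carrier (path_algebra n) \<Longrightarrow> P g \<Longrightarrow>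
      P (\<lambda>q. single c p q + g q)"
  shows "P f"
proof -
  have "f \<in> carrier (path_algebra n) \<Longrightarrow> {p. f p \<noteq> 0} = A \<Longrightarrow> P f" if "finite A" for A f
    using that
  proof (induction A arbitrary: f rule: finite_induct)
    case empty
    then have "f = (\<lambda>p. 0)" by auto
    then show ?case using zero by simp
  next
    case (insert p A)
    define g where "g = f(p := 0)"
    have "f p \<noteq> 0" "is_path n p" using insert.prems by (auto simp: path_algebra_simps)
    have A: "{q. g q \<noteq> 0} = A" using insert by (auto simp: g_def)
    moreover have "g \<in> carrier (path_algebra n)"
      using insert unfolding path_algebra_simps by (simp add: A)
    ultimately have "P g" using insert.IH by blast
    moreover have "f = (\<lambda>q. single (f p) p q + g q)" by (auto simp: single_def g_def)
    ultimately show ?case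
      using add[OF \<open>is_path n p\<close> \<open>g \<in> _\<close>, of "f p"] by simp
  qed
  then show ?thesis using f by (auto simp: path_algebra_simps)
qed

lemma path_mult_add_left:
  "(\<lambda>p. f p + g p) \<otimes>\<^bsub>path_algebra n\<^esub> h = (\<lambda>p. (f \<otimes>\<^bsub>path_algebra n\<^esub> h) p + (g \<otimes>\<^bsub>path_algebra n\<^esub> h) p)"
  by (simp add: path_algebra_def distrib_right sum.distrib)

lemma path_mult_add_right:
  "h \<otimes>\<^bsub>path_algebra n\<^esub> (\<lambda>p. f p + g p) = (\<lambda>p. (h \<otimes>\<^bsub>path_algebra n\<^esub> f) p + (h \<otimes>\<^bsub>path_algebra n\<^esub> g) p)"
  by (simp add: path_algebra_def distrib_left sum.distrib)

lemma path_mult_zero: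
  "(\<lambda>p. 0) \<otimes>\<^bsub>path_algebra n\<^esub> h = (\<lambda>p. 0)" "h \<otimes>\<^bsub>path_algebra n\<^esub> (\<lambda>p. 0) = (\<lambda>p. 0)"
  by (simp_all add: path_algebra_def)

lemma path_mult_closed:
  assumes "f \<in> carrier (path_algebra n)" "g \<in> carrier (path_algebra n)"
  shows "f \<otimes>\<^bsub>path_algebra n\<^esub> g \<in> carrier (path_algebra n)"
  using assms(1)
proof (induction rule: path_algebra_induct)
  case zero
  then show ?case by (simp add: path_mult_zero zero_carrier)
next
  case (add c p h)
  have "single c p \<otimes>\<^bsub>path_algebra n\<^esub> g \<in> carrier (path_algebra n)"
    using assms(2)
  proof (induction rule: path_algebra_induct)
    case zero
    then show ?case by (simp add: path_mult_zero zero_carrier)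
  next
    case (add d q h)
    have "single c p \<otimes>\<^bsub>path_algebra n\<^esub> single d q \<in> carrier (path_algebra n)"
      using \<open>is_path n p\<close> \<open>is_path n q\<close>
      by (cases p; cases q) (auto simp: single_mult zero_carrier is_path_append intro!: single_carrier)
    then show ?case using add by (simp add: path_mult_add_right add_carrier)
  qed
  then show ?case using add by (simp add: path_mult_add_left add_carrier)
qed

text \<open>Both sides are additive in each factor; three nested inductions leave scaled paths,
  where the claim is associativity of concatenation.\<close>

lemma path_mult_assoc:
  fixes f g h :: "path \<Rightarrow> 'k::field"
  assumes "f \<in> carrier (path_algebra n)" "g \<in> carrier (path_algebra n)" "h \<in> carrier (path_algebra n)"
  shows "(f \<otimes>\<^bsub>path_algebra n\<^esub> g) \<otimes>\<^bsub>path_algebra n\<^esub> h = f \<otimes>\<^bsub>path_algebra n\<^esub> (g \<otimes>\<^bsub>path_algebra n\<^esub> h)"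
  using assms(1)
proof (induction rule: path_algebra_induct)
  case (add c p f')
  have "(single c p \<otimes>\<^bsub>path_algebra n\<^esub> g) \<otimes>\<^bsub>path_algebra n\<^esub> h = single c p \<otimes>\<^bsub>path_algebra n\<^esub> (g \<otimes>\<^bsub>path_algebra n\<^esub> h)"
    using assms(2)
  proof (induction rule: path_algebra_induct)
    case (add d q g')
    have "(single c p \<otimes>\<^bsub>path_algebra n\<^esub> single d q) \<otimes>\<^bsub>path_algebra n\<^esub> h
        = single c p \<otimes>\<^bsub>path_algebra n\<^esub> (single d q \<otimes>\<^bsub>path_algebra n\<^esub> h)"
      using assms(3)
    proof (induction rule: path_algebra_induct)
      case (add e r h')
      have "(single c p \<otimes>\<^bsub>path_algebra n\<^esub> single d q) \<otimes>\<^bsub>path_algebra n\<^esub> single e r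
        = single c p \<otimes>\<^bsub>path_algebra n\<^esub> (single d q \<otimes>\<^bsub>path_algebra n\<^esub> single e r)"
        by (cases p; cases q; cases r) (auto simp: single_mult path_mult_zero path_end_append mult.assoc)
      then show ?case using add by (simp add: path_mult_add_right)
    qed (simp add: path_mult_zero)
    then show ?case using add by (simp add: path_mult_add_right path_mult_add_left)
  qed (simp add: path_mult_zero)
  then show ?case using add by (simp add: path_mult_add_left)
qed (simp add: path_mult_zero)

lemma path_one_carrier: "\<one>\<^bsub>path_algebra n\<^esub> \<in> carrier (path_algebra n)"
proof -
  have "{p::path. snd p = [] \<and> 1 \<le> fst p \<and> fst p \<le> n} = (\<lambda>i. (i, [])) ` {1..n}" by force
  then have "finite {p::path. snd p = [] \<and> 1 \<le> fst p \<and> fst p \<le> n}" by simp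
  then show ?thesis by (auto simp: path_algebra_simps elim: finite_subset[rotated])
qed

lemma path_one_mult:
  assumes "f \<in> carrier (path_algebra n)"
  shows "\<one>\<^bsub>path_algebra n\<^esub> \<otimes>\<^bsub>path_algebra n\<^esub> f = f"
proof
  fix p :: path
  obtain i as where p: "p = (i, as)" by (cases p)
  let ?g = "\<lambda>j. (if drop j as = [] \<and> 1 \<le> path_end (i, take j as) \<and> path_end (i, take j as) \<le> n then 1 else 0)
     * f (i, take j as)"
  have "f (i, as) \<noteq> 0 \<Longrightarrow> 1 \<le> path_end (i, as) \<and> path_end (i, as) \<le> n"
    using assms by (auto simp: path_algebra_simps dest!: is_path_end)
  then have "(\<Sum>j\<le>length as. ?g j) = (\<Sum>j\<le>length as. if j = length as then f (i, as) else 0)"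
    by (intro sum.cong) auto
  then show "(\<one>\<^bsub>path_algebra n\<^esub> \<otimes>\<^bsub>path_algebra n\<^esub> f) p = f p"
    by (simp add: path_algebra_def p)
qed

lemma path_mult_one:
  assumes "f \<in> carrier (path_algebra n)"
  shows "f \<otimes>\<^bsub>path_algebra n\<^esub> \<one>\<^bsub>path_algebra n\<^esub> = f"
proof
  fix p :: path
  obtain i as where p: "p = (i, as)" by (cases p)
  let ?g = "\<lambda>j. f (path_end (i, take j as), drop j as) * (if take j as = [] \<and> 1 \<le> i \<and> i \<le> n then 1 else 0)"
  have "f (i, as) \<noteq> 0 \<Longrightarrow> 1 \<le> i \<and> i \<le> n"
    using assms by (auto simp: path_algebra_simps dest!: is_path_start)
  then have "(\<Sum>j\<le>length as. ?g j) = (\<Sum>j\<le>length as. if j = 0 then f (i, as) else 0)"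
    by (intro sum.cong) auto
  then show "(f \<otimes>\<^bsub>path_algebra n\<^esub> \<one>\<^bsub>path_algebra n\<^esub>) p = f p"
    by (simp add: path_algebra_def p)
qed

lemma ring_path_algebra: "ring (path_algebra n :: (path \<Rightarrow> 'k::field) ring)"
proof (rule ringI)
  show "abelian_group (path_algebra n :: (path \<Rightarrow> 'k) ring)"
  proof (rule abelian_groupI)
    fix f :: "path \<Rightarrow> 'k" assume f: "f \<in> carrier (path_algebra n)"
    have "(\<lambda>p. - f p) \<in> carrier (path_algebra n)" using f by (simp add: path_algebra_simps)
    then show "\<exists>g\<in>carrier (path_algebra n). g \<oplus>\<^bsub>path_algebra n\<^esub> f = \<zero>\<^bsub>path_algebra n\<^esub>"
      by (force simp: path_algebra_simps(2,3))
  qed (auto simp: path_algebra_simps(2,3) add_carrier zero_carrier add.assoc add.commute)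
  show "Group.monoid (path_algebra n :: (path \<Rightarrow> 'k) ring)"
    by (rule monoidI)
       (auto simp: path_mult_closed path_one_carrier path_mult_assoc path_one_mult path_mult_one)
qed (auto simp: path_algebra_simps(3) path_mult_add_left path_mult_add_right)


section \<open>Coordinates on the preprojective algebra\<close>

lemma arrows_iff [simp]:
  "ArrX i \<in> arrows n \<longleftrightarrow> 1 \<le> i \<and> i < n" "ArrY i \<in> arrows n \<longleftrightarrow> 2 \<le> i \<and> i \<le> n"
  by (auto simp: arrows_def)

fun is_x :: "arrow \<Rightarrow> bool" where
  "is_x (ArrX i) = True"
| "is_x (ArrY i) = False"

definition num_x :: "arrow list \<Rightarrow> nat" where
  "num_x as = length (filter is_x as)"

definition num_y :: "arrow list \<Rightarrow> nat" where
  "num_y as = length (filter (Not \<circ> is_x) as)"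

lemma num_simps [simp]:
  "num_x [] = 0" "num_x (ArrX i # as) = Suc (num_x as)" "num_x (ArrY i # as) = num_x as"
  "num_y [] = 0" "num_y (ArrX i # as) = num_y as" "num_y (ArrY i # as) = Suc (num_y as)"
  "num_x (as @ bs) = num_x as + num_x bs" "num_y (as @ bs) = num_y as + num_y bs"
  by (simp_all add: num_x_def num_y_def)

lemma num_map [simp]:
  "num_x (map (\<lambda>j. ArrX (f j)) xs) = length xs" "num_x (map (\<lambda>j. ArrY (f j)) xs) = 0"
  "num_y (map (\<lambda>j. ArrX (f j)) xs) = 0" "num_y (map (\<lambda>j. ArrY (f j)) xs) = length xs"
  by (induction xs) auto

lemma length_num: "length as = num_x as + num_y as"
proof (induction as)
  case (Cons a as)
  then show ?case by (cases a) auto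
qed simp

text \<open>Every x raises the vertex by one and every y lowers it. The additive form keeps
  truncated subtraction out of later calculations.\<close>

lemma path_end_num: "is_path n (i, as) \<Longrightarrow> path_end (i, as) + num_y as = i + num_x as"
proof (induction as arbitrary: i)
  case (Cons a as)
  then show ?case by (cases a) (auto simp: arrows_def)
qed simp

text \<open>A start vertex \<open>s\<close> with a position of the array of P_s. The bounds say that
  \<open>a\<close> arrows x, and likewise \<open>b\<close> arrows y, can be followed from
  \<open>s\<close>; paths whose counts violate them turn out to be zero in
  \<open>\<Pi>\<close>.\<close>

definition box :: "nat \<Rightarrow> (nat \<times> nat \<times> nat) set" where
  "box n = {(s, a, b). 1 \<le> s \<and> s + a \<le> n \<and> b < s}"

definition paths_of :: "nat \<Rightarrow> nat \<Rightarrow> nat \<Rightarrow> nat \<Rightarrow> path set" where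
  "paths_of n s a b = {p. is_path n p \<and> fst p = s \<and> num_x (snd p) = a \<and> num_y (snd p) = b}"

lemma finite_paths_of: "finite (paths_of n s a b)"
proof (rule finite_subset)
  show "paths_of n s a b \<subseteq> {s} \<times> {as. set as \<subseteq> arrows n \<and> length as = a + b}"
    by (auto simp: paths_of_def length_num dest!: is_path_arrows)
  show "finite ({s} \<times> {as. set as \<subseteq> arrows n \<and> length as = a + b})"
    by (auto simp: arrows_def intro!: finite_lists_length_eq)
qed

text \<open>Paths with equal start and equal counts become equal in \<open>\<Pi>\<close>, so the
  coefficient of a residue class at a monomial can only be the sum over all of them.\<close>

definition path_coord :: "nat \<Rightarrow> (path \<Rightarrow> 'k::field) \<Rightarrow> nat \<Rightarrow> nat \<Rightarrow> nat \<Rightarrow> 'k" where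
  "path_coord n f s a b = (if (s, a, b) \<in> box n then \<Sum>p\<in>paths_of n s a b. f p else 0)"

lemma path_coord_add: "path_coord n (\<lambda>p. f p + g p) s a b = path_coord n f s a b + path_coord n g s a b"
  by (simp add: path_coord_def sum.distrib)

lemma path_coord_zero: "path_coord n (\<lambda>p. 0) s a b = 0"
  by (simp add: path_coord_def)

lemma path_coord_single:
  assumes "is_path n p"
  shows "path_coord n (single c p) s a b =
    (if (s, a, b) \<in> box n \<and> fst p = s \<and> num_x (snd p) = a \<and> num_y (snd p) = b then c else 0)"
proof -
  have "(\<Sum>q\<in>paths_of n s a b. single c p q) = (if p \<in> paths_of n s a b then c else 0)"
    by (simp add: single_def finite_paths_of)
  then show ?thesis using assms by (auto simp: path_coord_def paths_of_def)
qed

text \<open>\<open>G\<close> belongs to the part of the path that is traversed first; it ends at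
  \<open>s + a' - b'\<close>, where the part belonging to \<open>F\<close> starts.\<close>

definition conv :: "(nat \<Rightarrow> nat \<Rightarrow> nat \<Rightarrow> 'k::field) \<Rightarrow> (nat \<Rightarrow> nat \<Rightarrow> nat \<Rightarrow> 'k) \<Rightarrow> nat \<Rightarrow> nat \<Rightarrow> nat \<Rightarrow> 'k"
  where "conv F G s a b = (\<Sum>a'\<le>a. \<Sum>b'\<le>b. F (s + a' - b') (a - a') (b - b') * G s a' b')"

lemma conv_add:
  "conv (\<lambda>s a b. F s a b + F' s a b) G s a b = conv F G s a b + conv F' G s a b"
  "conv F (\<lambda>s a b. G s a b + G' s a b) s a b = conv F G s a b + conv F G' s a b"
  by (simp_all add: conv_def sum.distrib distrib_left distrib_right)

text \<open>Only the splitting at the counts of \<open>q\<close> can contribute. If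
  \<open>(s, a, b)\<close> is in the box then so are both parts of a splitting; outside of the box
  the left side is 0 by definition while the convolution need not be.\<close>

lemma path_coord_mult_single:
  fixes c d :: "'k::field"
  assumes "is_path n p" "is_path n q" "(s, a, b) \<in> box n"
  shows "path_coord n (single c p \<otimes>\<^bsub>path_algebra n\<^esub> single d q) s a b =
    conv (path_coord n (single c p)) (path_coord n (single d q)) s a b"
proof -
  obtain qi qs where q: "q = (qi, qs)" by (cases q)
  obtain pi ps where p: "p = (pi, ps)" by (cases p)
  define A where "A = num_x qs"
  define B where "B = num_y qs"
  let ?v = "path_coord n (single c p) (s + A - B) (a - A) (b - B) * path_coord n (single d q) s A B"
  have "conv (path_coord n (single c p)) (path_coord n (single d q)) s a b =
      (\<Sum>a'\<le>a. \<Sum>b'\<le>b. if a' = A then if b' = B then ?v else 0 else 0)"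
    unfolding conv_def
    by (intro sum.cong refl) (auto simp: path_coord_single[OF assms(2)[unfolded q]] q A_def B_def)
  also have "\<dots> = (\<Sum>a'\<le>a. if a' = A then (if B \<le> b then ?v else 0) else 0)"
    by (intro sum.cong) auto
  also have "\<dots> = (if A \<le> a \<and> B \<le> b then ?v else 0)" by simp
  also have "\<dots> = path_coord n (single c p \<otimes>\<^bsub>path_algebra n\<^esub> single d q) s a b"
  proof (cases "fst q = s \<and> path_end q = fst p \<and> num_x qs + num_x ps = a \<and> num_y qs + num_y ps = b")
    case True
    then have "is_path n (qi, qs @ ps)" using assms by (auto simp: is_path_append p q)
    moreover have "path_end q + B = s + A" using path_end_num[of n qi qs] assms(2) True by (auto simp: q A_def B_def)
    ultimately show ?thesis using assms True
      by (auto simp: single_mult path_coord_single p q A_def B_def box_def)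
  next
    case False
    have pe: "path_end q + B = s + A" if "qi = s"
      using path_end_num[of n qi qs] assms(2) that by (auto simp: q A_def B_def)
    have l: "path_coord n (single c p \<otimes>\<^bsub>path_algebra n\<^esub> single d q) s a b = 0"
    proof (cases "path_end q = fst p")
      case True
      then have "is_path n (qi, qs @ ps)" using assms by (simp add: is_path_append p q)
      then show ?thesis using False True by (auto simp: single_mult path_coord_single p q)
    qed (simp add: single_mult path_coord_zero)
    have "?v = 0" if "A \<le> a" "B \<le> b"
      using False assms(1,2) that pe by (auto simp: path_coord_single p q A_def B_def)
    then show ?thesis using l by simp
  qed
  finally show ?thesis by simp
qed

lemma path_coord_mult:
  fixes f g :: "path \<Rightarrow> 'k::field"
  assumes "f \<in> carrier (path_algebra n)" "g \<in> carrier (path_algebra n)" "(s, a, b) \<in> box n"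
  shows "path_coord n (f \<otimes>\<^bsub>path_algebra n\<^esub> g) s a b = conv (path_coord n f) (path_coord n g) s a b"
  using assms(1)
proof (induction rule: path_algebra_induct)
  case zero
  then show ?case by (simp add: path_mult_zero path_coord_zero conv_def)
next
  case (add c p f')
  have "path_coord n (single c p \<otimes>\<^bsub>path_algebra n\<^esub> g) s a b = conv (path_coord n (single c p)) (path_coord n g) s a b"
    using assms(2)
  proof (induction rule: path_algebra_induct)
    case zero
    then show ?case by (simp add: path_mult_zero path_coord_zero conv_def)
  next
    case (add d q g')
    then show ?case using path_coord_mult_single[OF \<open>is_path n p\<close> _ assms(3)]
      by (simp add: path_mult_add_right path_coord_add conv_add[abs_def])
  qed
  then show ?case using add by (simp add: path_mult_add_left path_coord_add conv_add[abs_def])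
qed

section \<open>Normal paths and the vanishing of the coordinates on the relations\<close>

definition normal_path :: "nat \<Rightarrow> nat \<Rightarrow> nat \<Rightarrow> path" where
  "normal_path s a b = (s, map (\<lambda>j. ArrY (s - j)) [0..<b] @ map (\<lambda>j. ArrX (s - b + j)) [0..<a])"

lemma array_vec_normal_path: "array_vec n l (r, c) = residue_class n (single 1 (normal_path l r c))"
  by (simp add: array_vec_def normal_path_def path_vec_single)

lemma normal_path_end: "b < s \<Longrightarrow> path_end (normal_path s a b) = s + a - b"
  by (induction a) (auto simp: normal_path_def path_end_def last_map)

lemma normal_path_Suc_x: "normal_path s (Suc a) b = (s, snd (normal_path s a b) @ [ArrX (s - b + a)])"
  by (simp add: normal_path_def)

lemma normal_path_Suc_y: "normal_path s 0 (Suc b) = (s, snd (normal_path s 0 b) @ [ArrY (s - b)])"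
  by (simp add: normal_path_def)

lemma fst_normal_path [simp]: "fst (normal_path s a b) = s"
  by (simp add: normal_path_def)

lemma num_normal_path [simp]:
  "num_x (snd (normal_path s a b)) = a" "num_y (snd (normal_path s a b)) = b"
  by (simp_all add: normal_path_def)

lemma is_path_normal_path: "(s, a, b) \<in> box n \<Longrightarrow> is_path n (normal_path s a b)"
proof (induction a)
  case 0
  then show ?case
  proof (induction b)
    case 0
    then show ?case by (simp add: normal_path_def box_def)
  next
    case (Suc b)
    then have "is_path n (s, snd (normal_path s 0 b))" and
      "path_end (s, snd (normal_path s 0 b)) = s - b"
      using normal_path_end[of b s 0] by (auto simp: box_def prod_eq_iff[symmetric] normal_path_def)
    then show ?case unfolding normal_path_Suc_y is_path_append
      using Suc.prems by (auto simp: box_def)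
  qed
next
  case (Suc a)
  then have "is_path n (s, snd (normal_path s a b))" and
      "path_end (s, snd (normal_path s a b)) = s + a - b"
    using normal_path_end[of b s a] by (auto simp: box_def normal_path_def)
  then show ?case unfolding normal_path_Suc_x is_path_append
    using Suc.prems by (auto simp: box_def)
qed

lemma preproj_relations_carrier: "preproj_relations n \<subseteq> carrier (path_algebra n :: (path \<Rightarrow> 'k::field) ring)"
proof
  fix f :: "path \<Rightarrow> 'k"
  assume "f \<in> preproj_relations n"
  then consider (ends) "n \<ge> 2" "f = single 1 (1, [ArrX 1, ArrY 2]) \<or> f = single 1 (n, [ArrY n, ArrX (n - 1)])"
    | (middle) i where "2 \<le> i" "i \<le> n - 1"
        "f = (\<lambda>p. single 1 (i, [ArrX i, ArrY (i + 1)]) p + single (- 1) (i, [ArrY i, ArrX (i - 1)]) p)"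
    by (force simp: preproj_relations_def path_vec_single single_def split: if_splits)
  then show "f \<in> carrier (path_algebra n)"
  proof cases
    case ends
    then show ?thesis by (auto simp: numeral_2_eq_2 intro!: single_carrier)
  next
    case middle
    then show ?thesis by (auto intro!: add_carrier single_carrier)
  qed
qed

text \<open>Coordinates multiply by convolution, and convolution with the zero function is zero.
  Once the relations are seen to lie in this ideal, so does everything they generate.\<close>

lemma ideal_path_coord_kernel:
  "ideal {f \<in> carrier (path_algebra n :: (path \<Rightarrow> 'k::field) ring). path_coord n f = (\<lambda>s a b. 0)} (path_algebra n)"
  (is "ideal ?K ?A")
proof (rule idealI[OF ring_path_algebra])
  interpret A: ring ?A by (rule ring_path_algebra)
  show "subgroup ?K (add_monoid ?A)"
  proof (rule A.add.subgroupI)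
    have "(\<lambda>p. 0) \<in> ?K" by (auto simp: zero_carrier path_coord_zero fun_eq_iff)
    then show "?K \<noteq> {}" by blast
    fix f assume f: "f \<in> ?K"
    have *: "\<ominus>\<^bsub>?A\<^esub> f = (\<lambda>p. - f p)"
      by (rule A.minus_equality) (use f in \<open>auto simp: path_algebra_simps\<close>)
    have "path_coord n (\<lambda>p. - f p) = (\<lambda>s a b. - path_coord n f s a b)"
      by (auto simp: path_coord_def fun_eq_iff sum_negf)
    moreover have "\<ominus>\<^bsub>?A\<^esub> f \<in> carrier ?A" using f by blast
    ultimately show "\<ominus>\<^bsub>?A\<^esub> f \<in> ?K" using f by (simp add: *)
  qed (auto simp: path_algebra_simps(3) add_carrier path_coord_add fun_eq_iff)
  fix f g assume f: "f \<in> ?K" and g: "g \<in> carrier ?A"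
  have out: "path_coord n h s a b = 0" if "(s, a, b) \<notin> box n" for h :: "path \<Rightarrow> 'k" and s a b
    using that by (simp add: path_coord_def)
  have "path_coord n (g \<otimes>\<^bsub>?A\<^esub> f) s a b = 0" "path_coord n (f \<otimes>\<^bsub>?A\<^esub> g) s a b = 0" for s a b
    using f g by (cases "(s, a, b) \<in> box n"; simp add: path_coord_mult out; simp add: conv_def)+
  then show "g \<otimes>\<^bsub>?A\<^esub> f \<in> ?K" "f \<otimes>\<^bsub>?A\<^esub> g \<in> ?K"
    using f g by (auto simp: path_mult_closed fun_eq_iff)
qed

text \<open>The two end relations are paths with counts \<open>(1, 1)\<close> starting at 1 or
  \<open>n\<close>, which are outside of the box; in a middle relation two paths with the same start
  and counts cancel.\<close>

lemma path_coord_relation: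
  fixes f :: "path \<Rightarrow> 'k::field"
  assumes "f \<in> preproj_relations n"
  shows "path_coord n f = (\<lambda>s a b. 0)"
proof -
  have ends: "path_coord n (single 1 (1, [ArrX 1, ArrY 2])) s a b = (0 :: 'k)"
    "path_coord n (single 1 (n, [ArrY n, ArrX (n - 1)])) s a b = (0 :: 'k)" if "n \<ge> 2" for s a b
    using that by (subst path_coord_single; auto simp: box_def numeral_2_eq_2)+
  have middle: "path_coord n (\<lambda>p. path_vec (i, [ArrX i, ArrY (i + 1)]) p - path_vec (i, [ArrY i, ArrX (i - 1)]) p :: 'k) s a b = 0"
    if "2 \<le> i" "i \<le> n - 1" for s a b i
  proof -
    have "(\<lambda>p. path_vec (i, [ArrX i, ArrY (i + 1)]) p - path_vec (i, [ArrY i, ArrX (i - 1)]) p :: 'k)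
        = (\<lambda>p. single 1 (i, [ArrX i, ArrY (i + 1)]) p + single (- 1) (i, [ArrY i, ArrX (i - 1)]) p)"
      by (auto simp: path_vec_single single_def)
    moreover have "is_path n (i, [ArrX i, ArrY (i + 1)])" "is_path n (i, [ArrY i, ArrX (i - 1)])"
      using that by auto
    ultimately show ?thesis by (simp only: path_coord_add) (simp add: path_coord_single)
  qed
  show ?thesis
  proof (intro ext)
    fix s a b
    show "path_coord n f s a b = 0"
      using assms ends[of s a b] middle[of _ s a b]
      by (auto simp: preproj_relations_def path_vec_single split: if_splits)
  qed
qed

lemma ideal_relation_ideal: "ideal (relation_ideal n) (path_algebra n :: (path \<Rightarrow> 'k::field) ring)"
  unfolding relation_ideal_def
  by (rule ring.genideal_ideal[OF ring_path_algebra preproj_relations_carrier])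

lemma path_coord_relation_ideal:
  assumes "f \<in> relation_ideal n"
  shows "path_coord n f = (\<lambda>s a b. 0)"
  using ring.genideal_minimal[OF ring_path_algebra ideal_path_coord_kernel, of "preproj_relations n" n] assms
    path_coord_relation preproj_relations_carrier
  by (force simp: relation_ideal_def)


section \<open>The quotient ring and the multiplication of monomials by arrows\<close>

lemma carrier_preproj: "carrier (preproj n) = residue_class n ` carrier (path_algebra n)"
  by (auto simp: preproj_def residue_class_def FactRing_def A_RCOSETS_def')

lemma ring_preproj: "ring (preproj n :: 'k::field preproj_elem ring)"
  unfolding preproj_def by (rule ideal.quotient_is_ring[OF ideal_relation_ideal])

lemma residue_class_hom:
  "residue_class n \<in> ring_hom (path_algebra n :: (path \<Rightarrow> 'k::field) ring) (preproj n)"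
  unfolding preproj_def using ideal.rcos_ring_hom[OF ideal_relation_ideal]
  by (simp add: residue_class_def[abs_def])

lemmas residue_class_simps = ring_hom_closed[OF residue_class_hom] ring_hom_mult[OF residue_class_hom]
  ring_hom_add[OF residue_class_hom] ring_hom_one[OF residue_class_hom]

lemma residue_class_zero: "residue_class n (\<lambda>p. 0) = \<zero>\<^bsub>preproj n\<^esub>"
  using ring_hom_zero[OF residue_class_hom ring_path_algebra ring_preproj]
  by (simp add: path_algebra_simps)

lemma residue_class_add: "f \<in> carrier (path_algebra n) \<Longrightarrow> g \<in> carrier (path_algebra n) \<Longrightarrow>
  residue_class n (\<lambda>p. f p + g p) = residue_class n f \<oplus>\<^bsub>preproj n\<^esub> residue_class n g"
  using residue_class_simps(3)[of f n g] by (simp add: path_algebra_simps(3))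

lemma residue_class_eq_iff:
  assumes "f \<in> carrier (path_algebra n)" "g \<in> carrier (path_algebra n)"
  shows "residue_class n f = residue_class n g \<longleftrightarrow> f \<ominus>\<^bsub>path_algebra n\<^esub> g \<in> relation_ideal n"
proof -
  interpret ideal "relation_ideal n" "path_algebra n" by (rule ideal_relation_ideal)
  show ?thesis unfolding residue_class_def
    using quotient_eq_iff_same_a_r_cos[OF is_ideal assms] by blast
qed

lemma residue_class_relation: "f \<in> relation_ideal n \<Longrightarrow> residue_class n f = \<zero>\<^bsub>preproj n\<^esub>"
  unfolding residue_class_def preproj_def FactRing_def
  by (simp add: ring.a_rcos_zero[OF ring_path_algebra ideal_relation_ideal])

lemma relation_mem: "f \<in> preproj_relations n \<Longrightarrow> f \<in> relation_ideal n"
  using ring.genideal_self[OF ring_path_algebra preproj_relations_carrier] by (auto simp: relation_ideal_def)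

lemma arrow_elem_single: "arrow_elem n a = residue_class n (single 1 (source a, [a]))"
  by (simp add: arrow_elem_def path_vec_single)

lemma is_path_source: "a \<in> arrows n \<Longrightarrow> is_path n (source a, [a])"
  by (cases a) auto

lemma arrow_elem_carrier: "a \<in> arrows n \<Longrightarrow> arrow_elem n a \<in> carrier (preproj n)"
  unfolding arrow_elem_single by (intro residue_class_simps single_carrier disjI1 is_path_source)

lemma arrow_elem_mult_path:
  assumes "is_path n (s, as)" "path_end (s, as) = source a" "a \<in> arrows n"
  shows "arrow_elem n a \<otimes>\<^bsub>preproj n\<^esub> residue_class n (single 1 (s, as)) =
    (residue_class n (single 1 (s, as @ [a])) :: 'k::field preproj_elem)"
proof -
  have "single 1 (source a, [a]) \<in> carrier (path_algebra n :: (path \<Rightarrow> 'k) ring)"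
    "single 1 (s, as) \<in> carrier (path_algebra n :: (path \<Rightarrow> 'k) ring)"
    using assms is_path_source by (auto intro!: single_carrier)
  from residue_class_simps(2)[OF this] show ?thesis
    using assms by (simp add: arrow_elem_single single_mult)
qed

lemma arrow_elem_mult:
  assumes "a \<in> arrows n" "b \<in> arrows n" "target b = source a"
  shows "arrow_elem n a \<otimes>\<^bsub>preproj n\<^esub> arrow_elem n b = residue_class n (single 1 (source b, [b, a]))"
  using arrow_elem_mult_path[of n "source b" "[b]" a] assms is_path_source[of b n]
  by (simp add: arrow_elem_single)

text \<open>The factors stand in the order opposite to the paths, because a product traverses its
  right factor first.\<close>

lemma arrow_relations:
  fixes n :: nat
  defines "x \<equiv> \<lambda>i. arrow_elem n (ArrX i) :: 'k::field preproj_elem" and "y \<equiv> \<lambda>i. arrow_elem n (ArrY i)"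
  shows "n \<ge> 2 \<Longrightarrow> y 2 \<otimes>\<^bsub>preproj n\<^esub> x 1 = \<zero>\<^bsub>preproj n\<^esub>"
    and "n \<ge> 2 \<Longrightarrow> x (n - 1) \<otimes>\<^bsub>preproj n\<^esub> y n = \<zero>\<^bsub>preproj n\<^esub>"
    and "2 \<le> i \<Longrightarrow> i + 1 \<le> n \<Longrightarrow> y (i + 1) \<otimes>\<^bsub>preproj n\<^esub> x i = x (i - 1) \<otimes>\<^bsub>preproj n\<^esub> y i"
proof -
  assume n: "n \<ge> 2"
  have "single 1 (1, [ArrX 1, ArrY 2]) \<in> (preproj_relations n :: (path \<Rightarrow> 'k) set)"
    "single 1 (n, [ArrY n, ArrX (n - 1)]) \<in> (preproj_relations n :: (path \<Rightarrow> 'k) set)"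
    using n by (auto simp: preproj_relations_def path_vec_single)
  from this[THEN relation_mem, THEN residue_class_relation]
  show "y 2 \<otimes>\<^bsub>preproj n\<^esub> x 1 = \<zero>\<^bsub>preproj n\<^esub>" "x (n - 1) \<otimes>\<^bsub>preproj n\<^esub> y n = \<zero>\<^bsub>preproj n\<^esub>"
    unfolding x_def y_def using n by (subst arrow_elem_mult; simp add: numeral_2_eq_2)+
next
  assume i: "2 \<le> i" "i + 1 \<le> n"
  let ?f = "single 1 (i, [ArrX i, ArrY (i + 1)]) :: path \<Rightarrow> 'k"
  let ?g = "single 1 (i, [ArrY i, ArrX (i - 1)]) :: path \<Rightarrow> 'k"
  interpret A: ring "path_algebra n :: (path \<Rightarrow> 'k) ring" by (rule ring_path_algebra)
  have c: "?f \<in> carrier (path_algebra n)" "?g \<in> carrier (path_algebra n)"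
    using i by (auto intro!: single_carrier)
  have inv: "\<ominus>\<^bsub>path_algebra n\<^esub> ?g = (\<lambda>p. - ?g p)"
    by (rule A.minus_equality) (use c in \<open>auto simp: path_algebra_simps\<close>)
  have "?f \<ominus>\<^bsub>path_algebra n\<^esub> ?g = (\<lambda>p. ?f p - ?g p)"
    unfolding a_minus_def inv by (simp add: path_algebra_simps)
  also have "\<dots> \<in> preproj_relations n"
    using i unfolding preproj_relations_def path_vec_single by (intro UnI2 CollectI exI[of _ i]) simp
  finally have "residue_class n ?f = residue_class n ?g"
    using residue_class_eq_iff[OF c] relation_mem by blast
  then show "y (i + 1) \<otimes>\<^bsub>preproj n\<^esub> x i = x (i - 1) \<otimes>\<^bsub>preproj n\<^esub> y i"
    unfolding x_def y_def using i by (subst (1 2) arrow_elem_mult) auto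
qed

text \<open>Being 0 outside of the box, it satisfies the same rule for multiplication by an arrow in
  the interior and at the border of the array.\<close>

definition normal_elem :: "nat \<Rightarrow> nat \<Rightarrow> nat \<Rightarrow> nat \<Rightarrow> 'k::field preproj_elem" where
  "normal_elem n s a b = (if (s, a, b) \<in> box n then residue_class n (single 1 (normal_path s a b))
     else \<zero>\<^bsub>preproj n\<^esub>)"

lemma normal_elem_carrier: "normal_elem n s a b \<in> carrier (preproj n :: 'k::field preproj_elem ring)"
proof -
  interpret ring "preproj n :: 'k preproj_elem ring" by (rule ring_preproj)
  show ?thesis
    by (auto simp: normal_elem_def intro!: residue_class_simps(1) single_carrier is_path_normal_path)
qed

lemma x_normal_elem_inside:
  assumes "(s, a, b) \<in> box n" "s + a + 1 \<le> n"
  shows "arrow_elem n (ArrX (s + a - b)) \<otimes>\<^bsub>preproj n\<^esub> normal_elem n s a b = normal_elem n s (a + 1) b"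
proof -
  have "arrow_elem n (ArrX (s + a - b)) \<otimes>\<^bsub>preproj n\<^esub> residue_class n (single 1 (s, snd (normal_path s a b)))
    = residue_class n (single 1 (s, snd (normal_path s a b) @ [ArrX (s + a - b)]))"
    using assms is_path_normal_path[OF assms(1)] normal_path_end[of b s a]
    by (intro arrow_elem_mult_path) (auto simp: box_def normal_path_def)
  moreover have "(s, snd (normal_path s a b) @ [ArrX (s + a - b)]) = normal_path s (a + 1) b"
    using assms by (simp add: normal_path_def box_def)
  moreover have "(s, snd (normal_path s a b)) = normal_path s a b" by (simp add: normal_path_def)
  moreover have "(s, a + 1, b) \<in> box n" using assms by (simp add: box_def)
  ultimately show ?thesis using assms by (simp only: normal_elem_def if_True)
qed

text \<open>In a normal path all y precede all x, so for \<open>a = 0\<close> the new y is simply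
  appended. Otherwise it is moved past the last x by the middle relation, and the induction over
  \<open>a\<close> continues one row higher.\<close>

lemma y_normal_elem:
  assumes "(s, a, b) \<in> box n" "s + a - b > 1"
  shows "arrow_elem n (ArrY (s + a - b)) \<otimes>\<^bsub>preproj n\<^esub> normal_elem n s a b =
    (normal_elem n s a (b + 1) :: 'k::field preproj_elem)"
  using assms
proof (induction a)
  case 0
  have "arrow_elem n (ArrY (s - b)) \<otimes>\<^bsub>preproj n\<^esub> residue_class n (single 1 (s, snd (normal_path s 0 b)))
    = (residue_class n (single 1 (s, snd (normal_path s 0 b) @ [ArrY (s - b)])) :: 'k preproj_elem)"
    using 0 is_path_normal_path[OF 0(1)] normal_path_end[of b s 0]
    by (intro arrow_elem_mult_path) (auto simp: box_def normal_path_def)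
  moreover have "(s, snd (normal_path s 0 b) @ [ArrY (s - b)]) = normal_path s 0 (b + 1)"
    by (simp add: normal_path_def)
  moreover have "(s, snd (normal_path s 0 b)) = normal_path s 0 b" by (simp add: normal_path_def)
  moreover have "(s, 0, b + 1) \<in> box n" using 0 by (auto simp: box_def)
  ultimately show ?case using 0 by (simp only: normal_elem_def if_True add_0_right)
next
  case (Suc a)
  interpret ring "preproj n :: 'k preproj_elem ring" by (rule ring_preproj)
  define i where "i = s + a - b"
  define w :: "'k preproj_elem" where "w = normal_elem n s a b"
  note c = arrow_elem_carrier normal_elem_carrier
  have sab: "(s, a, b) \<in> box n" "1 \<le> i" "i + 1 \<le> n" "s + Suc a - b = i + 1" and san: "s + a + 1 \<le> n"
    using Suc.prems by (auto simp: box_def i_def)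
  have "normal_elem n s (Suc a) b = arrow_elem n (ArrX i) \<otimes>\<^bsub>preproj n\<^esub> w"
    using x_normal_elem_inside[OF sab(1) san, where ?'a='k] by (simp add: i_def w_def)
  then have "arrow_elem n (ArrY (i + 1)) \<otimes>\<^bsub>preproj n\<^esub> normal_elem n s (Suc a) b
      = (arrow_elem n (ArrY (i + 1)) \<otimes>\<^bsub>preproj n\<^esub> arrow_elem n (ArrX i)) \<otimes>\<^bsub>preproj n\<^esub> w"
    using sab by (simp add: m_assoc c w_def)
  also have "\<dots> = normal_elem n s (Suc a) (b + 1)"
  proof (cases "i = 1")
    case True
    \<comment> \<open>At vertex 1 the product of y and x is zero by an end relation. Together with
      \<open>b < s\<close> this vertex forces \<open>b + 1 = s\<close>, so the new position has left
      the array and the right side is zero as well.\<close>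
    then have "b + 1 = s" using sab Suc.prems by (auto simp: i_def box_def)
    then have "normal_elem n s (Suc a) (b + 1) = (\<zero>\<^bsub>preproj n\<^esub> :: 'k preproj_elem)"
      by (simp add: normal_elem_def box_def)
    then show ?thesis using arrow_relations(1)[of n, where ?'k='k] True sab
      by (simp add: w_def numeral_2_eq_2 c)
  next
    case False
    then have i: "2 \<le> i" "1 \<le> i - 1" "i - 1 < n" using sab by auto
    have "(arrow_elem n (ArrY (i + 1)) \<otimes>\<^bsub>preproj n\<^esub> arrow_elem n (ArrX i)) \<otimes>\<^bsub>preproj n\<^esub> w
       = arrow_elem n (ArrX (i - 1)) \<otimes>\<^bsub>preproj n\<^esub> (arrow_elem n (ArrY i) \<otimes>\<^bsub>preproj n\<^esub> w)"
      using arrow_relations(3)[OF i(1) sab(3), where ?'k='k] i sab(3) normal_elem_carrier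
      by (simp add: m_assoc c w_def)
    also have "arrow_elem n (ArrY i) \<otimes>\<^bsub>preproj n\<^esub> w = normal_elem n s a (b + 1)"
      using Suc.IH sab(1) i by (simp add: i_def w_def)
    also have "arrow_elem n (ArrX (i - 1)) \<otimes>\<^bsub>preproj n\<^esub> normal_elem n s a (b + 1) =
       (normal_elem n s (Suc a) (b + 1) :: 'k preproj_elem)"
    proof (cases "b + 1 < s")
      case True
      then show ?thesis using x_normal_elem_inside[of s a "b + 1" n, where ?'a='k] sab san
        by (simp add: i_def box_def)
    next
      case False
      then show ?thesis using i sab by (simp add: normal_elem_def box_def c)
    qed
    finally show ?thesis .
  qed
  finally show ?case using sab(4) by simp
qed

text \<open>Appending x to a normal path gives a normal path except in the last row
  \<open>s + a = n\<close>, where the product has to vanish. There an induction over the column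
  moves x past the last y, until it meets the end relation at vertex \<open>n\<close>.\<close>

lemma x_normal_elem:
  assumes "(s, a, b) \<in> box n" "s + a - b < n"
  shows "arrow_elem n (ArrX (s + a - b)) \<otimes>\<^bsub>preproj n\<^esub> normal_elem n s a b =
    (normal_elem n s (a + 1) b :: 'k::field preproj_elem)"
proof (cases "s + a + 1 \<le> n")
  case True
  then show ?thesis using x_normal_elem_inside assms by blast
next
  case False
  interpret ring "preproj n :: 'k preproj_elem ring" by (rule ring_preproj)
  note c = arrow_elem_carrier normal_elem_carrier
  have "(s, a, b) \<in> box n \<Longrightarrow> n - b < n \<Longrightarrow>
    arrow_elem n (ArrX (n - b)) \<otimes>\<^bsub>preproj n\<^esub> normal_elem n s a b = (\<zero>\<^bsub>preproj n\<^esub> :: 'k preproj_elem)" for b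
  proof (induction b)
    case (Suc b)
    define i where "i = n - b"
    define w :: "'k preproj_elem" where "w = normal_elem n s a b"
    have san: "s + a = n" and sab: "(s, a, b) \<in> box n" and i: "2 \<le> i" "i \<le> n" "n - Suc b = i - 1" "1 \<le> i - 1" "i - 1 < n"
      using Suc.prems False by (auto simp: box_def i_def)
    have "normal_elem n s a (Suc b) = arrow_elem n (ArrY i) \<otimes>\<^bsub>preproj n\<^esub> w"
      using y_normal_elem[OF sab, where ?'k='k] san i by (simp add: i_def w_def)
    then have "arrow_elem n (ArrX (n - Suc b)) \<otimes>\<^bsub>preproj n\<^esub> normal_elem n s a (Suc b)
      = (arrow_elem n (ArrX (i - 1)) \<otimes>\<^bsub>preproj n\<^esub> arrow_elem n (ArrY i)) \<otimes>\<^bsub>preproj n\<^esub> w"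
      using i by (simp add: m_assoc c w_def)
    also have "\<dots> = \<zero>\<^bsub>preproj n\<^esub>"
    proof (cases "b = 0")
      case True
      then show ?thesis using arrow_relations(2)[of n, where ?'k='k] i
        by (simp add: w_def i_def c)
    next
      case False
      then have "i + 1 \<le> n" "i < n" using i by (auto simp: i_def)
      have "(arrow_elem n (ArrX (i - 1)) \<otimes>\<^bsub>preproj n\<^esub> arrow_elem n (ArrY i)) \<otimes>\<^bsub>preproj n\<^esub> w
         = arrow_elem n (ArrY (i + 1)) \<otimes>\<^bsub>preproj n\<^esub> (arrow_elem n (ArrX i) \<otimes>\<^bsub>preproj n\<^esub> w)"
        using arrow_relations(3)[OF i(1) \<open>i + 1 \<le> n\<close>, where ?'k='k, symmetric] i \<open>i + 1 \<le> n\<close>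
        by (simp add: m_assoc c w_def)
      also have "arrow_elem n (ArrX i) \<otimes>\<^bsub>preproj n\<^esub> w = \<zero>\<^bsub>preproj n\<^esub>"
        using Suc.IH sab \<open>i < n\<close> by (simp add: i_def w_def)
      finally show ?thesis using \<open>i + 1 \<le> n\<close> i by (simp add: c)
    qed
    finally show ?case .
  qed simp
  moreover have "s + a = n" using False assms by (auto simp: box_def)
  ultimately show ?thesis using assms by (simp add: normal_elem_def box_def)
qed

text \<open>This is the spanning half of the basis theorem. The path is built arrow by arrow; once
  its counts have left the box they never return, and the class stays zero.\<close>

lemma residue_class_path:
  assumes "is_path n (s, as)"
  shows "residue_class n (single 1 (s, as)) = (normal_elem n s (num_x as) (num_y as) :: 'k::field preproj_elem)"
  using assms
proof (induction as rule: rev_induct)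
  case Nil
  then show ?case by (simp add: normal_elem_def box_def normal_path_def)
next
  case (snoc \<alpha> as)
  interpret ring "preproj n :: 'k preproj_elem ring" by (rule ring_preproj)
  let ?a = "num_x as" and ?b = "num_y as"
  have p: "is_path n (s, as)" and \<alpha>: "\<alpha> \<in> arrows n" "path_end (s, as) = source \<alpha>"
    using snoc.prems by (auto simp: is_path_append)
  have e: "source \<alpha> + ?b = s + ?a" using path_end_num[OF p] \<alpha> by simp
  have eq: "residue_class n (single 1 (s, as @ [\<alpha>])) =
      arrow_elem n \<alpha> \<otimes>\<^bsub>preproj n\<^esub> (normal_elem n s ?a ?b :: 'k preproj_elem)"
    using arrow_elem_mult_path[OF p \<alpha>(2,1), where ?'k='k] snoc.IH[OF p] by simp
  show ?case
  proof (cases "(s, ?a, ?b) \<in> box n")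
    case True
    have "s + ?a - ?b = source \<alpha>" using e by simp
    then show ?thesis
      using eq x_normal_elem[OF True, where ?'k='k] y_normal_elem[OF True, where ?'k='k] \<alpha> by (cases \<alpha>) auto
  next
    case False
    then have "(s, num_x (as @ [\<alpha>]), num_y (as @ [\<alpha>])) \<notin> box n"
      by (auto simp: box_def)
    then show ?thesis using eq False \<alpha> by (simp add: normal_elem_def arrow_elem_carrier)
  qed
qed

section \<open>Normal forms and the coordinates of residue classes\<close>

lemma single_apply: "single c p q = (if q = p then c else 0)"
  by (simp add: single_def)

text \<open>A section of \<open>path_coord\<close>: the value at a triple is put on the one normal
  path with these counts.\<close>

definition normal_form :: "nat \<Rightarrow> (nat \<Rightarrow> nat \<Rightarrow> nat \<Rightarrow> 'k::field) \<Rightarrow> path \<Rightarrow> 'k" where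
  "normal_form n F p = (let s = fst p; a = num_x (snd p); b = num_y (snd p)
     in if (s, a, b) \<in> box n \<and> p = normal_path s a b then F s a b else 0)"

lemma finite_box: "finite (box n)"
  by (rule finite_subset[of _ "{..n} \<times> {..n} \<times> {..n}"]) (auto simp: box_def)

lemma normal_form_carrier: "normal_form n F \<in> carrier (path_algebra n)"
proof -
  have "{p. normal_form n F p \<noteq> 0} \<subseteq> (\<lambda>(s, a, b). normal_path s a b) ` box n"
    by (force simp: normal_form_def Let_def split: if_splits)
  then show ?thesis unfolding path_algebra_simps
    using finite_box is_path_normal_path
    by (auto intro: finite_surj)
qed

lemma normal_form_add: "normal_form n (\<lambda>s a b. F s a b + G s a b) p = normal_form n F p + normal_form n G p"
  by (simp add: normal_form_def Let_def)

lemma residue_class_normal_form: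
  fixes f :: "path \<Rightarrow> 'k::field"
  assumes "f \<in> carrier (path_algebra n)"
  shows "residue_class n (normal_form n (path_coord n f)) = residue_class n f"
  using assms
proof (induction rule: path_algebra_induct)
  case zero
  have "normal_form n (path_coord n (\<lambda>p. 0)) = (\<lambda>p. 0 :: 'k)"
    by (auto simp: normal_form_def Let_def path_coord_zero)
  then show ?case by simp
next
  case (add c p g)
  interpret ring "preproj n :: 'k preproj_elem ring" by (rule ring_preproj)
  obtain s as where p: "p = (s, as)" by (cases p)
  let ?a = "num_x as" and ?b = "num_y as"
  \<comment> \<open>The quotient is used here only as a ring, so the scalar is carried by the
    trivial path at the start vertex and multiplied from the right.\<close>
  have sc: "residue_class n (single c q) = residue_class n (single 1 q) \<otimes>\<^bsub>preproj n\<^esub> residue_class n (single c (fst q, []))"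
    and sc_carrier: "residue_class n (single c (fst q, [])) \<in> carrier (preproj n)"
    if "is_path n q" for q
  proof -
    have "single 1 q \<in> carrier (path_algebra n :: (path \<Rightarrow> 'k) ring)"
      "single c (fst q, []) \<in> carrier (path_algebra n)"
      using that by (cases q; auto intro!: single_carrier dest: is_path_start)+
    from residue_class_simps(2)[OF this] residue_class_simps(1)[OF this(2)]
    show "residue_class n (single c q) = residue_class n (single 1 q) \<otimes>\<^bsub>preproj n\<^esub> residue_class n (single c (fst q, []))"
      "residue_class n (single c (fst q, [])) \<in> carrier (preproj n)"
      by (simp_all add: single_mult)
  qed
  have c: "single c p \<in> carrier (path_algebra n)" using add by (auto intro: single_carrier)
  have "residue_class n (normal_form n (path_coord n (single c p))) = residue_class n (single c p)"
  proof (cases "(s, ?a, ?b) \<in> box n")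
    case True
    have nf: "normal_form n (path_coord n (single c p)) = single c (normal_path s ?a ?b)"
    proof
      fix q :: path
      show "normal_form n (path_coord n (single c p)) q = single c (normal_path s ?a ?b) q"
        using add(1) True
        by (cases "q = normal_path s ?a ?b")
           (auto simp: normal_form_def Let_def path_coord_single single_apply p)
    qed
    show ?thesis
      unfolding nf using residue_class_path[of n s as, where ?'k='k] add(1) True
      by (simp add: sc is_path_normal_path p normal_elem_def)
  next
    case False
    have "normal_form n (path_coord n (single c p)) = (\<lambda>p. 0)"
      using add False by (auto simp: normal_form_def Let_def path_coord_single fun_eq_iff p)
    moreover have "residue_class n (single c p) = \<zero>\<^bsub>preproj n\<^esub>"
      using residue_class_path[of n s as, where ?'k='k] add(1) False sc_carrier[of p]
      by (simp add: sc p normal_elem_def)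
    ultimately show ?thesis by (simp add: residue_class_zero)
  qed
  moreover have "normal_form n (path_coord n (\<lambda>q. single c p q + g q)) =
     (\<lambda>q. normal_form n (path_coord n (single c p)) q + normal_form n (path_coord n g) q)"
    by (simp add: path_coord_add[abs_def] normal_form_add fun_eq_iff)
  ultimately show ?case using add c
    by (simp add: residue_class_add normal_form_carrier)
qed

lemma path_coord_normal_form:
  assumes "\<And>s a b. (s, a, b) \<notin> box n \<Longrightarrow> F s a b = 0"
  shows "path_coord n (normal_form n F) = F"
proof (intro ext)
  fix s a b
  show "path_coord n (normal_form n F) s a b = F s a b"
  proof (cases "(s, a, b) \<in> box n")
    case True
    have normal_path_mem: "normal_path s a b \<in> paths_of n s a b"
      using True is_path_normal_path by (simp add: paths_of_def)
    have "(\<Sum>p\<in>paths_of n s a b. normal_form n F p) =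
        (\<Sum>p\<in>paths_of n s a b. if p = normal_path s a b then F s a b else 0)"
      using True by (intro sum.cong) (auto simp: paths_of_def normal_form_def)
    also have "\<dots> = F s a b"
      using True is_path_normal_path normal_path_mem by (simp add: finite_paths_of)
    finally show ?thesis using True by (simp add: path_coord_def)
  qed (simp add: path_coord_def assms)
qed

text \<open>The coefficient at the basis element \<open>array_vec n s (a, b)\<close>, defined to be zero outside of the box.\<close>

definition coord :: "nat \<Rightarrow> 'k::field preproj_elem \<Rightarrow> nat \<Rightarrow> nat \<Rightarrow> nat \<Rightarrow> 'k" where
  "coord n x = path_coord n (SOME f. f \<in> carrier (path_algebra n) \<and> x = residue_class n f)"

definition of_coord :: "nat \<Rightarrow> (nat \<Rightarrow> nat \<Rightarrow> nat \<Rightarrow> 'k::field) \<Rightarrow> 'k preproj_elem" where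
  "of_coord n F = residue_class n (normal_form n F)"

text \<open>Two representatives differ by an element of the relation ideal, on which all coordinates
  vanish. With the normal forms this makes \<open>coord\<close> a bijection onto the functions
  supported in the box.\<close>

lemma coord_residue_class:
  fixes f :: "path \<Rightarrow> 'k::field"
  assumes "f \<in> carrier (path_algebra n)"
  shows "coord n (residue_class n f) = path_coord n f"
proof -
  define g where "g = (SOME g. g \<in> carrier (path_algebra n) \<and> residue_class n f = residue_class n g)"
  interpret A: ring "path_algebra n :: (path \<Rightarrow> 'k) ring" by (rule ring_path_algebra)
  have g: "g \<in> carrier (path_algebra n)" "residue_class n f = residue_class n g"
    unfolding g_def using someI[of "\<lambda>g. g \<in> carrier (path_algebra n) \<and> residue_class n f = residue_class n g" f] assms
    by auto
  then have "f \<ominus>\<^bsub>path_algebra n\<^esub> g \<in> relation_ideal n" using residue_class_eq_iff assms by blast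
  then have "path_coord n (f \<ominus>\<^bsub>path_algebra n\<^esub> g) s a b = 0" for s a b
    using path_coord_relation_ideal by metis
  moreover have "f = (f \<ominus>\<^bsub>path_algebra n\<^esub> g) \<oplus>\<^bsub>path_algebra n\<^esub> g"
    using assms g by (simp add: a_minus_def A.a_assoc A.l_neg)
  then have "f = (\<lambda>p. (f \<ominus>\<^bsub>path_algebra n\<^esub> g) p + g p)"
    by (simp only: path_algebra_simps(3))
  ultimately have "path_coord n f s a b = path_coord n g s a b" for s a b
    by (metis (no_types) path_coord_add add_0)
  then show ?thesis by (auto simp: coord_def g_def[symmetric] fun_eq_iff)
qed

lemma coord_outside: "(s, a, b) \<notin> box n \<Longrightarrow> coord n x s a b = 0"
  by (simp add: coord_def path_coord_def)

lemma of_coord_carrier: "of_coord n F \<in> carrier (preproj n)"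
  by (simp add: of_coord_def residue_class_simps normal_form_carrier)

lemma coord_of_coord:
  "coord n (of_coord n F) s a b = (if (s, a, b) \<in> box n then F s a b else 0)"
proof -
  let ?F = "\<lambda>s a b. if (s, a, b) \<in> box n then F s a b else 0"
  have "normal_form n F = normal_form n ?F" by (auto simp: normal_form_def Let_def)
  then show ?thesis
    using path_coord_normal_form[of n ?F] by (simp add: of_coord_def coord_residue_class normal_form_carrier)
qed

lemma of_coord_coord: "x \<in> carrier (preproj n) \<Longrightarrow> of_coord n (coord n x) = x"
  by (auto simp: carrier_preproj coord_residue_class of_coord_def residue_class_normal_form)

lemma preproj_eqI:
  assumes "x \<in> carrier (preproj n)" "y \<in> carrier (preproj n)"
    "\<And>s a b. (s, a, b) \<in> box n \<Longrightarrow> coord n x s a b = coord n y s a b"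
  shows "x = y"
proof -
  have "coord n x s a b = coord n y s a b" for s a b
    using assms(3) by (cases "(s, a, b) \<in> box n") (simp_all add: coord_outside)
  then have "coord n x = coord n y" by (intro ext)
  then show ?thesis using assms(1,2) of_coord_coord by metis
qed

lemma coord_add:
  assumes "x \<in> carrier (preproj n)" "y \<in> carrier (preproj n)"
  shows "coord n (x \<oplus>\<^bsub>preproj n\<^esub> y) s a b = coord n x s a b + coord n y s a b"
  using assms
  by (auto simp: carrier_preproj residue_class_add[symmetric] coord_residue_class add_carrier path_coord_add)

lemma coord_zero: "coord n (\<zero>\<^bsub>preproj n\<^esub> :: 'k::field preproj_elem) s a b = 0"
proof -
  have "coord n (residue_class n (\<lambda>p. 0 :: 'k)) = path_coord n (\<lambda>p. 0)"
    by (rule coord_residue_class[OF zero_carrier])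
  then show ?thesis by (simp add: residue_class_zero path_coord_zero)
qed

lemma coord_mult:
  assumes "x \<in> carrier (preproj n)" "y \<in> carrier (preproj n)" "(s, a, b) \<in> box n"
  shows "coord n (x \<otimes>\<^bsub>preproj n\<^esub> y) s a b =
    (\<Sum>a'\<le>a. \<Sum>b'\<le>b. coord n x (s + a' - b') (a - a') (b - b') * coord n y s a' b')"
  using assms
  by (auto simp: carrier_preproj residue_class_simps(2)[symmetric] coord_residue_class path_mult_closed
      path_coord_mult conv_def)

lemma coord_array_vec:
  "(l, r, c) \<in> box n \<Longrightarrow> coord n (array_vec n l (r, c)) s a b = (if s = l \<and> a = r \<and> b = c then 1 else 0)"
  using is_path_normal_path[of l r c n]
  by (auto simp: array_vec_normal_path coord_residue_class single_carrier path_coord_single)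

lemma array_vec_carrier: "(l, r, c) \<in> box n \<Longrightarrow> array_vec n l (r, c) \<in> carrier (preproj n)"
  using is_path_normal_path[of l r c n]
  by (simp add: array_vec_normal_path residue_class_simps single_carrier)

lemma idem_array_vec: "idem n v = array_vec n v (0, 0)"
  by (simp add: idem_def array_vec_def)

lemma arrow_x_array_vec: "arrow_elem n (ArrX v) = array_vec n v (1, 0)"
  by (simp add: arrow_elem_def array_vec_def)

lemma arrow_y_array_vec: "arrow_elem n (ArrY v) = array_vec n v (0, 1)"
  by (simp add: arrow_elem_def array_vec_def)

lemma coord_one:
  "coord n (\<one>\<^bsub>preproj n\<^esub> :: 'a::field preproj_elem) s a b = (if 1 \<le> s \<and> s \<le> n \<and> a = 0 \<and> b = 0 then 1 else 0)"
proof (cases "(s, a, b) \<in> box n")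
  case True
  interpret A: ring "path_algebra n :: (path \<Rightarrow> 'a) ring" by (rule ring_path_algebra)
  have "(\<Sum>p\<in>paths_of n s a b. \<one>\<^bsub>path_algebra n\<^esub> p) = 
    (\<Sum>p\<in>paths_of n s a b. if p = (s, []) then if 1 \<le> s \<and> s \<le> n then 1 else 0 else (0::'a))"
    by (intro sum.cong) (auto simp: paths_of_def path_algebra_simps)
  also have "\<dots> = (if a = 0 \<and> b = 0 \<and> 1 \<le> s \<and> s \<le> n then 1 else 0)"
  proof -
    have "(s, []) \<in> paths_of n s a b \<longleftrightarrow> a = 0 \<and> b = 0 \<and> 1 \<le> s \<and> s \<le> n"
      by (auto simp: paths_of_def)
    then show ?thesis by (simp add: finite_paths_of)
  qed
  finally have "path_coord n \<one>\<^bsub>path_algebra n\<^esub> s a b = (if 1 \<le> s \<and> s \<le> n \<and> a = 0 \<and> b = 0 then 1 else (0::'a))"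
    using True by (auto simp: path_coord_def)
  then show ?thesis
    by (simp add: residue_class_simps(4)[symmetric] coord_residue_class path_one_carrier)
qed (auto simp: coord_outside box_def)

lemma scalar_elem_residue:
  fixes c :: "'k::field"
  shows "(\<lambda>p. c * \<one>\<^bsub>path_algebra n\<^esub> p) \<in> carrier (path_algebra n)"
  using path_one_carrier[of n, where ?'a='k] by (auto simp: path_algebra_simps(1) elim!: finite_subset[rotated])

lemma scalar_elem_carrier: "scalar_elem n c \<in> carrier (preproj n)"
  by (simp add: scalar_elem_def residue_class_simps scalar_elem_residue)

lemma coord_scalar_elem:
  fixes c :: "'k::field"
  shows "coord n (scalar_elem n c) s a b = (if 1 \<le> s \<and> s \<le> n \<and> a = 0 \<and> b = 0 then c else 0)"
proof -
  have "path_coord n (\<lambda>p. c * \<one>\<^bsub>path_algebra n\<^esub> p) s a b = c * path_coord n \<one>\<^bsub>path_algebra n\<^esub> s a b"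
    by (simp add: path_coord_def sum_distrib_left)
  moreover have "path_coord n \<one>\<^bsub>path_algebra n\<^esub> s a b = coord n (\<one>\<^bsub>preproj n\<^esub> :: 'k preproj_elem) s a b"
    by (simp add: residue_class_simps(4)[symmetric] coord_residue_class path_one_carrier)
  ultimately show ?thesis
    by (simp add: scalar_elem_def coord_residue_class scalar_elem_residue coord_one)
qed


section \<open>Left modules\<close>

lemma op_ring_simps [simp]:
  "carrier (op_ring R) = carrier R" "\<zero>\<^bsub>op_ring R\<^esub> = \<zero>\<^bsub>R\<^esub>" "\<one>\<^bsub>op_ring R\<^esub> = \<one>\<^bsub>R\<^esub>"
  "a \<oplus>\<^bsub>op_ring R\<^esub> b = a \<oplus>\<^bsub>R\<^esub> b" "a \<otimes>\<^bsub>op_ring R\<^esub> b = b \<otimes>\<^bsub>R\<^esub> a"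
  by (simp_all add: op_ring_def)

lemma op_op_ring [simp]: "op_ring (op_ring R) = R"
  by (simp add: op_ring_def)

lemma ring_op_ring:
  assumes "ring R"
  shows "ring (op_ring R)"
proof -
  interpret ring R by fact
  show ?thesis
    by (rule ringI; (rule abelian_groupI monoidI)?)
       (auto simp: a_ac m_assoc l_distr r_distr intro!: bexI[of _ "\<ominus>\<^bsub>R\<^esub> x" for x] l_neg)
qed

lemma left_moduleI:
  fixes R :: "('a, 'r) ring_scheme" and M :: "('a, 'm, 'q) module_scheme"
  assumes "ring R" "abelian_group M"
    and "\<And>a x. a \<in> carrier R \<Longrightarrow> x \<in> carrier M \<Longrightarrow> a \<odot>\<^bsub>M\<^esub> x \<in> carrier M"
    and "\<And>a b x. a \<in> carrier R \<Longrightarrow> b \<in> carrier R \<Longrightarrow> x \<in> carrier M \<Longrightarrow>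
        (a \<oplus>\<^bsub>R\<^esub> b) \<odot>\<^bsub>M\<^esub> x = a \<odot>\<^bsub>M\<^esub> x \<oplus>\<^bsub>M\<^esub> b \<odot>\<^bsub>M\<^esub> x"
    and "\<And>a x y. a \<in> carrier R \<Longrightarrow> x \<in> carrier M \<Longrightarrow> y \<in> carrier M \<Longrightarrow>
        a \<odot>\<^bsub>M\<^esub> (x \<oplus>\<^bsub>M\<^esub> y) = a \<odot>\<^bsub>M\<^esub> x \<oplus>\<^bsub>M\<^esub> a \<odot>\<^bsub>M\<^esub> y"
    and "\<And>a b x. a \<in> carrier R \<Longrightarrow> b \<in> carrier R \<Longrightarrow> x \<in> carrier M \<Longrightarrow>
        (a \<otimes>\<^bsub>R\<^esub> b) \<odot>\<^bsub>M\<^esub> x = a \<odot>\<^bsub>M\<^esub> (b \<odot>\<^bsub>M\<^esub> x)"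
    and "\<And>x. x \<in> carrier M \<Longrightarrow> \<one>\<^bsub>R\<^esub> \<odot>\<^bsub>M\<^esub> x = x"
  shows "left_module R M"
  using assms by (auto simp: left_module_def left_module_axioms_def)

context left_module
begin

lemma smult_zero_right:
  assumes "a \<in> carrier R"
  shows "a \<odot>\<^bsub>M\<^esub> \<zero>\<^bsub>M\<^esub> = \<zero>\<^bsub>M\<^esub>"
proof -
  have "a \<odot>\<^bsub>M\<^esub> \<zero>\<^bsub>M\<^esub> \<oplus>\<^bsub>M\<^esub> a \<odot>\<^bsub>M\<^esub> \<zero>\<^bsub>M\<^esub> = a \<odot>\<^bsub>M\<^esub> \<zero>\<^bsub>M\<^esub>"
    using smult_r_distr[OF assms M.zero_closed M.zero_closed] by simp
  then show ?thesis
    using smult_closed[OF assms M.zero_closed] M.add.r_cancel_one by blast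
qed

lemma smult_minus_right:
  assumes "a \<in> carrier R" "x \<in> carrier M"
  shows "a \<odot>\<^bsub>M\<^esub> (\<ominus>\<^bsub>M\<^esub> x) = \<ominus>\<^bsub>M\<^esub> (a \<odot>\<^bsub>M\<^esub> x)"
proof (rule M.minus_equality[symmetric])
  show "a \<odot>\<^bsub>M\<^esub> (\<ominus>\<^bsub>M\<^esub> x) \<oplus>\<^bsub>M\<^esub> a \<odot>\<^bsub>M\<^esub> x = \<zero>\<^bsub>M\<^esub>"
    using assms by (simp add: smult_r_distr[symmetric] M.l_neg smult_zero_right)
qed (use assms in \<open>auto intro: smult_closed\<close>)

lemma smult_zero_left:
  assumes "x \<in> carrier M"
  shows "\<zero>\<^bsub>R\<^esub> \<odot>\<^bsub>M\<^esub> x = \<zero>\<^bsub>M\<^esub>"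
proof -
  have "\<zero>\<^bsub>R\<^esub> \<odot>\<^bsub>M\<^esub> x \<oplus>\<^bsub>M\<^esub> \<zero>\<^bsub>R\<^esub> \<odot>\<^bsub>M\<^esub> x = \<zero>\<^bsub>R\<^esub> \<odot>\<^bsub>M\<^esub> x"
    using smult_l_distr[OF R.zero_closed R.zero_closed assms] by simp
  then show ?thesis
    using smult_closed[OF R.zero_closed assms] M.add.r_cancel_one by blast
qed

lemma smult_minus_one:
  assumes "x \<in> carrier M"
  shows "(\<ominus>\<^bsub>R\<^esub> \<one>\<^bsub>R\<^esub>) \<odot>\<^bsub>M\<^esub> x = \<ominus>\<^bsub>M\<^esub> x"
proof (rule M.minus_equality[symmetric])
  show "(\<ominus>\<^bsub>R\<^esub> \<one>\<^bsub>R\<^esub>) \<odot>\<^bsub>M\<^esub> x \<oplus>\<^bsub>M\<^esub> x = \<zero>\<^bsub>M\<^esub>"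
    using assms smult_l_distr[of "\<ominus>\<^bsub>R\<^esub> \<one>\<^bsub>R\<^esub>" "\<one>\<^bsub>R\<^esub>" x]
    by (simp add: smult_one R.l_neg smult_zero_left)
qed (use assms in \<open>auto intro: smult_closed\<close>)

text \<open>Closure under negation follows from the action of -1.\<close>

lemma submoduleI:
  assumes "U \<subseteq> carrier M" "\<zero>\<^bsub>M\<^esub> \<in> U"
    and "\<And>x y. x \<in> U \<Longrightarrow> y \<in> U \<Longrightarrow> x \<oplus>\<^bsub>M\<^esub> y \<in> U"
    and smult: "\<And>a x. a \<in> carrier R \<Longrightarrow> x \<in> U \<Longrightarrow> a \<odot>\<^bsub>M\<^esub> x \<in> U"
  shows "submodule U R M"
proof -
  have "subgroup U (add_monoid M)"
  proof (rule M.add.subgroupI)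
    fix x assume x: "x \<in> U"
    then have "(\<ominus>\<^bsub>R\<^esub> \<one>\<^bsub>R\<^esub>) \<odot>\<^bsub>M\<^esub> x \<in> U" by (intro smult) auto
    then show "\<ominus>\<^bsub>M\<^esub> x \<in> U" using x assms(1) smult_minus_one by auto
  qed (use assms in auto)
  then show ?thesis using assms by (auto simp: submodule_def submodule_axioms_def)
qed

lemma submoduleD:
  assumes "submodule U R M"
  shows "x \<in> U \<Longrightarrow> x \<in> carrier M" "\<zero>\<^bsub>M\<^esub> \<in> U"
    and "x \<in> U \<Longrightarrow> y \<in> U \<Longrightarrow> x \<oplus>\<^bsub>M\<^esub> y \<in> U"
    and "a \<in> carrier R \<Longrightarrow> x \<in> U \<Longrightarrow> a \<odot>\<^bsub>M\<^esub> x \<in> U"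
    and "x \<in> U \<Longrightarrow> \<ominus>\<^bsub>M\<^esub> x \<in> U" "x \<in> U \<Longrightarrow> y \<in> U \<Longrightarrow> x \<ominus>\<^bsub>M\<^esub> y \<in> U"
proof -
  interpret submodule U R M by fact
  interpret additive_subgroup U M by (rule additive_subgroupI) (rule subgroup_axioms)
  show "x \<in> U \<Longrightarrow> x \<in> carrier M" "\<zero>\<^bsub>M\<^esub> \<in> U"
    "x \<in> U \<Longrightarrow> y \<in> U \<Longrightarrow> x \<oplus>\<^bsub>M\<^esub> y \<in> U"
    "a \<in> carrier R \<Longrightarrow> x \<in> U \<Longrightarrow> a \<odot>\<^bsub>M\<^esub> x \<in> U" by auto
  show m: "x \<in> U \<Longrightarrow> \<ominus>\<^bsub>M\<^esub> x \<in> U" for x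
    using m_inv_closed[of x] by (simp add: a_inv_def)
  show "x \<in> U \<Longrightarrow> y \<in> U \<Longrightarrow> x \<ominus>\<^bsub>M\<^esub> y \<in> U" unfolding a_minus_def using m by auto
qed

end

section \<open>Epimorphisms and factor modules\<close>

definition module_epi ::
  "('a, 'r) ring_scheme \<Rightarrow> ('a, 'm) module \<Rightarrow> ('a, 'n) module \<Rightarrow> ('m \<Rightarrow> 'n) \<Rightarrow> bool" where
  "module_epi R M N q \<longleftrightarrow> q ` carrier M = carrier N \<and> q \<zero>\<^bsub>M\<^esub> = \<zero>\<^bsub>N\<^esub> \<and>
     (\<forall>x \<in> carrier M. \<forall>y \<in> carrier M. q (x \<oplus>\<^bsub>M\<^esub> y) = q x \<oplus>\<^bsub>N\<^esub> q y) \<and>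
     (\<forall>a \<in> carrier R. \<forall>x \<in> carrier M. q (a \<odot>\<^bsub>M\<^esub> x) = a \<odot>\<^bsub>N\<^esub> q x)"

lemma module_epiD:
  assumes "module_epi R M N q"
  shows "x \<in> carrier M \<Longrightarrow> q x \<in> carrier N" "q \<zero>\<^bsub>M\<^esub> = \<zero>\<^bsub>N\<^esub>"
    "x \<in> carrier M \<Longrightarrow> y \<in> carrier M \<Longrightarrow> q (x \<oplus>\<^bsub>M\<^esub> y) = q x \<oplus>\<^bsub>N\<^esub> q y"
    "a \<in> carrier R \<Longrightarrow> x \<in> carrier M \<Longrightarrow> q (a \<odot>\<^bsub>M\<^esub> x) = a \<odot>\<^bsub>N\<^esub> q x"
    "z \<in> carrier N \<Longrightarrow> \<exists>x \<in> carrier M. z = q x"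
  using assms by (auto simp: module_epi_def)

text \<open>Each axiom for \<open>N\<close> is the image of the same axiom for \<open>M\<close>.
  This gives the module structure on \<open>J(w)\<close> and on factor modules without any
  arithmetic of cosets.\<close>

lemma left_module_epi:
  assumes "left_module R M" "module_epi R M N q"
  shows "left_module R N"
proof -
  interpret left_module R M by fact
  note q = module_epiD[OF assms(2)]
  have cN: "carrier N = q ` carrier M" using assms(2) by (simp add: module_epi_def)
  have inv: "\<exists>y \<in> carrier M. q (x \<oplus>\<^bsub>M\<^esub> y) = q \<zero>\<^bsub>M\<^esub>" if "x \<in> carrier M" for x
    using that by (intro bexI[of _ "\<ominus>\<^bsub>M\<^esub> x"]) (simp_all add: M.r_neg)
  show ?thesis
  proof (rule left_moduleI)
    show "abelian_group N"
      by (rule abelian_groupI)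
         (auto simp: cN q(3)[symmetric] q(2)[symmetric] M.a_ac inv simp del: q(2))
  qed (auto simp: cN q(3,4)[symmetric] R.ring_axioms smult_closed smult_l_distr smult_r_distr
      smult_assoc1 smult_one)
qed

lemma module_epi_minus:
  assumes "left_module R M" "module_epi R M N q" "x \<in> carrier M" "y \<in> carrier M"
  shows "q (x \<ominus>\<^bsub>M\<^esub> y) = q x \<ominus>\<^bsub>N\<^esub> q y"
proof -
  interpret M: left_module R M by fact
  interpret N: left_module R N by (rule left_module_epi[OF assms(1,2)])
  note q = module_epiD[OF assms(2)]
  have "q (\<ominus>\<^bsub>M\<^esub> y) = \<ominus>\<^bsub>N\<^esub> q y"
    by (rule N.M.minus_equality[symmetric])
       (use assms q in \<open>simp_all add: q(3)[symmetric] M.M.l_neg\<close>)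
  then show ?thesis using assms q(3)[of x "\<ominus>\<^bsub>M\<^esub> y"] by (simp add: a_minus_def)
qed

lemma module_epi_eq_iff:
  assumes "left_module R M" "module_epi R M N q" "x \<in> carrier M" "y \<in> carrier M"
  shows "q x = q y \<longleftrightarrow> q (x \<ominus>\<^bsub>M\<^esub> y) = \<zero>\<^bsub>N\<^esub>"
proof -
  interpret N: left_module R N by (rule left_module_epi[OF assms(1,2)])
  show ?thesis
    unfolding module_epi_minus[OF assms]
    using module_epiD(1)[OF assms(2)] assms(3,4) N.M.add.inv_solve_right'[of "\<zero>\<^bsub>N\<^esub>" "q x" "q y"]
    by (auto simp: a_minus_def)
qed

context
  fixes R :: "('a, 'r) ring_scheme" and M :: "('a, 'm) module" and U :: "'m set"
  assumes M: "left_module R M" and U: "submodule U R M"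
begin

interpretation M: left_module R M by (rule M)

interpretation abelian_subgroup U M
  by (rule abelian_subgroupI3)
     (auto intro: additive_subgroupI submodule.axioms(1)[OF U] M.M.abelian_group_axioms)

lemma quot_coset_eq_iff:
  assumes "x \<in> carrier M" "y \<in> carrier M"
  shows "U +>\<^bsub>M\<^esub> x = U +>\<^bsub>M\<^esub> y \<longleftrightarrow> x \<ominus>\<^bsub>M\<^esub> y \<in> U"
  using assms a_rcos_module[of y x] a_rcos_self[of x] a_repr_independence'[of x y]
  unfolding a_minus_def by blast

text \<open>The union in the definition of the action runs over the elements of one coset; as
  \<open>U\<close> is stable under scalars, all its members are the same coset.\<close>

lemma quot_module_epi: "module_epi R M (quot_module M U) (\<lambda>x. U +>\<^bsub>M\<^esub> x)"
  unfolding module_epi_def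
proof (intro conjI ballI)
  show "(\<lambda>x. U +>\<^bsub>M\<^esub> x) ` carrier M = carrier (quot_module M U)"
    by (auto simp: quot_module_def A_RCOSETS_def')
  show "U +>\<^bsub>M\<^esub> \<zero>\<^bsub>M\<^esub> = \<zero>\<^bsub>quot_module M U\<^esub>"
    using a_subset by (simp add: quot_module_def)
  show "U +>\<^bsub>M\<^esub> (x \<oplus>\<^bsub>M\<^esub> y) = (U +>\<^bsub>M\<^esub> x) \<oplus>\<^bsub>quot_module M U\<^esub> (U +>\<^bsub>M\<^esub> y)"
    if "x \<in> carrier M" "y \<in> carrier M" for x y
    using that by (simp add: quot_module_def a_rcos_sum)
  fix a x assume a: "a \<in> carrier R" and x: "x \<in> carrier M"
  have *: "U +>\<^bsub>M\<^esub> (a \<odot>\<^bsub>M\<^esub> y) = U +>\<^bsub>M\<^esub> (a \<odot>\<^bsub>M\<^esub> x)" if y: "y \<in> U +>\<^bsub>M\<^esub> x" for y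
  proof -
    have yc: "y \<in> carrier M" using x y a_elemrcos_carrier by blast
    have "y \<ominus>\<^bsub>M\<^esub> x \<in> U" using a_rcos_module[of x y] x y yc unfolding a_minus_def by blast
    then have "a \<odot>\<^bsub>M\<^esub> (y \<ominus>\<^bsub>M\<^esub> x) \<in> U" using a M.submoduleD(4)[OF U] by blast
    then have "a \<odot>\<^bsub>M\<^esub> y \<ominus>\<^bsub>M\<^esub> a \<odot>\<^bsub>M\<^esub> x \<in> U"
      using a x yc by (simp add: a_minus_def M.smult_r_distr M.smult_minus_right)
    then show ?thesis using a x yc quot_coset_eq_iff M.smult_closed by blast
  qed
  have "U +>\<^bsub>M\<^esub> x \<noteq> {}" using x a_rcos_self by blast
  then have "(\<Union>y\<in>U +>\<^bsub>M\<^esub> x. U +>\<^bsub>M\<^esub> (a \<odot>\<^bsub>M\<^esub> y)) = U +>\<^bsub>M\<^esub> (a \<odot>\<^bsub>M\<^esub> x)"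
    by (rule SUP_eq_const) (rule *)
  then show "U +>\<^bsub>M\<^esub> (a \<odot>\<^bsub>M\<^esub> x) = a \<odot>\<^bsub>quot_module M U\<^esub> (U +>\<^bsub>M\<^esub> x)"
    by (simp add: quot_module_def)
qed

lemma quot_module_kernel:
  assumes "x \<in> carrier M"
  shows "U +>\<^bsub>M\<^esub> x = \<zero>\<^bsub>quot_module M U\<^esub> \<longleftrightarrow> x \<in> U"
  using quot_coset_eq_iff[OF assms M.M.zero_closed] module_epiD(2)[OF quot_module_epi] assms M.M.minus_equality[of "\<zero>\<^bsub>M\<^esub>" "\<zero>\<^bsub>M\<^esub>"]
  by (simp add: a_minus_def)

end

section \<open>Duals with values in the ring\<close>

lemma ring_dual_simps:
  "carrier (ring_dual R P) = left_hom R P (regular_module R)"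
  "\<zero>\<^bsub>ring_dual R P\<^esub> = (\<lambda>x\<in>carrier P. \<zero>\<^bsub>R\<^esub>)"
  "f \<oplus>\<^bsub>ring_dual R P\<^esub> g = (\<lambda>x\<in>carrier P. f x \<oplus>\<^bsub>R\<^esub> g x)"
  "a \<odot>\<^bsub>ring_dual R P\<^esub> f = (\<lambda>x\<in>carrier P. f x \<otimes>\<^bsub>R\<^esub> a)"
  by (simp_all add: ring_dual_def)

lemma left_hom_regular:
  "f \<in> left_hom R P (regular_module R) \<longleftrightarrow> f \<in> carrier P \<rightarrow>\<^sub>E carrier R \<and>
     (\<forall>x \<in> carrier P. \<forall>y \<in> carrier P. f (x \<oplus>\<^bsub>P\<^esub> y) = f x \<oplus>\<^bsub>R\<^esub> f y) \<and>
     (\<forall>a \<in> carrier R. \<forall>x \<in> carrier P. f (a \<odot>\<^bsub>P\<^esub> x) = a \<otimes>\<^bsub>R\<^esub> f x)"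
  by (simp add: left_hom_def regular_module_def)

lemma ring_dualI:
  assumes "\<And>x. x \<in> carrier P \<Longrightarrow> f x \<in> carrier R"
    and "\<And>x y. x \<in> carrier P \<Longrightarrow> y \<in> carrier P \<Longrightarrow> f (x \<oplus>\<^bsub>P\<^esub> y) = f x \<oplus>\<^bsub>R\<^esub> f y"
    and "\<And>a x. a \<in> carrier R \<Longrightarrow> x \<in> carrier P \<Longrightarrow> f (a \<odot>\<^bsub>P\<^esub> x) = a \<otimes>\<^bsub>R\<^esub> f x"
    and "f \<in> extensional (carrier P)"
  shows "f \<in> carrier (ring_dual R P)"
  using assms by (simp add: ring_dual_simps left_hom_regular PiE_def)

lemma ring_dualD:
  assumes "f \<in> carrier (ring_dual R P)"
  shows "x \<in> carrier P \<Longrightarrow> f x \<in> carrier R"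
    and "x \<in> carrier P \<Longrightarrow> y \<in> carrier P \<Longrightarrow> f (x \<oplus>\<^bsub>P\<^esub> y) = f x \<oplus>\<^bsub>R\<^esub> f y"
    and "a \<in> carrier R \<Longrightarrow> x \<in> carrier P \<Longrightarrow> f (a \<odot>\<^bsub>P\<^esub> x) = a \<otimes>\<^bsub>R\<^esub> f x"
    and "f \<in> extensional (carrier P)"
  using assms by (auto simp: ring_dual_simps left_hom_regular PiE_def)

lemma ring_dual_apply:
  assumes "x \<in> carrier P"
  shows "\<zero>\<^bsub>ring_dual R P\<^esub> x = \<zero>\<^bsub>R\<^esub>" "(f \<oplus>\<^bsub>ring_dual R P\<^esub> g) x = f x \<oplus>\<^bsub>R\<^esub> g x"
    "(a \<odot>\<^bsub>ring_dual R P\<^esub> f) x = f x \<otimes>\<^bsub>R\<^esub> a"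
  using assms by (simp_all add: ring_dual_simps)

lemma ring_dual_extensional:
  "\<zero>\<^bsub>ring_dual R P\<^esub> \<in> extensional (carrier P)" "f \<oplus>\<^bsub>ring_dual R P\<^esub> g \<in> extensional (carrier P)"
  "a \<odot>\<^bsub>ring_dual R P\<^esub> f \<in> extensional (carrier P)"
  by (simp_all add: ring_dual_simps)

lemma left_module_ring_dual:
  fixes R :: "'a ring" and P :: "('a, 'p) module"
  assumes "left_module R P"
  shows "left_module (op_ring R) (ring_dual R P)"
proof -
  interpret left_module R P by fact
  note D = ring_dualD[where R = R and P = P] and app = ring_dual_apply[where R = R and P = P]
    and ext = extensionalityI[where A = "carrier P"]
  note simps = app D(1-3) R.l_distr R.r_distr R.m_assoc smult_closed R.a_ac
  have zero: "\<zero>\<^bsub>ring_dual R P\<^esub> \<in> carrier (ring_dual R P)"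
    by (intro ring_dualI ring_dual_extensional) (simp_all add: app smult_closed)
  have add: "f \<oplus>\<^bsub>ring_dual R P\<^esub> g \<in> carrier (ring_dual R P)"
    if "f \<in> carrier (ring_dual R P)" "g \<in> carrier (ring_dual R P)" for f g
    using that by (intro ring_dualI ring_dual_extensional) (simp_all add: simps)
  have smult: "a \<odot>\<^bsub>ring_dual R P\<^esub> f \<in> carrier (ring_dual R P)"
    if "f \<in> carrier (ring_dual R P)" "a \<in> carrier R" for f a
    using that by (intro ring_dualI ring_dual_extensional) (simp_all add: simps)
  have minus: "\<exists>g\<in>carrier (ring_dual R P). g \<oplus>\<^bsub>ring_dual R P\<^esub> f = \<zero>\<^bsub>ring_dual R P\<^esub>"
    if f: "f \<in> carrier (ring_dual R P)" for f
  proof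
    show "(\<ominus>\<^bsub>R\<^esub> \<one>\<^bsub>R\<^esub>) \<odot>\<^bsub>ring_dual R P\<^esub> f \<in> carrier (ring_dual R P)"
      using f by (intro smult) auto
    then show "(\<ominus>\<^bsub>R\<^esub> \<one>\<^bsub>R\<^esub>) \<odot>\<^bsub>ring_dual R P\<^esub> f \<oplus>\<^bsub>ring_dual R P\<^esub> f = \<zero>\<^bsub>ring_dual R P\<^esub>"
      using f by (intro ext ring_dual_extensional) (simp add: app D(1) R.r_minus R.l_neg)
  qed
  show ?thesis
  proof (rule left_moduleI)
    show "ring (op_ring R)" by (rule ring_op_ring) (rule R.ring_axioms)
    show "abelian_group (ring_dual R P)"
    proof (rule abelian_groupI)
      show "\<zero>\<^bsub>ring_dual R P\<^esub> \<oplus>\<^bsub>ring_dual R P\<^esub> f = f" if "f \<in> carrier (ring_dual R P)" for f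
        using that by (intro ext ring_dual_extensional D(4)) (simp_all add: app D(1))
    qed (use zero add minus in \<open>auto simp: simps intro!: ext ring_dual_extensional\<close>)
    show "\<one>\<^bsub>op_ring R\<^esub> \<odot>\<^bsub>ring_dual R P\<^esub> f = f" if "f \<in> carrier (ring_dual R P)" for f
      using that by (intro ext ring_dual_extensional D(4)) (simp_all add: app D(1))
  qed (auto simp: simps smult add intro!: ext ring_dual_extensional)
qed


section \<open>Modules with a basis indexed by an array\<close>

text \<open>Two epimorphisms with the same kernel identify the same pairs of elements, so
  \<open>q x \<mapsto> q' x\<close> is well defined and injective.\<close>

lemma left_iso_of_epis:
  assumes M: "left_module R M" and q: "module_epi R M N q" and q': "module_epi R M N' q'"
    and ker: "\<And>x. x \<in> carrier M \<Longrightarrow> q x = \<zero>\<^bsub>N\<^esub> \<longleftrightarrow> q' x = \<zero>\<^bsub>N'\<^esub>"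
  shows "\<exists>h \<in> left_iso R N N'. \<forall>x \<in> carrier M. h (q x) = q' x"
proof -
  interpret left_module R M by (rule M)
  note qD = module_epiD[OF q] and q'D = module_epiD[OF q']
  define h where "h = (\<lambda>z\<in>carrier N. q' (SOME x. x \<in> carrier M \<and> z = q x))"
  have eq: "q x = q y \<longleftrightarrow> q' x = q' y" if "x \<in> carrier M" "y \<in> carrier M" for x y
    using that ker[of "x \<ominus>\<^bsub>M\<^esub> y"] by (simp add: module_epi_eq_iff[OF M q] module_epi_eq_iff[OF M q'])
  have hq: "h (q x) = q' x" if x: "x \<in> carrier M" for x
  proof -
    let ?y = "SOME y. y \<in> carrier M \<and> q x = q y"
    have "?y \<in> carrier M \<and> q x = q ?y" by (rule someI[of _ x]) (use x in auto)
    then have "q' ?y = q' x" using eq x by metis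
    then show ?thesis using x qD(1) by (simp add: h_def)
  qed
  have cN: "carrier N = q ` carrier M" and cN': "carrier N' = q' ` carrier M"
    using q q' by (auto simp: module_epi_def)
  have "h \<in> left_hom R N N'"
    unfolding left_hom_def
    by (auto simp: cN hq cN' qD(3,4)[symmetric] q'D(3,4) smult_closed)
       (simp add: h_def cN)
  moreover have "bij_betw h (carrier N) (carrier N')"
    unfolding bij_betw_def inj_on_def by (auto simp: cN cN' hq eq image_image)
  ultimately show ?thesis using hq by (auto simp: left_iso_def)
qed

text \<open>Multiplication by a single monomial with counts \<open>(a, b)\<close>: of all splittings
  only the one at \<open>(r - a, c - b)\<close> survives. \<open>P\<close> stands for the condition
  that the vertices fit together.\<close>

lemma double_sum_delta:
  fixes g :: "nat \<Rightarrow> nat \<Rightarrow> 'k::field"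
  shows "(\<Sum>r'\<le>r. \<Sum>c'\<le>c. (if P r' c' \<and> r - r' = a \<and> c - c' = b then k else 0) * g r' c') =
    (if a \<le> r \<and> b \<le> c \<and> P (r - a) (c - b) then k * g (r - a) (c - b) else 0)"
proof -
  let ?v = "if P (r - a) (c - b) then k * g (r - a) (c - b) else 0"
  have "(if P r' c' \<and> r - r' = a \<and> c - c' = b then k else 0) * g r' c' =
      (if c' = c - b then if r' = r - a then if a \<le> r \<and> b \<le> c then ?v else 0 else 0 else 0)"
    if "r' \<le> r" "c' \<le> c" for r' c'
  proof -
    have "r - r' = a \<longleftrightarrow> a \<le> r \<and> r' = r - a" "c - c' = b \<longleftrightarrow> b \<le> c \<and> c' = c - b"
      using that by linarith+
    then show ?thesis by simp
  qed
  then have "(\<Sum>r'\<le>r. \<Sum>c'\<le>c. (if P r' c' \<and> r - r' = a \<and> c - c' = b then k else 0) * g r' c') =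
     (\<Sum>r'\<le>r. \<Sum>c'\<le>c. if c' = c - b then if r' = r - a then if a \<le> r \<and> b \<le> c then ?v else 0 else 0 else 0)"
    by (intro sum.cong refl) simp
  also have "\<dots> = (\<Sum>r'\<le>r. if r' = r - a then if a \<le> r \<and> b \<le> c then ?v else 0 else 0)"
    by (intro sum.cong refl) (subst sum.delta, simp, simp)
  also have "\<dots> = (if a \<le> r \<and> b \<le> c then ?v else 0)"
    by (subst sum.delta) simp_all
  finally show ?thesis by simp
qed

lemma coord_array_vec_mult:
  assumes "(v, a, b) \<in> box n" "x \<in> carrier (preproj n)" "(s, a', b') \<in> box n"
  shows "coord n (array_vec n v (a, b) \<otimes>\<^bsub>preproj n\<^esub> x) s a' b' =
    (if a \<le> a' \<and> b \<le> b' \<and> s + (a' - a) - (b' - b) = v then coord n x s (a' - a) (b' - b) else 0)"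
  using coord_mult[OF array_vec_carrier[OF assms(1)] assms(2,3)]
    double_sum_delta[where r = a' and c = b' and P = "\<lambda>r' c'. s + r' - c' = v" and a = a and b = b
      and k = 1 and g = "coord n x s"]
  by (simp only: coord_array_vec[OF assms(1)] mult_1)

lemma proj_array_iff: "1 \<le> l \<Longrightarrow> l \<le> n \<Longrightarrow> (r, c) \<in> proj_array n l \<longleftrightarrow> (l, r, c) \<in> box n"
  by (auto simp: proj_array_def box_def)

lemma pred_closed_subarrayD:
  assumes "pred_closed_subarray n l Y" "(r, c) \<in> Y" "r' \<le> r" "c' \<le> c"
  shows "(r', c') \<in> Y"
proof -
  have step: "(Suc r, c) \<in> Y \<Longrightarrow> (r, c) \<in> Y" "(r, Suc c) \<in> Y \<Longrightarrow> (r, c) \<in> Y" for r c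
    using assms(1) unfolding pred_closed_subarray_def Suc_eq_plus1 by blast+
  have "(r', c) \<in> Y" using assms(3) by (induction rule: inc_induct) (use assms(2) step in blast)+
  with assms(4) show ?thesis by (induction rule: inc_induct) (use step in blast)+
qed

text \<open>An axiomatic form of a factor module of P_l, so that P_l, \<open>J(w)\<close> and all
  other factors are treated at once. \<open>\<mu> x r c\<close> is the coefficient of
  \<open>x\<close> at the position \<open>(r, c)\<close>; on \<open>Y\<close> the coefficients are
  arbitrary and determine \<open>x\<close>, and scalars act by the convolution of
  \<open>\<Pi>\<close>. As \<open>Y\<close> is closed under predecessors, this sum stays inside
  \<open>Y\<close>.\<close>

locale array_module = left_module "preproj n" M
  for n and M :: "('k::field preproj_elem, 'm) module" +
  fixes l :: nat and Y :: "(nat \<times> nat) set" and \<mu> :: "'m \<Rightarrow> nat \<Rightarrow> nat \<Rightarrow> 'k"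
  assumes vertex: "1 \<le> l" "l \<le> n"
    and closed: "pred_closed_subarray n l Y"
    and mu_outside: "(r, c) \<notin> Y \<Longrightarrow> \<mu> x r c = 0"
    and mu_eqI: "x \<in> carrier M \<Longrightarrow> y \<in> carrier M \<Longrightarrow> (\<And>r c. (r, c) \<in> Y \<Longrightarrow> \<mu> x r c = \<mu> y r c) \<Longrightarrow> x = y"
    and mu_exists: "\<exists>x \<in> carrier M. \<forall>r c. (r, c) \<in> Y \<longrightarrow> \<mu> x r c = F r c"
    and mu_add: "x \<in> carrier M \<Longrightarrow> y \<in> carrier M \<Longrightarrow> \<mu> (x \<oplus>\<^bsub>M\<^esub> y) r c = \<mu> x r c + \<mu> y r c"
    and mu_smult: "a \<in> carrier (preproj n) \<Longrightarrow> x \<in> carrier M \<Longrightarrow> (r, c) \<in> Y \<Longrightarrow>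
      \<mu> (a \<odot>\<^bsub>M\<^esub> x) r c = (\<Sum>r'\<le>r. \<Sum>c'\<le>c. coord n a (l + r' - c') (r - r') (c - c') * \<mu> x r' c')"
begin

lemma in_box: "(r, c) \<in> Y \<Longrightarrow> (l, r, c) \<in> box n"
  using closed proj_array_iff[OF vertex] unfolding pred_closed_subarray_def by blast

lemmas down = pred_closed_subarrayD[OF closed]

lemma finite_Y: "finite Y"
  using in_box vertex by (intro finite_subset[of Y "{..n} \<times> {..n}"]) (force simp: box_def)+

lemma mu_zero: "\<mu> \<zero>\<^bsub>M\<^esub> r c = 0"
proof -
  have "\<mu> \<zero>\<^bsub>M\<^esub> r c = \<mu> \<zero>\<^bsub>M\<^esub> r c + \<mu> \<zero>\<^bsub>M\<^esub> r c"
    using mu_add[OF M.zero_closed M.zero_closed, of r c] M.l_zero[OF M.zero_closed] by simp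
  then show ?thesis by (simp only: add_cancel_right_right)
qed

lemma mu_minus:
  assumes "x \<in> carrier M" "y \<in> carrier M"
  shows "\<mu> (x \<ominus>\<^bsub>M\<^esub> y) r c = \<mu> x r c - \<mu> y r c"
proof -
  have "(x \<ominus>\<^bsub>M\<^esub> y) \<oplus>\<^bsub>M\<^esub> y = x" using assms by (simp add: a_minus_def M.a_assoc M.l_neg)
  then show ?thesis using mu_add[of "x \<ominus>\<^bsub>M\<^esub> y" y r c] assms by simp
qed

lemma mu_scalar:
  assumes "x \<in> carrier M"
  shows "\<mu> (scalar_elem n k \<odot>\<^bsub>M\<^esub> x) r c = k * \<mu> x r c"
proof (cases "(r, c) \<in> Y")
  case True
  have "\<mu> (scalar_elem n k \<odot>\<^bsub>M\<^esub> x) r c = (\<Sum>r'\<le>r. \<Sum>c'\<le>c.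
      (if (1 \<le> l + r' - c' \<and> l + r' - c' \<le> n) \<and> r - r' = 0 \<and> c - c' = 0 then k else 0) * \<mu> x r' c')"
    unfolding mu_smult[OF scalar_elem_carrier assms True]
    by (intro sum.cong refl) (simp add: coord_scalar_elem conj_assoc)
  also have "\<dots> = k * \<mu> x r c"
    using in_box[OF True] by (subst double_sum_delta) (auto simp: box_def)
  finally show ?thesis .
qed (simp add: mu_outside)

lemma mu_array_vec_smult:
  assumes "(v, a, b) \<in> box n" "x \<in> carrier M" "(r, c) \<in> Y"
  shows "\<mu> (array_vec n v (a, b) \<odot>\<^bsub>M\<^esub> x) r c =
    (if a \<le> r \<and> b \<le> c \<and> l + (r - a) - (c - b) = v then \<mu> x (r - a) (c - b) else 0)"
  using mu_smult[OF array_vec_carrier[OF assms(1)] assms(2,3)]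
    double_sum_delta[where r = r and c = c and P = "\<lambda>r' c'. l + r' - c' = v" and a = a and b = b
      and k = 1 and g = "\<mu> x"]
  by (simp only: coord_array_vec[OF assms(1)] mult_1)

definition vec :: "nat \<times> nat \<Rightarrow> 'm" where
  "vec s = (SOME x. x \<in> carrier M \<and> (\<forall>r c. (r, c) \<in> Y \<longrightarrow> \<mu> x r c = (if (r, c) = s then 1 else 0)))"

lemma vec: "vec s \<in> carrier M" "(r, c) \<in> Y \<Longrightarrow> \<mu> (vec s) r c = (if (r, c) = s then 1 else 0)"
  using someI_ex[OF mu_exists[of "\<lambda>r c. if (r, c) = s then 1 else 0", unfolded Bex_def]]
  unfolding vec_def by blast+

lemma mu_vec: "s \<in> Y \<Longrightarrow> \<mu> (vec s) r c = (if (r, c) = s then 1 else 0)"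
  by (cases "(r, c) \<in> Y") (auto simp: vec mu_outside)

lemma support_induct:
  assumes "S \<subseteq> Y" "x \<in> carrier M" "\<And>r c. (r, c) \<notin> S \<Longrightarrow> \<mu> x r c = 0"
    and zero: "P \<zero>\<^bsub>M\<^esub>"
    and add: "\<And>y z. y \<in> carrier M \<Longrightarrow> z \<in> carrier M \<Longrightarrow> P y \<Longrightarrow> P z \<Longrightarrow> P (y \<oplus>\<^bsub>M\<^esub> z)"
    and base: "\<And>k s. s \<in> S \<Longrightarrow> P (scalar_elem n k \<odot>\<^bsub>M\<^esub> vec s)"
  shows "P x"
proof -
  have "finite S" using assms(1) finite_Y finite_subset by blast
  then show ?thesis using assms(1,2,3) base
  proof (induction S arbitrary: x rule: finite_induct)
    case empty
    then have "x = \<zero>\<^bsub>M\<^esub>" by (intro mu_eqI) (auto simp: mu_zero)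
    then show ?case using zero by simp
  next
    case (insert s S)
    obtain r c where s: "s = (r, c)" by (cases s)
    obtain y where y: "y \<in> carrier M" "\<And>r' c'. (r', c') \<in> Y \<Longrightarrow> \<mu> y r' c' = (if (r', c') = s then 0 else \<mu> x r' c')"
      using mu_exists[of "\<lambda>r' c'. if (r', c') = s then 0 else \<mu> x r' c'"] by blast
    let ?z = "scalar_elem n (\<mu> x r c) \<odot>\<^bsub>M\<^esub> vec s"
    have z: "?z \<in> carrier M" by (intro smult_closed scalar_elem_carrier vec(1))
    have "\<mu> y r' c' = 0" if "(r', c') \<notin> S" for r' c'
      using that insert.prems(3)[of r' c'] y(2)[of r' c'] mu_outside[of r' c'] by (cases "(r', c') \<in> Y") auto
    then have "P y" using insert y(1) by blast
    moreover have "P ?z" using insert.prems by blast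
    ultimately have "P (?z \<oplus>\<^bsub>M\<^esub> y)" using add z y(1) by blast
    moreover have "?z \<oplus>\<^bsub>M\<^esub> y = x"
      using z y insert.prems(1,2)
      by (intro mu_eqI) (auto simp: mu_add mu_scalar vec(1) mu_vec s)
    ultimately show ?case by simp
  qed
qed

lemma support_mem:
  assumes "submodule U (preproj n) M" "S \<subseteq> Y" "\<And>s. s \<in> S \<Longrightarrow> vec s \<in> U"
    and "x \<in> carrier M" "\<And>r c. (r, c) \<notin> S \<Longrightarrow> \<mu> x r c = 0"
  shows "x \<in> U"
  using assms(2,4,5)
proof (rule support_induct[where P = "\<lambda>x. x \<in> U"])
  show "scalar_elem n k \<odot>\<^bsub>M\<^esub> vec s \<in> U" if "s \<in> S" for k s
    by (rule submoduleD(4)[OF assms(1) scalar_elem_carrier assms(3)[OF that]])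
qed (simp_all add: submoduleD(2,3)[OF assms(1)])

text \<open>The elements at a fixed vertex form a uniserial module over \<open>k[z]\<close>, where \<open>z\<close> acts as \<open>xy = yx\<close>.\<close>

lemma vec_mem_submodule:
  assumes U: "submodule U (preproj n) M" and x: "x \<in> U" "\<mu> x r c \<noteq> 0"
  shows "vec (r, c) \<in> U"
proof -
  note UD = submoduleD[OF U]
  have rc: "(r, c) \<in> Y" using x mu_outside by blast
  define v where "v = l + r - c"
  have v: "(v, 0, 0) \<in> box n" using in_box[OF rc] by (auto simp: box_def v_def)
  \<comment> \<open>Multiplying by the idempotent at \<open>v\<close> keeps only the coefficients on
    the diagonal of \<open>(r, c)\<close>.\<close>
  define w where "w = array_vec n v (0, 0) \<odot>\<^bsub>M\<^esub> x"
  have w: "w \<in> U" "w \<in> carrier M" using UD(1,4) x array_vec_carrier[OF v] unfolding w_def by blast+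
  have mu_w: "\<mu> w r' c' = (if l + r' - c' = v then \<mu> x r' c' else 0)" for r' c'
  proof (cases "(r', c') \<in> Y")
    case True
    then show ?thesis using mu_array_vec_smult[OF v _ True, of x] UD(1) x by (simp add: w_def)
  qed (simp add: mu_outside)
  define Q where "Q = (\<lambda>r'. \<exists>c'. \<mu> w r' c' \<noteq> 0)"
  \<comment> \<open>The top position \<open>(r0, c0)\<close> of the support of \<open>w\<close>
    carries the lowest power of xy, and every position of \<open>Y\<close> at \<open>v\<close> from
    this row downwards is \<open>(r0 + k, c0 + k)\<close> for some \<open>k\<close>.\<close>
  define r0 where "r0 = (LEAST r'. Q r')"
  have Qr: "Q r" unfolding Q_def by (rule exI[of _ c]) (use x in \<open>simp add: mu_w v_def\<close>)
  then have "Q r0" "r0 \<le> r" unfolding r0_def by (rule LeastI, rule Least_le)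
  then obtain c0 where c0: "\<mu> w r0 c0 \<noteq> 0" by (auto simp: Q_def)
  have below: "\<mu> w r' c' = 0" if "r' < r0" for r' c' using that not_less_Least Q_def r0_def by blast
  have Y0: "(r0, c0) \<in> Y" using c0 mu_outside by blast
  have v0: "l + r0 = v + c0" using c0 in_box[OF Y0] by (auto simp: mu_w box_def split: if_splits)
  have c: "c = c0 + (r - r0)" using v0 \<open>r0 \<le> r\<close> in_box[OF rc] by (auto simp: v_def box_def)
  \<comment> \<open>The positions on the diagonal are treated from the far end, where
    \<open>k \<ge> n\<close> leaves the array, back to the top, so that all later basis vectors are
    already known to lie in \<open>U\<close>.\<close>
  have "\<forall>k\<ge>n - j. (r0 + k, c0 + k) \<in> Y \<longrightarrow> vec (r0 + k, c0 + k) \<in> U" for j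
  proof (induction j)
    case 0
    show ?case
    proof (intro allI impI)
      fix k assume "k \<ge> n - 0" "(r0 + k, c0 + k) \<in> Y"
      then have False using in_box vertex by (fastforce simp: box_def)
      then show "vec (r0 + k, c0 + k) \<in> U" ..
    qed
  next
    case (Suc j)
    show ?case
    proof (intro allI impI)
      fix k assume k: "k \<ge> n - Suc j" "(r0 + k, c0 + k) \<in> Y"
      have vk: "(v, k, k) \<in> box n" using in_box[OF k(2)] v0 by (auto simp: box_def)
      \<comment> \<open>Multiplication by the \<open>k\<close>-th power of xy moves the leading term
        of \<open>w\<close> to the position \<open>k\<close>. What follows it on the diagonal lies
        in \<open>U\<close> by induction and can be subtracted.\<close>
      define y where "y = array_vec n v (k, k) \<odot>\<^bsub>M\<^esub> w"
      have y: "y \<in> U" "y \<in> carrier M" using UD(1,4) w array_vec_carrier[OF vk] unfolding y_def by blast+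
      have mu_y: "\<mu> y r' c' = (if k \<le> r' \<and> k \<le> c' \<and> l + (r' - k) - (c' - k) = v then \<mu> w (r' - k) (c' - k) else 0)"
        if "(r', c') \<in> Y" for r' c'
        unfolding y_def by (rule mu_array_vec_smult[OF vk w(2) that])
      define \<alpha> where "\<alpha> = \<mu> w r0 c0"
      define u where "u = scalar_elem n \<alpha> \<odot>\<^bsub>M\<^esub> vec (r0 + k, c0 + k)"
      have u: "u \<in> carrier M" by (simp add: u_def smult_closed scalar_elem_carrier vec)
      have mu_u: "\<mu> u r' c' = (if (r', c') = (r0 + k, c0 + k) then \<alpha> else 0)" for r' c'
        using k(2) by (simp add: u_def mu_scalar vec(1) mu_vec)
      define S where "S = {(r', c') \<in> Y. \<exists>k'>k. r' = r0 + k' \<and> c' = c0 + k'}"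
      have S: "vec s \<in> U" if s: "s \<in> S" for s
      proof -
        from s obtain k' where "k' > k" "s = (r0 + k', c0 + k')" "(r0 + k', c0 + k') \<in> Y"
          by (auto simp: S_def)
        then show ?thesis using Suc.IH k(1) by auto
      qed
      have "y \<ominus>\<^bsub>M\<^esub> u \<in> carrier M" using y u by simp
      moreover have "\<mu> (y \<ominus>\<^bsub>M\<^esub> u) r' c' = 0" if s: "(r', c') \<notin> S" for r' c'
      proof (cases "(r', c') \<in> Y")
        case True
        have "\<mu> y r' c' = \<mu> u r' c'"
        proof (cases "(r', c') = (r0 + k, c0 + k)")
          case True
          then show ?thesis using mu_y[OF k(2)] v0 in_box[OF Y0] by (simp add: mu_u \<alpha>_def)
        next
          case False
          have "\<mu> y r' c' = 0"
          proof (rule ccontr)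
            assume "\<mu> y r' c' \<noteq> 0"
            then have *: "k \<le> r'" "k \<le> c'" "l + (r' - k) - (c' - k) = v" "\<mu> w (r' - k) (c' - k) \<noteq> 0"
              using mu_y[OF True] by (auto split: if_splits)
            then have "(r' - k, c' - k) \<in> Y" "r0 \<le> r' - k" using mu_outside below by (blast, metis not_le)
            moreover have "c' - k < l + (r' - k)" using in_box[OF \<open>(r' - k, c' - k) \<in> Y\<close>] by (auto simp: box_def)
            ultimately have "r' = r0 + (r' - r0)" "c' = c0 + (r' - r0)" "k \<le> r' - r0" "r0 \<le> r'"
              using * v0 by auto
            moreover have "r' - r0 \<noteq> k" using calculation False by auto
            ultimately have "(r', c') \<in> S"
              unfolding S_def using True by (intro CollectI case_prodI conjI exI[of _ "r' - r0"]) auto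
            then show False using s by simp
          qed
          then show ?thesis using False by (auto simp: mu_u)
        qed
        then show ?thesis using y u by (simp add: mu_minus)
      qed (simp add: mu_outside)
      moreover have "S \<subseteq> Y" unfolding S_def by blast
      ultimately have "y \<ominus>\<^bsub>M\<^esub> u \<in> U" using support_mem[OF U _ S] by blast
      then have "y \<ominus>\<^bsub>M\<^esub> (y \<ominus>\<^bsub>M\<^esub> u) \<in> U" by (rule UD(6)[OF y(1)])
      also have "y \<ominus>\<^bsub>M\<^esub> (y \<ominus>\<^bsub>M\<^esub> u) = u"
        using y u by (intro mu_eqI) (simp_all add: mu_minus)
      finally have "scalar_elem n (1 / \<alpha>) \<odot>\<^bsub>M\<^esub> u \<in> U" by (rule UD(4)[OF scalar_elem_carrier])
      moreover have "scalar_elem n (1 / \<alpha>) \<odot>\<^bsub>M\<^esub> u = vec (r0 + k, c0 + k)"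
        using u c0 k(2) by (intro mu_eqI) (auto simp: smult_closed scalar_elem_carrier vec mu_scalar mu_u mu_vec \<alpha>_def)
      ultimately show "vec (r0 + k, c0 + k) \<in> U" by simp
    qed
  qed
  from this[of n] have "(r0 + (r - r0), c0 + (r - r0)) \<in> Y \<longrightarrow> vec (r0 + (r - r0), c0 + (r - r0)) \<in> U"
    unfolding diff_self_eq_0 by blast
  moreover have "(r0 + (r - r0), c0 + (r - r0)) = (r, c)" using c \<open>r0 \<le> r\<close> by simp
  ultimately show ?thesis using rc by simp
qed

section \<open>Submodules and indecomposability\<close>

lemma array_vec_smult_vec:
  assumes "(r, c) \<in> Y" "(l + r - c, a, b) \<in> box n"
  shows "array_vec n (l + r - c) (a, b) \<odot>\<^bsub>M\<^esub> vec (r, c) =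
    (if (r + a, c + b) \<in> Y then vec (r + a, c + b) else \<zero>\<^bsub>M\<^esub>)"
proof (rule mu_eqI)
  fix r' c' assume Y: "(r', c') \<in> Y"
  have "c < l + r" using in_box[OF assms(1)] by (auto simp: box_def)
  then show "\<mu> (array_vec n (l + r - c) (a, b) \<odot>\<^bsub>M\<^esub> vec (r, c)) r' c' =
      \<mu> (if (r + a, c + b) \<in> Y then vec (r + a, c + b) else \<zero>\<^bsub>M\<^esub>) r' c'"
    using Y by (auto simp: mu_array_vec_smult[OF assms(2) vec(1) Y] mu_vec mu_zero assms(1))
qed (simp_all add: smult_closed array_vec_carrier assms vec)

text \<open>By \<open>vec_mem_submodule\<close> an element of \<open>U\<close> only involves basis
  vectors that are themselves in \<open>U\<close>. A submodule is thus the same as the set of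
  positions whose basis vectors it contains.\<close>

lemma submodule_eq:
  assumes U: "submodule U (preproj n) M"
  shows "U = {x \<in> carrier M. \<forall>(r, c) \<in> Y. vec (r, c) \<notin> U \<longrightarrow> \<mu> x r c = 0}"
proof
  show "U \<subseteq> {x \<in> carrier M. \<forall>(r, c) \<in> Y. vec (r, c) \<notin> U \<longrightarrow> \<mu> x r c = 0}"
    using vec_mem_submodule[OF U] submoduleD(1)[OF U] by blast
  show "{x \<in> carrier M. \<forall>(r, c) \<in> Y. vec (r, c) \<notin> U \<longrightarrow> \<mu> x r c = 0} \<subseteq> U"
  proof
    fix x assume x: "x \<in> {x \<in> carrier M. \<forall>(r, c) \<in> Y. vec (r, c) \<notin> U \<longrightarrow> \<mu> x r c = 0}"
    then have "\<mu> x r c = 0" if "(r, c) \<notin> {s \<in> Y. vec s \<in> U}" for r c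
      using that mu_outside[of r c x] by (cases "(r, c) \<in> Y") auto
    with x show "x \<in> U"
      by (elim CollectE, rule_tac support_mem[OF U, of "{s \<in> Y. vec s \<in> U}"]) auto
  qed
qed

lemma submodule_complement_closed:
  assumes U: "submodule U (preproj n) M"
  shows "pred_closed_subarray n l {s \<in> Y. vec s \<notin> U}"
proof -
  have *: "vec (r + a, c + b) \<in> U" if "vec (r, c) \<in> U" "(r + a, c + b) \<in> Y" for r c a b
  proof -
    have rc: "(r, c) \<in> Y" using down[OF that(2), of r c] by simp
    have b: "(l + r - c, a, b) \<in> box n" using in_box[OF that(2)] by (auto simp: box_def)
    show ?thesis
      using array_vec_smult_vec[OF rc b] that submoduleD(4)[OF U array_vec_carrier[OF b] that(1)] by simp
  qed
  have "vec (r + 1, c) \<in> U" if "vec (r, c) \<in> U" "(r + 1, c) \<in> Y" for r c using that *[of r c 1 0] by simp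
  moreover have "vec (r, c + 1) \<in> U" if "vec (r, c) \<in> U" "(r, c + 1) \<in> Y" for r c
    using that *[of r c 0 1] by simp
  ultimately show ?thesis
    using closed unfolding pred_closed_subarray_def by blast
qed

text \<open>The positions missing from \<open>U\<close> are closed under predecessors, so there are
  none if the origin is not among them.\<close>

lemma vec_origin_generates:
  assumes U: "submodule U (preproj n) M" and "vec (0, 0) \<in> U"
  shows "U = carrier M"
proof
  show "U \<subseteq> carrier M" using submoduleD(1)[OF U] by blast
  show "carrier M \<subseteq> U"
  proof
    fix x assume x: "x \<in> carrier M"
    have "vec s \<in> U" if "s \<in> Y" for s
      using submodule_complement_closed[OF U, THEN pred_closed_subarrayD, of "fst s" "snd s" 0 0] that assms(2)
      by auto
    then show "x \<in> U" using support_mem[OF U order_refl _ x] mu_outside by blast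
  qed
qed

text \<open>The module is local. When the generator is written as \<open>u + v\<close>, one of the
  summands has a non-zero coefficient at the origin; its submodule then contains the generator and
  is everything, which leaves 0 for the other one.\<close>

lemma indecomposable:
  assumes "(0, 0) \<in> Y"
  shows "indecomposable_module (preproj n) M"
  unfolding indecomposable_module_def
proof (intro conjI allI impI)
  have "vec (0, 0) \<noteq> \<zero>\<^bsub>M\<^esub>" using mu_vec[OF assms, of 0 0] mu_zero[of 0 0] by auto
  then show "carrier M \<noteq> {\<zero>\<^bsub>M\<^esub>}" using vec(1)[of "(0, 0)"] by auto
  fix U V assume *: "submodule U (preproj n) M \<and> submodule V (preproj n) M \<and> U \<inter> V = {\<zero>\<^bsub>M\<^esub>} \<and>
    U <+>\<^bsub>M\<^esub> V = carrier M"
  then have U: "submodule U (preproj n) M" and V: "submodule V (preproj n) M" by auto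
  have "vec (0, 0) \<in> U <+>\<^bsub>M\<^esub> V" using * vec(1) by blast
  then obtain u v where uv: "u \<in> U" "v \<in> V" "vec (0, 0) = u \<oplus>\<^bsub>M\<^esub> v"
    by (auto simp: set_add_def')
  then have "\<mu> u 0 0 + \<mu> v 0 0 = 1"
    using mu_add[of u v 0 0] mu_vec[OF assms, of 0 0] submoduleD(1)[OF U] submoduleD(1)[OF V] by simp
  then have "\<mu> u 0 0 \<noteq> 0 \<or> \<mu> v 0 0 \<noteq> 0" by auto
  then have "U = carrier M \<or> V = carrier M"
    using vec_mem_submodule[OF U uv(1)] vec_mem_submodule[OF V uv(2)]
      vec_origin_generates[OF U] vec_origin_generates[OF V] by blast
  moreover have "U \<subseteq> carrier M" "V \<subseteq> carrier M"
    using submoduleD(1)[OF U] submoduleD(1)[OF V] by blast+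
  ultimately show "U = {\<zero>\<^bsub>M\<^esub>} \<or> V = {\<zero>\<^bsub>M\<^esub>}" using * by blast
qed

section \<open>Spans and bases\<close>

lemma mu_finsum:
  assumes "finite S" "g \<in> S \<rightarrow> carrier M"
  shows "\<mu> (\<Oplus>\<^bsub>M\<^esub>s\<in>S. g s) r c = (\<Sum>s\<in>S. \<mu> (g s) r c)"
  using assms
proof (induction S rule: finite_induct)
  case (insert s S)
  then have "(\<Oplus>\<^bsub>M\<^esub>s\<in>S. g s) \<in> carrier M" by (intro M.finsum_closed) auto
  with insert show ?case by (simp add: M.finsum_insert mu_add)
qed (simp add: mu_zero)

lemma combination:
  assumes "S \<subseteq> Y"
  shows "(\<Oplus>\<^bsub>M\<^esub>s\<in>S. scalar_elem n (k s) \<odot>\<^bsub>M\<^esub> vec s) \<in> carrier M"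
    and "\<mu> (\<Oplus>\<^bsub>M\<^esub>s\<in>S. scalar_elem n (k s) \<odot>\<^bsub>M\<^esub> vec s) r c = (if (r, c) \<in> S then k (r, c) else 0)"
proof -
  have S: "finite S" using assms finite_Y finite_subset by blast
  have f: "(\<lambda>s. scalar_elem n (k s) \<odot>\<^bsub>M\<^esub> vec s) \<in> S \<rightarrow> carrier M"
    by (auto intro: smult_closed scalar_elem_carrier vec)
  then show "(\<Oplus>\<^bsub>M\<^esub>s\<in>S. scalar_elem n (k s) \<odot>\<^bsub>M\<^esub> vec s) \<in> carrier M"
    by (intro M.finsum_closed)
  have "(\<Sum>s\<in>S. \<mu> (scalar_elem n (k s) \<odot>\<^bsub>M\<^esub> vec s) r c) = (\<Sum>s\<in>S. if s = (r, c) then k s else 0)"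
  proof (intro sum.cong refl)
    fix s assume "s \<in> S"
    then have "\<mu> (vec s) r c = (if (r, c) = s then 1 else 0)" using mu_vec assms by blast
    then show "\<mu> (scalar_elem n (k s) \<odot>\<^bsub>M\<^esub> vec s) r c = (if s = (r, c) then k s else 0)"
      by (auto simp: mu_scalar vec(1))
  qed
  then show "\<mu> (\<Oplus>\<^bsub>M\<^esub>s\<in>S. scalar_elem n (k s) \<odot>\<^bsub>M\<^esub> vec s) r c = (if (r, c) \<in> S then k (r, c) else 0)"
    using mu_finsum[OF S f] S by (simp add: sum.delta)
qed

lemma k_span_vec:
  assumes "S \<subseteq> Y"
  shows "k_span (scalar_elem n) M S vec = {x \<in> carrier M. \<forall>(r, c) \<in> Y - S. \<mu> x r c = 0}"
proof
  show "k_span (scalar_elem n) M S vec \<subseteq> {x \<in> carrier M. \<forall>(r, c) \<in> Y - S. \<mu> x r c = 0}"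
    using combination[OF assms] by (auto simp: k_span_def)
  show "{x \<in> carrier M. \<forall>(r, c) \<in> Y - S. \<mu> x r c = 0} \<subseteq> k_span (scalar_elem n) M S vec"
  proof
    fix x assume x: "x \<in> {x \<in> carrier M. \<forall>(r, c) \<in> Y - S. \<mu> x r c = 0}"
    have "x = (\<Oplus>\<^bsub>M\<^esub>s\<in>S. scalar_elem n (\<mu> x (fst s) (snd s)) \<odot>\<^bsub>M\<^esub> vec s)"
      using x by (intro mu_eqI) (auto simp: combination[OF assms])
    then show "x \<in> k_span (scalar_elem n) M S vec"
      unfolding k_span_def by (intro CollectI exI[of _ "\<lambda>s. \<mu> x (fst s) (snd s)"] conjI TrueI)
  qed
qed

lemma is_k_basis_vec: "is_k_basis (scalar_elem n) M Y vec"
  unfolding is_k_basis_def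
proof (intro conjI ballI)
  fix x assume x: "x \<in> carrier M"
  show "\<exists>!c. c \<in> Y \<rightarrow>\<^sub>E UNIV \<and> x = (\<Oplus>\<^bsub>M\<^esub>s\<in>Y. scalar_elem n (c s) \<odot>\<^bsub>M\<^esub> vec s)"
  proof (rule ex1I[of _ "\<lambda>s\<in>Y. \<mu> x (fst s) (snd s)"])
    show "(\<lambda>s\<in>Y. \<mu> x (fst s) (snd s)) \<in> Y \<rightarrow>\<^sub>E UNIV \<and>
        x = (\<Oplus>\<^bsub>M\<^esub>s\<in>Y. scalar_elem n ((\<lambda>s\<in>Y. \<mu> x (fst s) (snd s)) s) \<odot>\<^bsub>M\<^esub> vec s)"
      using x by (intro conjI mu_eqI combination(1)[OF order_refl])
                 (auto simp: combination(2)[OF order_refl])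
    fix c assume "c \<in> Y \<rightarrow>\<^sub>E UNIV \<and> x = (\<Oplus>\<^bsub>M\<^esub>s\<in>Y. scalar_elem n (c s) \<odot>\<^bsub>M\<^esub> vec s)"
    then show "c = (\<lambda>s\<in>Y. \<mu> x (fst s) (snd s))"
      using combination(2)[OF order_refl, of c]
      by (auto intro!: extensionalityI[where A = Y] simp: PiE_def)
  qed
qed (auto simp: finite_Y vec)

lemma represented_by_array_vec: "represented_by_array n l Y M vec"
  unfolding represented_by_array_def Let_def
proof (intro conjI allI impI is_k_basis_vec)
  fix r c assume rc: "(r, c) \<in> Y"
  note b = in_box[OF rc]
  have 0: "(l + r - c, 0, 0) \<in> box n" using b by (auto simp: box_def)
  show "idem n (l + r - c) \<odot>\<^bsub>M\<^esub> vec (r, c) = vec (r, c)"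
    using array_vec_smult_vec[OF rc 0] rc by (simp add: idem_array_vec)
  show "arrow_elem n (ArrX (l + r - c)) \<odot>\<^bsub>M\<^esub> vec (r, c) = (if (r + 1, c) \<in> Y then vec (r + 1, c) else \<zero>\<^bsub>M\<^esub>)"
    if "l + r - c < n"
  proof -
    have "(l + r - c, 1, 0) \<in> box n" using that b by (auto simp: box_def)
    from array_vec_smult_vec[OF rc this] show ?thesis by (simp add: arrow_x_array_vec)
  qed
  show "arrow_elem n (ArrY (l + r - c)) \<odot>\<^bsub>M\<^esub> vec (r, c) = (if (r, c + 1) \<in> Y then vec (r, c + 1) else \<zero>\<^bsub>M\<^esub>)"
    if "1 < l + r - c"
  proof -
    have "(l + r - c, 0, 1) \<in> box n" using that b by (auto simp: box_def)
    from array_vec_smult_vec[OF rc this] show ?thesis by (simp add: arrow_y_array_vec)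
  qed
qed

end


section \<open>The ideals of words\<close>

text \<open>A multiple of a monomial that is defined for all triples and is zero outside of the box,
  so that products need no separate treatment at the border.\<close>

definition basis_elem :: "nat \<Rightarrow> 'k::field \<Rightarrow> nat \<Rightarrow> nat \<Rightarrow> nat \<Rightarrow> 'k preproj_elem" where
  "basis_elem n k s a b = of_coord n (\<lambda>s' a' b'. if (s', a', b') = (s, a, b) then k else 0)"

lemma basis_elem_carrier: "basis_elem n k s a b \<in> carrier (preproj n)"
  by (simp add: basis_elem_def of_coord_carrier)

lemma coord_basis_elem:
  "coord n (basis_elem n k s a b) s' a' b' = (if (s', a', b') = (s, a, b) \<and> (s, a, b) \<in> box n then k else 0)"
  by (auto simp: basis_elem_def coord_of_coord)

text \<open>The counts add up when the vertices fit; if the sum leaves the box, the right side is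
  zero on its own.\<close>

lemma basis_elem_mult:
  assumes "(s, a, b) \<in> box n"
  shows "basis_elem n k v a' b' \<otimes>\<^bsub>preproj n\<^esub> basis_elem n k' s a b =
    (if v = s + a - b \<and> (v, a', b') \<in> box n then basis_elem n (k * k') s (a + a') (b + b') else \<zero>\<^bsub>preproj n\<^esub>)"
proof (rule preproj_eqI)
  interpret ring "preproj n :: 'a preproj_elem ring" by (rule ring_preproj)
  show "basis_elem n k v a' b' \<otimes>\<^bsub>preproj n\<^esub> basis_elem n k' s a b \<in> carrier (preproj n)"
    by (simp add: basis_elem_carrier)
  show "(if v = s + a - b \<and> (v, a', b') \<in> box n then basis_elem n (k * k') s (a + a') (b + b') else \<zero>\<^bsub>preproj n\<^esub>)
      \<in> carrier (preproj n)"
    by (simp add: basis_elem_carrier)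
  fix t p q assume tpq: "(t, p, q) \<in> box n"
  let ?g = "coord n (basis_elem n k' s a b) t"
  have F: "coord n (basis_elem n k v a' b') (t + p' - q') (p - p') (q - q') =
      (if (t + p' - q' = v \<and> (v, a', b') \<in> box n) \<and> p - p' = a' \<and> q - q' = b' then k else 0)" for p' q'
    by (auto simp: coord_basis_elem)
  have "coord n (basis_elem n k v a' b' \<otimes>\<^bsub>preproj n\<^esub> basis_elem n k' s a b) t p q =
      (if a' \<le> p \<and> b' \<le> q \<and> (t + (p - a') - (q - b') = v \<and> (v, a', b') \<in> box n) then k * ?g (p - a') (q - b') else 0)"
    unfolding coord_mult[OF basis_elem_carrier basis_elem_carrier tpq] F double_sum_delta ..
  also have "\<dots> = coord n (if v = s + a - b \<and> (v, a', b') \<in> box n then basis_elem n (k * k') s (a + a') (b + b')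
      else \<zero>\<^bsub>preproj n\<^esub>) t p q"
    using assms tpq by (auto simp: coord_basis_elem coord_zero)
  finally show "coord n (basis_elem n k v a' b' \<otimes>\<^bsub>preproj n\<^esub> basis_elem n k' s a b) t p q = \<dots>" .
qed

lemma array_vec_basis_elem: "(s, a, b) \<in> box n \<Longrightarrow> array_vec n s (a, b) = basis_elem n 1 s a b"
  by (rule preproj_eqI[of _ n]) (auto simp: array_vec_carrier basis_elem_carrier coord_array_vec coord_basis_elem)

lemma preproj_support_induct:
  fixes x :: "'k::field preproj_elem"
  assumes "x \<in> carrier (preproj n)" and "\<And>s a b. (s, a, b) \<notin> S \<Longrightarrow> coord n x s a b = 0"
    and P_zero: "P \<zero>\<^bsub>preproj n\<^esub>"
    and P_add: "\<And>y z. y \<in> carrier (preproj n) \<Longrightarrow> z \<in> carrier (preproj n) \<Longrightarrow> P y \<Longrightarrow> P z \<Longrightarrow> P (y \<oplus>\<^bsub>preproj n\<^esub> z)"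
    and P_basis: "\<And>k s a b. (s, a, b) \<in> S \<Longrightarrow> (s, a, b) \<in> box n \<Longrightarrow> P (basis_elem n k s a b)"
  shows "P x"
proof -
  interpret ring "preproj n :: 'k preproj_elem ring" by (rule ring_preproj)
  have "finite A \<Longrightarrow> A \<subseteq> S \<inter> box n \<Longrightarrow> x \<in> carrier (preproj n) \<Longrightarrow>
      (\<And>s a b. (s, a, b) \<notin> A \<Longrightarrow> coord n x s a b = 0) \<Longrightarrow> P x" for A x
  proof (induction A arbitrary: x rule: finite_induct)
    case empty
    then have "x = \<zero>\<^bsub>preproj n\<^esub>" by (intro preproj_eqI) (auto simp: coord_zero)
    then show ?case using P_zero by simp
  next
    case (insert t A)
    obtain s a b where t: "t = (s, a, b)" by (cases t)
    have sab: "(s, a, b) \<in> S" "(s, a, b) \<in> box n" using insert.prems(1) t by auto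
    define y where "y = of_coord n (\<lambda>s' a' b'. if (s', a', b') = t then 0 else coord n x s' a' b')"
    have yc: "y \<in> carrier (preproj n)" by (simp add: y_def of_coord_carrier)
    have "coord n y s' a' b' = 0" if "(s', a', b') \<notin> A" for s' a' b'
      using that insert.prems(3)[of s' a' b'] by (auto simp: y_def coord_of_coord)
    then have "P y" using insert yc by blast
    then have "P (basis_elem n (coord n x s a b) s a b \<oplus>\<^bsub>preproj n\<^esub> y)"
      by (intro P_add P_basis sab yc basis_elem_carrier)
    moreover have "basis_elem n (coord n x s a b) s a b \<oplus>\<^bsub>preproj n\<^esub> y = x"
      using insert.prems(2) yc sab
      by (intro preproj_eqI) (auto simp: basis_elem_carrier coord_add coord_basis_elem t y_def coord_of_coord)
    ultimately show ?case by simp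
  qed
  from this[of "S \<inter> box n" x] show ?thesis
    using assms(1,2) finite_box coord_outside by blast
qed

lemma coord_minus:
  assumes "x \<in> carrier (preproj n)" "y \<in> carrier (preproj n)"
  shows "coord n (x \<ominus>\<^bsub>preproj n\<^esub> y) s a b = coord n x s a b - coord n y s a b"
proof -
  interpret ring "preproj n :: 'a preproj_elem ring" by (rule ring_preproj)
  have "(x \<ominus>\<^bsub>preproj n\<^esub> y) \<oplus>\<^bsub>preproj n\<^esub> y = x" using assms by (simp add: a_minus_def a_assoc l_neg)
  then show ?thesis using coord_add[of "x \<ominus>\<^bsub>preproj n\<^esub> y" n y s a b] assms by simp
qed

text \<open>The coefficient at \<open>e_i\<close> is multiplicative, so its kernel is an ideal, and
  it contains \<open>1 - e_i\<close>. Conversely \<open>1 - e_i\<close> fixes, from one side, every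
  monomial that does not both start and end at \<open>i\<close>; a loop of positive length at
  \<open>i\<close> is obtained from one of those.\<close>

lemma vertex_ideal_eq:
  assumes "1 \<le> i" "i \<le> n"
  shows "vertex_ideal n i = {x \<in> carrier (preproj n :: 'k::field preproj_elem ring). coord n x i 0 0 = 0}"
    (is "_ = ?K")
proof
  let ?A = "preproj n :: 'k preproj_elem ring"
  interpret ring ?A by (rule ring_preproj)
  have i: "(i, 0, 0) \<in> box n" using assms by (simp add: box_def)
  define f :: "'k preproj_elem" where "f = \<one>\<^bsub>?A\<^esub> \<ominus>\<^bsub>?A\<^esub> basis_elem n 1 i 0 0"
  have fc: "f \<in> carrier ?A" by (simp add: f_def basis_elem_carrier)
  have v: "vertex_ideal n i = Idl\<^bsub>?A\<^esub> {f}"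
    by (simp add: vertex_ideal_def f_def idem_array_vec array_vec_basis_elem[OF i])
  have mult: "coord n (x \<otimes>\<^bsub>?A\<^esub> y) i 0 0 = coord n x i 0 0 * coord n y i 0 0"
    if "x \<in> carrier ?A" "y \<in> carrier ?A" for x y
    using coord_mult[OF that i] by simp
  have "ideal ?K ?A"
  proof (rule idealI[OF ring_preproj])
    show "subgroup ?K (add_monoid ?A)"
    proof (rule add.subgroupI)
      show "?K \<noteq> {}" using zero_closed coord_zero by blast
      show "\<ominus>\<^bsub>?A\<^esub> x \<in> ?K" if "x \<in> ?K" for x
        using that coord_minus[of "\<zero>\<^bsub>?A\<^esub>" n x i 0 0] by (simp add: a_minus_def coord_zero)
    qed (auto simp: coord_add)
  qed (auto simp: mult)
  moreover have "f \<in> ?K" using i assms fc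
    by (simp add: f_def coord_minus basis_elem_carrier coord_one coord_basis_elem)
  ultimately show "vertex_ideal n i \<subseteq> ?K"
    unfolding v by (intro genideal_minimal) auto
  have K: "ideal (Idl\<^bsub>?A\<^esub> {f}) ?A" using fc by (intro genideal_ideal) auto
  interpret K: ideal "Idl\<^bsub>?A\<^esub> {f}" ?A by (rule K)
  have fK: "f \<in> Idl\<^bsub>?A\<^esub> {f}" using fc by (rule genideal_self')
  show "?K \<subseteq> vertex_ideal n i"
  proof
    fix x assume x: "x \<in> ?K"
    show "x \<in> vertex_ideal n i" unfolding v
    proof (rule preproj_support_induct[where n = n and S = "- {(i, 0, 0)}" and P = "\<lambda>x. x \<in> Idl\<^bsub>?A\<^esub> {f}"])
      show "x \<in> carrier ?A" using x by simp
      show "coord n x s a b = 0" if "(s, a, b) \<notin> - {(i, 0, 0)}" for s a b using that x by simp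
      fix k :: 'k and s a b
      assume sab: "(s, a, b) \<in> - {(i, 0, 0)}" "(s, a, b) \<in> box n"
      have right: "basis_elem n k s a b \<in> Idl\<^bsub>?A\<^esub> {f}" if "s \<noteq> i" "(s, a, b) \<in> box n" for k :: 'k and s a b
      proof -
        have "basis_elem n k s a b \<otimes>\<^bsub>?A\<^esub> f = basis_elem n k s a b \<ominus>\<^bsub>?A\<^esub> \<zero>\<^bsub>?A\<^esub>"
          using that i basis_elem_mult[OF i, of k s a b 1]
          by (simp add: f_def a_minus_def r_distr basis_elem_carrier r_minus)
        then show ?thesis using K.I_l_closed[OF fK, of "basis_elem n k s a b"]
          by (simp add: basis_elem_carrier a_minus_def)
      qed
      have left: "basis_elem n k s a b \<in> Idl\<^bsub>?A\<^esub> {f}" if "s + a - b \<noteq> i" "(s, a, b) \<in> box n" for k :: 'k and s a b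
      proof -
        have "f \<otimes>\<^bsub>?A\<^esub> basis_elem n k s a b = basis_elem n k s a b \<ominus>\<^bsub>?A\<^esub> \<zero>\<^bsub>?A\<^esub>"
          using that i basis_elem_mult[OF that(2), of 1 i 0 0 k]
          by (simp add: f_def a_minus_def l_distr basis_elem_carrier l_minus)
        then show ?thesis using K.I_r_closed[OF fK, of "basis_elem n k s a b"]
          by (simp add: basis_elem_carrier a_minus_def)
      qed
      show "basis_elem n k s a b \<in> Idl\<^bsub>?A\<^esub> {f}"
      proof (cases "s \<noteq> i \<or> s + a - b \<noteq> i")
        case True
        then show ?thesis using left right sab(2) by blast
      next
        case False
        then have s: "s = i" "a = b" "a \<ge> 1" using sab by (auto simp: box_def)
        \<comment> \<open>The loop with counts \<open>(a, a)\<close> starts with the arrow x at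
          \<open>i\<close>. That arrow ends at \<open>i + 1\<close> and hence is in the ideal
          already.\<close>
        have b1: "(i, 1, 0) \<in> box n" and b2: "(i + 1, a - 1, a) \<in> box n"
          using sab(2) s by (auto simp: box_def)
        have "basis_elem n k (i + 1) (a - 1) a \<otimes>\<^bsub>?A\<^esub> basis_elem n 1 i 1 0 = basis_elem n k i a a"
          using basis_elem_mult[OF b1, of k "i + 1" "a - 1" a 1] b2 s by simp
        moreover have "basis_elem n 1 i 1 0 \<in> Idl\<^bsub>?A\<^esub> {f}" by (rule left[OF _ b1]) simp
        ultimately show ?thesis using s K.I_l_closed basis_elem_carrier by metis
      qed
    qed (auto simp: K.a_closed)
  qed
qed

text \<open>A span of monomials, recorded through its complement: \<open>Y l\<close> holds the
  positions of P_l that survive modulo this set.\<close>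

definition vanishing :: "nat \<Rightarrow> (nat \<Rightarrow> (nat \<times> nat) set) \<Rightarrow> 'k::field preproj_elem set" where
  "vanishing n Y = {x \<in> carrier (preproj n). \<forall>l r c. (l, r, c) \<in> box n \<longrightarrow> (r, c) \<in> Y l \<longrightarrow> coord n x l r c = 0}"

lemma basis_elem_vanishing: "(r, c) \<notin> Y l \<Longrightarrow> basis_elem n k l r c \<in> vanishing n Y"
  by (auto simp: vanishing_def basis_elem_carrier coord_basis_elem)

text \<open>Multiplication by \<open>I\<^sub>i\<close> adds the addable boxes at vertex \<open>i\<close>.\<close>

lemma vertex_ideal_prod:
  assumes i: "1 \<le> i" "i \<le> n"
    and down: "\<And>l r c r' c'. (l, r, c) \<in> box n \<Longrightarrow> (r, c) \<in> Y l \<Longrightarrow> r' \<le> r \<Longrightarrow> c' \<le> c \<Longrightarrow> (r', c') \<in> Y l"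
    and Y': "\<And>l r c. (l, r, c) \<in> box n \<Longrightarrow> (r, c) \<in> Y' l \<longleftrightarrow> (r, c) \<in> Y l \<or>
      (l + r - c = i \<and> (r = 0 \<or> (r - 1, c) \<in> Y l) \<and> (c = 0 \<or> (r, c - 1) \<in> Y l))"
  shows "ideal_prod (preproj n) (vertex_ideal n i) (vanishing n Y) = (vanishing n Y' :: 'k::field preproj_elem set)"
    (is "?L = ?R")
proof
  let ?A = "preproj n :: 'k preproj_elem ring"
  interpret ring ?A by (rule ring_preproj)
  note I = vertex_ideal_eq[OF i, where ?'k='k]
  show "?L \<subseteq> ?R"
  proof
    fix z assume "z \<in> ?L"
    then show "z \<in> ?R"
    proof induction
      case (prod x y)
      then have x: "x \<in> carrier ?A" "coord n x i 0 0 = 0" and y: "y \<in> carrier ?A"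
        and y0: "\<And>l r c. (l, r, c) \<in> box n \<Longrightarrow> (r, c) \<in> Y l \<Longrightarrow> coord n y l r c = 0"
        by (auto simp: I vanishing_def)
      have "coord n (x \<otimes>\<^bsub>?A\<^esub> y) l r c = 0" if b: "(l, r, c) \<in> box n" and rc: "(r, c) \<in> Y' l" for l r c
      proof -
        have "coord n x (l + r' - c') (r - r') (c - c') * coord n y l r' c' = 0" if le: "r' \<le> r" "c' \<le> c" for r' c'
        proof -
          have b': "(l, r', c') \<in> box n" using b le by (auto simp: box_def)
          \<comment> \<open>Each term of the convolution is zero. If \<open>(r', c')\<close> is
            \<open>(r, c)\<close> itself and the box is new, the factor from \<open>x\<close> is its
            coefficient at \<open>e_i\<close>; in all other cases \<open>(r', c')\<close> is in
            \<open>Y l\<close>, where \<open>y\<close> vanishes.\<close>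
          consider "(r, c) \<in> Y l" | "r' = r" "c' = c" "l + r - c = i"
            | "r' < r" "(r - 1, c) \<in> Y l" | "c' < c" "(r, c - 1) \<in> Y l"
            using rc le unfolding Y'[OF b] by (cases "r' = r"; cases "c' = c") auto
          then show ?thesis
          proof cases
            case 1
            then show ?thesis using down[OF b _ le] y0[OF b'] by simp
          next
            case 2
            then show ?thesis using x by simp
          next
            case 3
            have "(l, r - 1, c) \<in> box n" using b by (auto simp: box_def)
            from down[OF this 3(2), of r' c'] show ?thesis using y0[OF b'] le 3 by simp
          next
            case 4
            have "(l, r, c - 1) \<in> box n" using b by (auto simp: box_def)
            from down[OF this 4(2), of r' c'] show ?thesis using y0[OF b'] le 4 by simp
          qed
        qed
        then show ?thesis unfolding coord_mult[OF x(1) y b] by (intro sum.neutral ballI) simp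
      qed
      then show ?case using x y by (simp add: vanishing_def)
    next
      case (sum s1 s2)
      then show ?case by (simp add: vanishing_def coord_add)
    qed
  qed
  show "?R \<subseteq> ?L"
  proof
    fix x assume x: "x \<in> ?R"
    show "x \<in> ?L"
    proof (rule preproj_support_induct[where n = n and S = "{(l, r, c) \<in> box n. (r, c) \<notin> Y' l}" and P = "\<lambda>x. x \<in> ?L"])
      show "x \<in> carrier ?A" using x by (simp add: vanishing_def)
      show "coord n x s a b = 0" if "(s, a, b) \<notin> {(l, r, c) \<in> box n. (r, c) \<notin> Y' l}" for s a b
        using that x coord_outside[of s a b n x] by (auto simp: vanishing_def)
      have "\<zero>\<^bsub>?A\<^esub> \<otimes>\<^bsub>?A\<^esub> \<zero>\<^bsub>?A\<^esub> \<in> ?L"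
        by (rule ideal_prod.prod) (auto simp: I vanishing_def coord_zero)
      then show "\<zero>\<^bsub>?A\<^esub> \<in> ?L" by simp
      show "y \<oplus>\<^bsub>?A\<^esub> z \<in> ?L" if "y \<in> ?L" "z \<in> ?L" for y z using that by (rule ideal_prod.sum)
      fix k :: 'k and l r c
      assume "(l, r, c) \<in> {(l, r, c) \<in> box n. (r, c) \<notin> Y' l}"
      then have b: "(l, r, c) \<in> box n" and rc: "(r, c) \<notin> Y' l" by auto
      have prod: "basis_elem n 1 v a' b' \<otimes>\<^bsub>?A\<^esub> basis_elem n k l r' c' \<in> ?L"
        if "(r', c') \<notin> Y l" "(v, a', b') \<noteq> (i, 0, 0)" for v a' b' r' c'
        by (rule ideal_prod.prod)
           (use that in \<open>auto simp: I basis_elem_carrier coord_basis_elem basis_elem_vanishing\<close>)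
      \<comment> \<open>A position stays outside of the array for one of these reasons. The monomial
        is then a product of an element of \<open>I_i\<close> with a monomial outside of
        \<open>Y l\<close>: an idempotent at another vertex, or the arrow from the missing
        predecessor.\<close>
      consider "l + r - c \<noteq> i" "(r, c) \<notin> Y l" | "l + r - c = i" "r > 0" "(r - 1, c) \<notin> Y l"
        | "l + r - c = i" "c > 0" "(r, c - 1) \<notin> Y l"
        using rc unfolding Y'[OF b] by auto
      then show "basis_elem n k l r c \<in> ?L"
      proof cases
        case 1
        have b0: "(l + r - c, 0, 0) \<in> box n" using b by (auto simp: box_def)
        then show ?thesis
          using basis_elem_mult[OF b, of 1 "l + r - c" 0 0 k] prod[of r c "l + r - c" 0 0] 1 by simp
      next
        case 2
        have b': "(l, r - 1, c) \<in> box n" "(i - 1, 1, 0) \<in> box n" "i - 1 = l + (r - 1) - c"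
          using b 2 by (auto simp: box_def)
        have "basis_elem n 1 (i - 1) 1 0 \<otimes>\<^bsub>?A\<^esub> basis_elem n k l (r - 1) c = basis_elem n k l r c"
          unfolding basis_elem_mult[OF b'(1)] using b' 2 by simp
        then show ?thesis using prod[of "r - 1" c "i - 1" 1 0] 2 by simp
      next
        case 3
        have b': "(l, r, c - 1) \<in> box n" "(i + 1, 0, 1) \<in> box n" "i + 1 = l + r - (c - 1)"
          using b 3 by (auto simp: box_def)
        have "basis_elem n 1 (i + 1) 0 1 \<otimes>\<^bsub>?A\<^esub> basis_elem n k l r (c - 1) = basis_elem n k l r c"
          unfolding basis_elem_mult[OF b'(1)] using b' 3 by simp
        then show ?thesis using prod[of r "c - 1" "i + 1" 0 1] 3 by simp
      qed
    qed
  qed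
qed

subsection \<open>The arrays of words\<close>

text \<open>A subset \<open>S\<close> of \<open>{1..n + 1}\<close> with \<open>n + 1 - l\<close> elements encodes the boundary path of a subarray
  of the array of \<open>P\<^sub>l\<close>; on such sets, \<open>s\<^sub>i\<close> acts by a 0-Hecke operator.\<close>

definition boundary_array :: "nat \<Rightarrow> nat set \<Rightarrow> (nat \<times> nat) set" where
  "boundary_array l S = {(r, c). r < card (S \<inter> {..l + r - c})}"

text \<open>The reflection is applied only when it lowers the element \<open>i + 1\<close> to
  \<open>i\<close>; in all other cases nothing happens, which makes the operator idempotent.\<close>

definition hecke_swap :: "nat \<Rightarrow> nat set \<Rightarrow> nat set" where
  "hecke_swap i S = (if i + 1 \<in> S \<and> i \<notin> S then insert i (S - {i + 1}) else S)"

lemma card_Int_Suc: "card (S \<inter> {..Suc v}) = card (S \<inter> {..v}) + (if Suc v \<in> S then 1 else 0)"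
proof (cases "Suc v \<in> S")
  case True
  then have "S \<inter> {..Suc v} = insert (Suc v) (S \<inter> {..v})" by (auto simp: atMost_Suc)
  then show ?thesis using True by (simp add: card_insert_if)
next
  case False
  then have "S \<inter> {..Suc v} = S \<inter> {..v}" by (auto simp: atMost_Suc)
  then show ?thesis using False by simp
qed

text \<open>One row up, the vertex drops by one and the count by at most one, so
  \<open>r < card\<close> is preserved; one column to the left, the count can only grow. The
  condition \<open>c < l\<close> keeps the subtraction honest.\<close>

lemma boundary_array_down:
  assumes "(r, c) \<in> boundary_array l S" "r' \<le> r" "c' \<le> c" "c < l"
  shows "(r', c') \<in> boundary_array l S"
proof -
  have 1: "(r - k, c) \<in> boundary_array l S" if "k \<le> r" for k
    using that
  proof (induction k)
    case (Suc k)
    have "l + (r - k) - c = Suc (l + (r - Suc k) - c)" using Suc.prems assms(4) by auto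
    then show ?case using Suc card_Int_Suc[of S "l + (r - Suc k) - c"]
      by (auto simp: boundary_array_def split: if_splits)
  qed (use assms in simp)
  have "(r', c) \<in> boundary_array l S" using 1[of "r - r'"] assms(2) by simp
  moreover have "card (S \<inter> {..l + r' - c}) \<le> card (S \<inter> {..l + r' - c'})"
    using assms(3) by (intro card_mono) auto
  ultimately show ?thesis by (auto simp: boundary_array_def)
qed

lemma card_hecke_swap:
  assumes "finite S"
  shows "card (hecke_swap i S) = card S"
  using assms card.remove[of S "i + 1"] by (auto simp: hecke_swap_def card_insert_if)

lemma card_hecke_swap_Int:
  assumes "i + 1 \<in> S" "i \<notin> S"
  shows "card (hecke_swap i S \<inter> {..v}) = card (S \<inter> {..v}) + (if v = i then 1 else 0)"
proof -
  consider "v < i" | "v = i" | "v > i" by linarith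
  then show ?thesis
  proof cases
    case 1
    then have "hecke_swap i S \<inter> {..v} = S \<inter> {..v}" using assms by (auto simp: hecke_swap_def)
    then show ?thesis using 1 by simp
  next
    case 2
    then have "hecke_swap i S \<inter> {..v} = insert i (S \<inter> {..v})" using assms by (auto simp: hecke_swap_def)
    then show ?thesis using 2 assms by (simp add: card_insert_if)
  next
    case 3
    then have "hecke_swap i S \<inter> {..v} = insert i ((S \<inter> {..v}) - {i + 1})" "i + 1 \<in> S \<inter> {..v}"
      using assms by (auto simp: hecke_swap_def)
    then show ?thesis using 3 assms card.remove[of "S \<inter> {..v}" "i + 1"] by (simp add: card_insert_if)
  qed
qed

text \<open>With \<open>N v\<close> the number of elements up to \<open>v\<close>, a box at vertex
  \<open>i\<close> is present iff \<open>r < N i\<close>, its upper neighbour iff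
  \<open>r - 1 < N (i - 1)\<close>, its left neighbour iff \<open>r < N (i + 1)\<close>. If the box
  is missing and both neighbours are present, then \<open>N\<close> is constant from
  \<open>i - 1\<close> to \<open>i\<close> and grows from \<open>i\<close> to \<open>i + 1\<close>:
  just the case in which the swap acts.\<close>

lemma boundary_array_hecke_swap:
  assumes S: "S \<subseteq> {1..n + 1}" "card S = n + 1 - l" and b: "(l, r, c) \<in> box n" and i: "1 \<le> i" "i \<le> n"
  shows "(r, c) \<in> boundary_array l (hecke_swap i S) \<longleftrightarrow> (r, c) \<in> boundary_array l S \<or>
    (l + r - c = i \<and> (r = 0 \<or> (r - 1, c) \<in> boundary_array l S) \<and> (c = 0 \<or> (r, c - 1) \<in> boundary_array l S))"
proof (cases "l + r - c = i")
  case False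
  then show ?thesis
  proof (cases "i + 1 \<in> S \<and> i \<notin> S")
    case True
    then show ?thesis using card_hecke_swap_Int[of i S] False by (simp add: boundary_array_def)
  qed (auto simp: hecke_swap_def)
next
  case True
  define N where "N = (\<lambda>v. card (S \<inter> {..v}))"
  have NS: "N (Suc v) = N v + (if Suc v \<in> S then 1 else 0)" for v
    unfolding N_def by (rule card_Int_Suc)
  have Ni: "N i = N (i - 1) + (if i \<in> S then 1 else 0)" "N (i + 1) = N i + (if i + 1 \<in> S then 1 else 0)"
    using NS[of "i - 1"] NS[of i] i by auto
  have finS: "finite S" using S(1) finite_subset by blast
  have bounds: "1 \<le> l" "l + r \<le> n" "c < l" using b by (auto simp: box_def)
  have e1: "l + (r - 1) - c = i - 1" if "r > 0" using True that bounds by auto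
  have e2: "l + r - (c - 1) = i + 1" if "c > 0" using True that bounds by auto
  \<comment> \<open>In column 0 there is no left neighbour to test. Here the size of
    \<open>S\<close> replaces it: without \<open>i + 1\<close>, at most
    \<open>r + (n - i) = n - l\<close> elements would be available.\<close>
  have c0: "i + 1 \<in> S" if "c = 0" "N i \<le> r"
  proof (rule ccontr)
    assume "i + 1 \<notin> S"
    have "S \<subseteq> (S \<inter> {..i}) \<union> {i + 2..n + 1}"
    proof
      fix x assume x: "x \<in> S"
      then have "x \<noteq> i + 1" "x \<le> n + 1" using S(1) \<open>i + 1 \<notin> S\<close> by auto
      then show "x \<in> (S \<inter> {..i}) \<union> {i + 2..n + 1}" using x by (cases "x \<le> i") auto
    qed
    then have "card S \<le> card ((S \<inter> {..i}) \<union> {i + 2..n + 1})" using finS by (intro card_mono) auto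
    also have "\<dots> \<le> N i + card {i + 2..n + 1}" unfolding N_def by (rule card_Un_le)
    also have "\<dots> \<le> r + (n - i)" using that by simp
    finally have "n + 1 - l \<le> r + (n - i)" unfolding S(2) .
    moreover have "i = l + r" using True that(1) by simp
    ultimately show False using bounds(2) by linarith
  qed
  have Y: "(r, c) \<in> boundary_array l S \<longleftrightarrow> r < N i"
    "r > 0 \<Longrightarrow> (r - 1, c) \<in> boundary_array l S \<longleftrightarrow> r - 1 < N (i - 1)"
    "c > 0 \<Longrightarrow> (r, c - 1) \<in> boundary_array l S \<longleftrightarrow> r < N (i + 1)"
    using True e1 e2 by (auto simp: boundary_array_def N_def)
  show ?thesis
  proof (cases "i + 1 \<in> S \<and> i \<notin> S")
    case sw: True
    have "(r, c) \<in> boundary_array l (hecke_swap i S) \<longleftrightarrow> r < N i + 1"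
      using card_hecke_swap_Int[of i S i] sw True by (simp add: boundary_array_def N_def)
    moreover have "r < N i + 1 \<longleftrightarrow> r < N i \<or> (r = 0 \<or> r - 1 < N (i - 1)) \<and> (c = 0 \<or> r < N (i + 1))"
      using Ni sw by auto
    ultimately show ?thesis using Y True by auto
  next
    case False
    then have "hecke_swap i S = S" by (auto simp: hecke_swap_def)
    moreover have "r < N i" if a: "r = 0 \<or> r - 1 < N (i - 1)" "c = 0 \<or> r < N (i + 1)"
    proof (rule ccontr)
      assume r: "\<not> r < N i"
      then have "i + 1 \<in> S" using a(2) c0 Ni(2) by (auto split: if_splits)
      moreover have "i \<notin> S"
      proof
        assume "i \<in> S"
        then have "N i = N (i - 1) + 1" using Ni(1) by simp
        then show False using a(1) r by linarith
      qed
      ultimately show False using False by simp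
    qed
    moreover have "r = 0 \<or> r - 1 < N (i - 1)" if "r = 0 \<or> (r - 1, c) \<in> boundary_array l S"
      using that Y(2) by blast
    moreover have "c = 0 \<or> r < N (i + 1)" if "c = 0 \<or> (r, c - 1) \<in> boundary_array l S"
      using that Y(3) by blast
    ultimately show ?thesis using Y(1) by metis
  qed
qed

text \<open>As in \<open>word_ideal\<close>, the last letter acts first. The start set belongs to
  the empty array.\<close>

definition word_set :: "nat \<Rightarrow> nat list \<Rightarrow> nat \<Rightarrow> nat set" where
  "word_set n is l = foldr hecke_swap is {l + 1..n + 1}"

lemma word_set_props:
  assumes "set is \<subseteq> {1..n}"
  shows "word_set n is l \<subseteq> {1..n + 1}" "card (word_set n is l) = n + 1 - l"
proof -
  have "word_set n is l \<subseteq> {1..n + 1} \<and> card (word_set n is l) = n + 1 - l"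
    using assms
  proof (induction "is")
    case (Cons i "is")
    then have "finite (word_set n is l)" using finite_subset by auto
    from card_hecke_swap[OF this, of i] Cons show ?case
      by (auto simp: word_set_def hecke_swap_def)
  qed (simp add: word_set_def)
  then show "word_set n is l \<subseteq> {1..n + 1}" "card (word_set n is l) = n + 1 - l" by auto
qed

lemma word_ideal_vanishing:
  assumes "set is \<subseteq> {1..n}"
  shows "word_ideal n is = (vanishing n (\<lambda>l. boundary_array l (word_set n is l)) :: 'k::field preproj_elem set)"
  using assms
proof (induction "is")
  case Nil
  \<comment> \<open>The empty word gives the whole of \<open>\<Pi>\<close>, so its arrays have to be
    empty: at most \<open>r - c\<close> elements of the start set are counted.\<close>
  have "\<not> r < card ({l + 1..n + 1} \<inter> {..l + r - c})" if "(l, r, c) \<in> box n" for l r c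
  proof -
    have "card ({l + 1..n + 1} \<inter> {..l + r - c}) \<le> card {l + 1..l + r - c}" by (intro card_mono) auto
    then show ?thesis by simp
  qed
  then show ?case by (auto simp: word_ideal_def word_set_def vanishing_def boundary_array_def)
next
  case (Cons i "is")
  have i: "1 \<le> i" "i \<le> n" and "is": "set is \<subseteq> {1..n}" using Cons.prems by auto
  have "(word_ideal n (i # is) :: 'k preproj_elem set) = ideal_prod (preproj n) (vertex_ideal n i) (word_ideal n is)"
    by (simp add: word_ideal_def)
  also have "\<dots> = vanishing n (\<lambda>l. boundary_array l (word_set n (i # is) l))"
    unfolding Cons.IH[OF "is"]
  proof (rule vertex_ideal_prod[OF i])
    show "(r', c') \<in> boundary_array l (word_set n is l)"
      if "(l, r, c) \<in> box n" "(r, c) \<in> boundary_array l (word_set n is l)" "r' \<le> r" "c' \<le> c" for l r c r' c'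
      using boundary_array_down[OF that(2-4)] that(1) by (simp add: box_def)
    have Cons_set: "word_set n (i # is) l = hecke_swap i (word_set n is l)" for l
      by (simp add: word_set_def)
    show "(r, c) \<in> boundary_array l (word_set n (i # is) l) \<longleftrightarrow> (r, c) \<in> boundary_array l (word_set n is l) \<or>
      (l + r - c = i \<and> (r = 0 \<or> (r - 1, c) \<in> boundary_array l (word_set n is l)) \<and>
        (c = 0 \<or> (r, c - 1) \<in> boundary_array l (word_set n is l)))"
      if "(l, r, c) \<in> box n" for l r c
      unfolding Cons_set by (rule boundary_array_hecke_swap[OF word_set_props[OF "is"] that i])
  qed
  finally show ?case .
qed

subsection \<open>Reduced words\<close>

text \<open>It is applied to the inverse of \<open>w\<close>: a letter put in front of a word
  multiplies the inverse by a transposition from the right, which exchanges the values at two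
  neighbouring positions.\<close>

definition inversions :: "nat \<Rightarrow> (nat \<Rightarrow> nat) \<Rightarrow> (nat \<times> nat) set" where
  "inversions n p = {(a, b). 1 \<le> a \<and> a < b \<and> b \<le> n + 1 \<and> p b < p a}"

lemma finite_inversions: "finite (inversions n p)"
  by (rule finite_subset[of _ "{..n + 1} \<times> {..n + 1}"]) (auto simp: inversions_def)

lemma inversions_id: "inversions n id = {}" "inversions n (\<lambda>a. a) = {}"
  by (auto simp: inversions_def)

text \<open>The transposition preserves the order of every pair except \<open>(i, i + 1)\<close>. It
  therefore carries the old inversions bijectively to the new ones other than
  \<open>(i, i + 1)\<close>, which is added.\<close>

lemma card_inversions_ascent:
  assumes i: "1 \<le> i" "i \<le> n" and "p i < p (i + 1)"
  shows "card (inversions n (p \<circ> transpose i (i + 1))) = card (inversions n p) + 1"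
proof -
  let ?s = "transpose i (i + 1)"
  have mono: "?s a < ?s b" if "a < b" "(a, b) \<noteq> (i, i + 1)" for a b
    using that by (auto simp: transpose_def)
  have range: "1 \<le> ?s a \<and> ?s a \<le> n + 1 \<longleftrightarrow> 1 \<le> a \<and> a \<le> n + 1" for a
    using i by (auto simp: transpose_def)
  have "inversions n (p \<circ> ?s) = insert (i, i + 1) (map_prod ?s ?s ` inversions n p)" (is "?L = ?R")
  proof (intro equalityI subsetI)
    fix z assume z: "z \<in> ?L"
    obtain a b where ab: "z = (a, b)" by (cases z)
    show "z \<in> ?R"
    proof (cases "z = (i, i + 1)")
      case False
      then have "(?s a, ?s b) \<in> inversions n p"
        using z ab mono[of a b] range[of a] range[of b] by (auto simp: inversions_def)
      then have "map_prod ?s ?s (?s a, ?s b) \<in> map_prod ?s ?s ` inversions n p" by (rule imageI)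
      then show ?thesis by (simp add: ab)
    qed simp
  next
    fix z assume z: "z \<in> ?R"
    show "z \<in> ?L"
    proof (cases "z = (i, i + 1)")
      case True
      then show ?thesis using assms by (simp add: inversions_def)
    next
      case False
      then obtain a b where ab: "(a, b) \<in> inversions n p" "z = (?s a, ?s b)" using z by auto
      then have "(a, b) \<noteq> (i, i + 1)" using assms(3) by (auto simp: inversions_def)
      then show ?thesis using ab mono[of a b] range[of a] range[of b] by (auto simp: inversions_def)
    qed
  qed
  moreover have "(i, i + 1) \<notin> map_prod ?s ?s ` inversions n p"
  proof
    assume "(i, i + 1) \<in> map_prod ?s ?s ` inversions n p"
    then obtain a b where "(a, b) \<in> inversions n p" "?s a = i" "?s b = i + 1" by auto
    moreover from this have "a = i + 1" "b = i" by (metis transpose_apply_first transpose_apply_second transpose_involutory)+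
    ultimately show False by (simp add: inversions_def)
  qed
  moreover have "inj_on (map_prod ?s ?s) (inversions n p)"
    by (intro inj_onI) (auto dest: injD[OF inj_transpose])
  ultimately show ?thesis by (simp add: finite_inversions card_image)
qed

lemma word_perm_Cons: "word_perm (i # is) = transpose i (i + 1) \<circ> word_perm is"
  by (simp add: word_perm_def)

lemma word_perm_permutes: "set is \<subseteq> {1..n} \<Longrightarrow> word_perm is permutes {1..n + 1}"
proof (induction "is")
  case Nil
  then show ?case by (simp add: word_perm_def permutes_def)
next
  case (Cons i "is")
  then show ?case unfolding word_perm_Cons by (intro permutes_compose permutes_swap_id) auto
qed

lemma inv_transpose_comp:
  assumes "w permutes A"
  shows "inv_into UNIV (transpose i j \<circ> w) = inv_into UNIV w \<circ> transpose i j"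
  using assms by (simp add: o_inv_distrib permutes_bij bij_swap_iff)

lemma card_inversions_transpose:
  assumes i: "1 \<le> i" "i \<le> n" and w: "w permutes {1..n + 1}"
  shows "inv_into UNIV w i < inv_into UNIV w (i + 1) \<Longrightarrow>
      card (inversions n (inv_into UNIV (transpose i (i + 1) \<circ> w))) = card (inversions n (inv_into UNIV w)) + 1"
    and "\<not> inv_into UNIV w i < inv_into UNIV w (i + 1) \<Longrightarrow>
      card (inversions n (inv_into UNIV w)) = card (inversions n (inv_into UNIV (transpose i (i + 1) \<circ> w))) + 1"
proof -
  show "inv_into UNIV w i < inv_into UNIV w (i + 1) \<Longrightarrow>
      card (inversions n (inv_into UNIV (transpose i (i + 1) \<circ> w))) = card (inversions n (inv_into UNIV w)) + 1"
    unfolding inv_transpose_comp[OF w] by (rule card_inversions_ascent[OF i])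
  assume "\<not> inv_into UNIV w i < inv_into UNIV w (i + 1)"
  moreover have "inv_into UNIV w i \<noteq> inv_into UNIV w (i + 1)"
    using permutes_inj[OF permutes_inv[OF w]] by (metis injD n_not_Suc_n Suc_eq_plus1)
  ultimately have "(inv_into UNIV w \<circ> transpose i (i + 1)) i < (inv_into UNIV w \<circ> transpose i (i + 1)) (i + 1)" by simp
  moreover have "inv_into UNIV w \<circ> transpose i (i + 1) \<circ> transpose i (i + 1) = inv_into UNIV w"
    by (simp add: fun_eq_iff)
  ultimately show "card (inversions n (inv_into UNIV w)) = card (inversions n (inv_into UNIV (transpose i (i + 1) \<circ> w))) + 1"
    unfolding inv_transpose_comp[OF w] using card_inversions_ascent[OF i] by metis
qed

lemma card_inversions_word:
  assumes "set is \<subseteq> {1..n}"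
  shows "card (inversions n (inv_into UNIV (word_perm is))) \<le> length is"
  using assms
proof (induction "is")
  case Nil
  then show ?case by (simp add: word_perm_def inversions_id)
next
  case (Cons i "is")
  have i: "1 \<le> i" "i \<le> n" and "is": "set is \<subseteq> {1..n}" using Cons.prems by auto
  note * = card_inversions_transpose[OF i word_perm_permutes[OF "is"]] Cons.IH[OF "is"]
  show ?case unfolding word_perm_Cons
  proof (cases "inv_into UNIV (word_perm is) i < inv_into UNIV (word_perm is) (i + 1)")
    case True
    from *(1)[OF True] *(3)
    show "card (inversions n (inv_into UNIV (transpose i (i + 1) \<circ> word_perm is))) \<le> length (i # is)" by simp
  next
    case False
    from *(2)[OF False] *(3)
    show "card (inversions n (inv_into UNIV (transpose i (i + 1) \<circ> word_perm is))) \<le> length (i # is)" by simp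
  qed
qed

text \<open>Counting from the left end gives \<open>p a \<ge> a\<close>, counting from the right end
  gives \<open>p a \<le> a\<close>.\<close>

lemma strict_mono_permutes_id:
  fixes p :: "nat \<Rightarrow> nat"
  assumes "p permutes {1..n + 1}" "\<And>i. 1 \<le> i \<Longrightarrow> i \<le> n \<Longrightarrow> p i < p (i + 1)"
  shows "p = id"
proof
  fix a
  have "p 1 \<in> {1..n + 1}" "p (n + 1) \<in> {1..n + 1}"
    using permutes_in_image[OF assms(1), of 1] permutes_in_image[OF assms(1), of "n + 1"] by auto
  then have ends: "1 \<le> p 1" "p (n + 1) \<le> n + 1" by auto
  have low: "j \<le> n \<longrightarrow> 1 + j \<le> p (1 + j)" for j
  proof (induction j)
    case (Suc j)
    then show ?case using assms(2)[of "1 + j"] by auto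
  qed (use ends in auto)
  have up: "j \<le> n \<longrightarrow> p (n + 1 - j) \<le> n + 1 - j" for j
  proof (induction j)
    case (Suc j)
    show ?case
    proof
      assume j: "Suc j \<le> n"
      then have e: "n + 1 - j = n + 1 - Suc j + 1" "1 \<le> n + 1 - Suc j" "n + 1 - Suc j \<le> n" by auto
      have "p (n + 1 - Suc j + 1) \<le> n + 1 - Suc j + 1" using Suc j unfolding e(1) by simp
      then show "p (n + 1 - Suc j) \<le> n + 1 - Suc j" using assms(2)[OF e(2,3)] by linarith
    qed
  qed (use ends in auto)
  have "p a = a" if "a \<in> {1..n + 1}"
    using low[of "a - 1"] up[of "n + 1 - a"] that by auto
  then show "p a = id a" using permutes_not_in[OF assms(1)] by (cases "a \<in> {1..n + 1}") auto
qed

text \<open>A descent of the inverse of \<open>w\<close> at \<open>i\<close> allows the letter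
  \<open>i\<close> to be split off on the left, which removes one inversion; an inverse without
  descents is the identity.\<close>

lemma exists_word:
  assumes "w permutes {1..n + 1}"
  shows "\<exists>is. set is \<subseteq> {1..n} \<and> word_perm is = w \<and> length is = card (inversions n (inv_into UNIV w))"
  using assms
proof (induction "card (inversions n (inv_into UNIV w))" arbitrary: w)
  case 0
  have "inv_into UNIV w i < inv_into UNIV w (i + 1)" if "1 \<le> i" "i \<le> n" for i
    using card_inversions_transpose(2)[OF that 0(2)] 0(1) by linarith
  then have "inv_into UNIV w = id" using strict_mono_permutes_id[OF permutes_inv[OF 0(2)]] by blast
  then have "w = id" using 0(2) by (metis inv_id permutes_inv_inv)
  then show ?case using 0(1) by (intro exI[of _ "[]"]) (simp add: word_perm_def)
next
  case (Suc m)
  have "\<exists>i. 1 \<le> i \<and> i \<le> n \<and> \<not> inv_into UNIV w i < inv_into UNIV w (i + 1)"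
  proof (rule ccontr)
    assume "\<not> ?thesis"
    then have "inv_into UNIV w = id" using strict_mono_permutes_id[OF permutes_inv[OF Suc(3)]] by blast
    then show False using Suc(2) by (simp add: inversions_id)
  qed
  then obtain i where i: "1 \<le> i" "i \<le> n" "\<not> inv_into UNIV w i < inv_into UNIV w (i + 1)" by blast
  let ?v = "transpose i (i + 1) \<circ> w"
  have v: "?v permutes {1..n + 1}" using Suc(3) i by (intro permutes_compose permutes_swap_id) auto
  have m: "card (inversions n (inv_into UNIV w)) = card (inversions n (inv_into UNIV ?v)) + 1"
    using card_inversions_transpose(2)[OF i(1,2) Suc(3) i(3)] .
  then obtain "is" where "is": "set is \<subseteq> {1..n}" "word_perm is = ?v" "length is = card (inversions n (inv_into UNIV ?v))"
    using Suc(1)[of ?v] Suc(2) v by auto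
  have "word_perm (i # is) = w" unfolding word_perm_Cons "is" by (simp add: comp_assoc[symmetric])
  then show ?case using "is" i m by (intro exI[of _ "i # is"]) auto
qed

lemma coxeter_length_eq:
  assumes "w permutes {1..n + 1}"
  shows "coxeter_length n w = card (inversions n (inv_into UNIV w))"
  unfolding coxeter_length_def
proof (rule Least_equality)
  show "\<exists>is. set is \<subseteq> {1..n} \<and> length is = card (inversions n (inv_into UNIV w)) \<and> word_perm is = w"
    using exists_word[OF assms] by blast
qed (use card_inversions_word in blast)

lemma exists_reduced_word:
  "w permutes {1..n + 1} \<Longrightarrow> \<exists>is. reduced_word n is w"
  using exists_word[of w n] by (auto simp: reduced_word_def coxeter_length_eq)

text \<open>Reflection and 0-Hecke operator disagree only when the reflection would raise
  \<open>i\<close> to \<open>i + 1\<close>.\<close>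

lemma transpose_image_hecke_swap:
  assumes "\<not> (i \<in> S \<and> i + 1 \<notin> S)"
  shows "transpose i (i + 1) ` S = hecke_swap i S"
proof (cases "i \<in> S")
  case True
  then show ?thesis using assms by (simp add: hecke_swap_def transpose_image_eq)
next
  case False
  show ?thesis
  proof (cases "i + 1 \<in> S")
    case True
    have "transpose i (i + 1) ` S = transpose i (i + 1) ` insert (i + 1) (S - {i + 1})"
      using True by (simp add: insert_absorb)
    also have "\<dots> = insert i (S - {i + 1})"
      using False by (force simp: transpose_def)
    finally show ?thesis using True False by (simp add: hecke_swap_def)
  next
    case i1: False
    have "transpose i (i + 1) ` S = S" using False i1 by (force simp: transpose_def)
    then show ?thesis using i1 by (simp add: hecke_swap_def)
  qed
qed

text \<open>In a reduced word every letter \<open>i\<close> is added at an ascent: the inverse of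
  the remaining word sends \<open>i\<close> to an earlier place than \<open>i + 1\<close>. If the
  place of \<open>i\<close> is beyond \<open>l\<close>, so is that of \<open>i + 1\<close>, and the
  bad case of the previous lemma cannot occur.\<close>

lemma word_set_reduced:
  assumes "set is \<subseteq> {1..n}" "length is = card (inversions n (inv_into UNIV (word_perm is)))" "1 \<le> l"
  shows "word_set n is l = word_perm is ` {l + 1..n + 1}"
  using assms(1,2)
proof (induction "is")
  case Nil
  then show ?case by (simp add: word_set_def word_perm_def)
next
  case (Cons i "is")
  let ?w = "word_perm is"
  have i: "1 \<le> i" "i \<le> n" and "is": "set is \<subseteq> {1..n}" using Cons.prems by auto
  note w = word_perm_permutes[OF "is"]
  have len: "card (inversions n (inv_into UNIV ?w)) \<le> length is" using card_inversions_word[OF "is"] .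
  have len_Cons: "length is + 1 = card (inversions n (inv_into UNIV (transpose i (i + 1) \<circ> ?w)))"
    using Cons.prems(2) unfolding word_perm_Cons by (simp only: list.size(4))
  have asc: "inv_into UNIV ?w i < inv_into UNIV ?w (i + 1)"
  proof (rule ccontr)
    assume "\<not> ?thesis"
    from card_inversions_transpose(2)[OF i w this] show False
      using len_Cons len by linarith
  qed
  then have "length is = card (inversions n (inv_into UNIV ?w))"
    using card_inversions_transpose(1)[OF i w] len_Cons by linarith
  then have IH: "word_set n is l = ?w ` {l + 1..n + 1}" using Cons.IH "is" by blast
  have mem: "a \<in> ?w ` {l + 1..n + 1} \<longleftrightarrow> inv_into UNIV ?w a \<in> {l + 1..n + 1}" for a
    using permutes_inverses[OF w] by (metis image_iff)
  have "inv_into UNIV ?w (i + 1) \<in> {1..n + 1}" using permutes_in_image[OF permutes_inv[OF w], of "i + 1"] i by simp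
  then have "\<not> (i \<in> ?w ` {l + 1..n + 1} \<and> i + 1 \<notin> ?w ` {l + 1..n + 1})"
    unfolding mem using asc by auto
  from transpose_image_hecke_swap[OF this] show ?case
    using IH by (simp add: word_perm_Cons word_set_def image_comp)
qed

text \<open>The description mentions \<open>w\<close> only, so the choice of a reduced word inside
  \<open>perm_ideal\<close> is harmless. The ideal property is what the factor ring in
  \<open>J_module\<close> rests on.\<close>

lemma perm_ideal_vanishing:
  assumes w: "w permutes {1..n + 1}"
  shows "perm_ideal n w = (vanishing n (\<lambda>l. boundary_array l (w ` {l + 1..n + 1})) :: 'k::field preproj_elem set)"
    and "ideal (perm_ideal n w) (preproj n :: 'k::field preproj_elem ring)"
proof -
  define ws where "ws = (SOME is. reduced_word n is w)"
  have "reduced_word n ws w" unfolding ws_def using exists_reduced_word[OF w] by (rule someI_ex)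
  then have ws: "set ws \<subseteq> {1..n}" "word_perm ws = w" "length ws = card (inversions n (inv_into UNIV w))"
    using coxeter_length_eq[OF w] by (auto simp: reduced_word_def)
  have "word_set n ws l = w ` {l + 1..n + 1}" if "1 \<le> l" for l
    using word_set_reduced[OF ws(1) _ that] ws by simp
  then have "vanishing n (\<lambda>l. boundary_array l (word_set n ws l)) =
      (vanishing n (\<lambda>l. boundary_array l (w ` {l + 1..n + 1})) :: 'k preproj_elem set)"
    by (auto simp: vanishing_def box_def)
  then show "perm_ideal n w = (vanishing n (\<lambda>l. boundary_array l (w ` {l + 1..n + 1})) :: 'k preproj_elem set)"
    using word_ideal_vanishing[OF ws(1), where ?'k='k] by (simp add: perm_ideal_def ws_def)
  interpret ring "preproj n :: 'k preproj_elem ring" by (rule ring_preproj)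
  have "ideal (word_ideal n is) (preproj n :: 'k preproj_elem ring)" if "set is \<subseteq> {1..n}" for "is"
    using that
  proof (induction "is")
    case Nil
    then show ?case by (simp add: word_ideal_def oneideal)
  next
    case (Cons i "is")
    have "idem n i \<in> carrier (preproj n :: 'k preproj_elem ring)"
      using Cons.prems by (simp add: idem_array_vec array_vec_carrier box_def)
    then have "ideal (vertex_ideal n i) (preproj n :: 'k preproj_elem ring)"
      unfolding vertex_ideal_def by (intro genideal_ideal) auto
    then show ?case using Cons ideal_prod_is_ideal by (simp add: word_ideal_def)
  qed
  then show "ideal (perm_ideal n w) (preproj n :: 'k preproj_elem ring)"
    using ws(1) by (simp add: perm_ideal_def ws_def)
qed

text \<open>Since \<open>w\<close> increases on \<open>l + 1, ..., n + 1\<close>, the value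
  \<open>w (l + 1 + r)\<close> is preceded by exactly \<open>r\<close> smaller ones there. So more
  than \<open>r\<close> values are at most \<open>v\<close> iff this value is, which turns the count
  into the condition on the row.\<close>

lemma J_array_boundary:
  assumes w: "w permutes {1..n + 1}" and l: "of_type n w l"
  shows "(r, c) \<in> J_array n l w \<longleftrightarrow> (l, r, c) \<in> box n \<and> (r, c) \<in> boundary_array l (w ` {l + 1..n + 1})"
proof -
  have l1: "1 \<le> l" "l \<le> n" and mono: "strict_mono_on {l + 1..n + 1} w" using l by (auto simp: of_type_def)
  let ?v = "l + r - c"
  have "(r, c) \<in> J_array n l w \<longleftrightarrow> l + r \<le> n \<and> c < l \<and> w (l + 1 + r) \<le> ?v"
  proof
    assume "(r, c) \<in> J_array n l w"
    then obtain m where m: "m \<in> {l + 1..n + 1}" "c < l" "w m \<le> m - 1 - c" "r = m - 1 - l"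
      by (auto simp: J_array_def)
    then have "m = l + 1 + r" by auto
    then show "l + r \<le> n \<and> c < l \<and> w (l + 1 + r) \<le> ?v" using m by auto
  next
    assume "l + r \<le> n \<and> c < l \<and> w (l + 1 + r) \<le> ?v"
    then show "(r, c) \<in> J_array n l w"
      unfolding J_array_def by (intro CollectI exI[of _ "l + 1 + r"] exI[of _ c]) auto
  qed
  moreover have "w (l + 1 + r) \<le> ?v \<longleftrightarrow> (r, c) \<in> boundary_array l (w ` {l + 1..n + 1})" if r: "l + r \<le> n"
  proof -
    define A where "A = {m \<in> {l + 1..n + 1}. w m \<le> ?v}"
    have "w ` {l + 1..n + 1} \<inter> {..?v} = w ` A" by (auto simp: A_def)
    moreover have "inj_on w A" using permutes_inj[OF w] inj_on_subset by blast
    ultimately have card: "card (w ` {l + 1..n + 1} \<inter> {..?v}) = card A" by (simp add: card_image)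
    have "w (l + 1 + r) \<le> ?v \<longleftrightarrow> r < card A"
    proof
      assume le: "w (l + 1 + r) \<le> ?v"
      have "{l + 1..l + 1 + r} \<subseteq> A"
      proof
        fix m assume m: "m \<in> {l + 1..l + 1 + r}"
        then have "w m \<le> w (l + 1 + r)"
          using strict_mono_onD[OF mono, of m "l + 1 + r"] r by (cases "m = l + 1 + r") auto
        then show "m \<in> A" using m r le by (auto simp: A_def)
      qed
      then have "card {l + 1..l + 1 + r} \<le> card A" by (intro card_mono) (auto simp: A_def)
      then show "r < card A" by simp
    next
      assume rA: "r < card A"
      show "w (l + 1 + r) \<le> ?v"
      proof (rule ccontr)
        assume gt: "\<not> w (l + 1 + r) \<le> ?v"
        have "A \<subseteq> {l + 1..l + r}"
        proof
          fix m assume m: "m \<in> A"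
          have "\<not> l + 1 + r \<le> m"
            using strict_mono_onD[OF mono, of "l + 1 + r" m] m gt r by (cases "m = l + 1 + r") (auto simp: A_def)
          then show "m \<in> {l + 1..l + r}" using m by (auto simp: A_def)
        qed
        then have "card A \<le> card {l + 1..l + r}" by (intro card_mono) auto
        then show False using rA by simp
      qed
    qed
    then show ?thesis using card by (simp add: boundary_array_def)
  qed
  ultimately show ?thesis using l1 by (auto simp: box_def)
qed


section \<open>Factor modules of \<open>P\<^sub>l\<close>\<close>

lemma coord_mult_idem:
  fixes x :: "'k::field preproj_elem"
  assumes "x \<in> carrier (preproj n)" "1 \<le> l" "l \<le> n"
  shows "coord n (x \<otimes>\<^bsub>preproj n\<^esub> idem n l) s a b = (if s = l then coord n x s a b else 0)"
proof (cases "(s, a, b) \<in> box n")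
  case True
  have l: "(l, 0, 0) \<in> box n" using assms by (simp add: box_def)
  have "coord n (x \<otimes>\<^bsub>preproj n\<^esub> idem n l) s a b =
      (\<Sum>a'\<le>a. \<Sum>b'\<le>b. coord n x (s + a' - b') (a - a') (b - b') * (if s = l \<and> a' = 0 \<and> b' = 0 then 1 else 0))"
    using coord_mult[OF assms(1) array_vec_carrier[OF l] True]
    by (simp only: idem_array_vec coord_array_vec[OF l])
  also have "\<dots> = (\<Sum>a'\<le>a. \<Sum>b'\<le>b. if b' = 0 then if a' = 0 then if s = l then coord n x s a b else 0 else 0 else 0)"
    by (intro sum.cong refl) auto
  also have "\<dots> = (\<Sum>a'\<le>a. if a' = 0 then if s = l then coord n x s a b else 0 else 0)"
    by (intro sum.cong refl) (subst sum.delta, simp, simp)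
  also have "\<dots> = (if s = l then coord n x s a b else 0)"
    by (subst sum.delta) simp_all
  finally show ?thesis .
qed (auto simp: coord_outside)

lemma idem_carrier: "1 \<le> l \<Longrightarrow> l \<le> n \<Longrightarrow> idem n l \<in> carrier (preproj n)"
  by (simp add: idem_array_vec array_vec_carrier box_def)

lemma proj_module_simps:
  "\<zero>\<^bsub>proj_module n l\<^esub> = \<zero>\<^bsub>preproj n\<^esub>" "x \<oplus>\<^bsub>proj_module n l\<^esub> y = x \<oplus>\<^bsub>preproj n\<^esub> y"
  "x \<odot>\<^bsub>proj_module n l\<^esub> y = x \<otimes>\<^bsub>preproj n\<^esub> y"
  by (simp_all add: proj_module_def regular_module_def)

lemma mem_proj_module:
  fixes x :: "'k::field preproj_elem"
  assumes "1 \<le> l" "l \<le> n"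
  shows "x \<in> carrier (proj_module n l) \<longleftrightarrow> x \<in> carrier (preproj n) \<and> (\<forall>s a b. s \<noteq> l \<longrightarrow> coord n x s a b = 0)"
proof -
  interpret ring "preproj n :: 'k preproj_elem ring" by (rule ring_preproj)
  have "x = x \<otimes>\<^bsub>preproj n\<^esub> idem n l" if "x \<in> carrier (preproj n)" "\<forall>s a b. s \<noteq> l \<longrightarrow> coord n x s a b = 0"
    using that assms by (intro preproj_eqI) (auto simp: coord_mult_idem idem_carrier)
  then show ?thesis
    using assms by (auto simp: proj_module_def coord_mult_idem idem_carrier)
qed

lemma left_module_proj_module:
  assumes l: "1 \<le> l" "l \<le> n"
  shows "left_module (preproj n) (proj_module n l :: ('k::field preproj_elem, 'k preproj_elem) module)"
proof -
  interpret ring "preproj n :: 'k preproj_elem ring" by (rule ring_preproj)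
  define e :: "'k preproj_elem" where "e = idem n l"
  have e: "e \<in> carrier (preproj n)" using l by (simp add: e_def idem_carrier)
  have c: "carrier (proj_module n l) = (\<lambda>a. a \<otimes>\<^bsub>preproj n\<^esub> e) ` carrier (preproj n)"
    by (auto simp: proj_module_def e_def)
  note add = l_distr[symmetric, OF _ _ e]
  have Pc: "x \<in> carrier (preproj n)" if "x \<in> carrier (proj_module n l)" for x :: "'k preproj_elem"
    using that e by (auto simp: c)
  show ?thesis
  proof (rule left_moduleI[OF ring_preproj])
    show "abelian_group (proj_module n l :: ('k preproj_elem, 'k preproj_elem) module)"
    proof (rule abelian_groupI)
      show "\<zero>\<^bsub>proj_module n l\<^esub> \<in> carrier (proj_module n l :: ('k preproj_elem, 'k preproj_elem) module)"
        unfolding c proj_module_simps by (rule image_eqI[of _ _ "\<zero>\<^bsub>preproj n\<^esub>"]) (simp_all add: e)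
      fix x :: "'k preproj_elem"
      assume x: "x \<in> carrier (proj_module n l)"
      then obtain a where a: "a \<in> carrier (preproj n)" "x = a \<otimes>\<^bsub>preproj n\<^esub> e" unfolding c by blast
      show "\<exists>y\<in>carrier (proj_module n l). y \<oplus>\<^bsub>proj_module n l\<^esub> x = \<zero>\<^bsub>proj_module n l\<^esub>"
        unfolding c proj_module_simps
        by (rule bexI[OF _ imageI[of "\<ominus>\<^bsub>preproj n\<^esub> a"]]) (simp_all add: a add e l_neg)
    qed (auto simp: proj_module_simps c add e a_ac)
    show "a \<odot>\<^bsub>proj_module n l\<^esub> x \<in> carrier (proj_module n l)"
      if a: "a \<in> carrier (preproj n)" and x: "x \<in> carrier (proj_module n l)" for a x :: "'k preproj_elem"
    proof -
      obtain b where b: "b \<in> carrier (preproj n)" "x = b \<otimes>\<^bsub>preproj n\<^esub> e" using x unfolding c by blast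
      then have "a \<odot>\<^bsub>proj_module n l\<^esub> x = (a \<otimes>\<^bsub>preproj n\<^esub> b) \<otimes>\<^bsub>preproj n\<^esub> e"
        using a e by (simp add: proj_module_simps m_assoc)
      then show ?thesis using a b c by simp
    qed
  qed (simp_all add: proj_module_simps Pc l_distr r_distr m_assoc)
qed

lemma array_module_proj_module:
  assumes l: "1 \<le> l" "l \<le> n"
  shows "array_module n (proj_module n l :: ('k::field preproj_elem, 'k preproj_elem) module) l (proj_array n l)
    (\<lambda>x r c. coord n x l r c)"
proof (rule array_module.intro[OF left_module_proj_module[OF l] array_module_axioms.intro[OF l]])
  note mem = mem_proj_module[OF l, where ?'k='k] and box = proj_array_iff[OF l]
  show "pred_closed_subarray n l (proj_array n l)"
    by (auto simp: pred_closed_subarray_def proj_array_def)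
  show "coord n x l r c = 0" if "(r, c) \<notin> proj_array n l" for x :: "'k preproj_elem" and r c
    using that box by (simp add: coord_outside)
  show "x = y" if "x \<in> carrier (proj_module n l)" "y \<in> carrier (proj_module n l)"
    "\<And>r c. (r, c) \<in> proj_array n l \<Longrightarrow> coord n x l r c = coord n y l r c" for x y :: "'k preproj_elem"
  proof (rule preproj_eqI)
    show "coord n x s a b = coord n y s a b" if "(s, a, b) \<in> box n" for s a b
      using that \<open>x \<in> _\<close> \<open>y \<in> _\<close> \<open>\<And>r c. _ \<Longrightarrow> coord n x l r c = coord n y l r c\<close>[of a b] box
      by (cases "s = l") (auto simp: mem)
  qed (use that in \<open>auto simp: mem\<close>)
  show "\<exists>x\<in>carrier (proj_module n l). \<forall>r c. (r, c) \<in> proj_array n l \<longrightarrow> coord n x l r c = F r c"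
    for F :: "nat \<Rightarrow> nat \<Rightarrow> 'k"
    by (rule bexI[of _ "of_coord n (\<lambda>s a b. if s = l then F a b else 0)"])
       (auto simp: mem of_coord_carrier coord_of_coord box)
  show "coord n (x \<oplus>\<^bsub>proj_module n l\<^esub> y) l r c = coord n x l r c + coord n y l r c"
    if "x \<in> carrier (proj_module n l)" "y \<in> carrier (proj_module n l)" for x y :: "'k preproj_elem" and r c
    using that by (simp add: mem proj_module_simps coord_add)
  show "coord n (a \<odot>\<^bsub>proj_module n l\<^esub> x) l r c =
      (\<Sum>r'\<le>r. \<Sum>c'\<le>c. coord n a (l + r' - c') (r - r') (c - c') * coord n x l r' c')"
    if "a \<in> carrier (preproj n)" "x \<in> carrier (proj_module n l)" "(r, c) \<in> proj_array n l"
    for a x :: "'k preproj_elem" and r c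
    using that by (simp add: mem proj_module_simps coord_mult box)
qed

text \<open>The coefficients of \<open>q x\<close> on \<open>Y\<close> are those of
  \<open>x\<close>; they do not depend on the preimage, because the kernel consists of the elements
  vanishing on \<open>Y\<close>.\<close>

lemma array_module_epi:
  fixes M :: "('k::field preproj_elem, 'm) module"
  assumes l: "1 \<le> l" "l \<le> n" and Y: "pred_closed_subarray n l Y"
    and q: "module_epi (preproj n) (proj_module n l) M q"
    and ker: "\<And>x. x \<in> carrier (proj_module n l) \<Longrightarrow>
      q x = \<zero>\<^bsub>M\<^esub> \<longleftrightarrow> (\<forall>r c. (r, c) \<in> Y \<longrightarrow> coord n x l r c = 0)"
  shows "\<exists>\<mu>. array_module n M l Y \<mu> \<and> (\<forall>x \<in> carrier (proj_module n l). \<forall>r c.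
    \<mu> (q x) r c = (if (r, c) \<in> Y then coord n x l r c else 0))"
proof -
  let ?P = "proj_module n l :: ('k preproj_elem, 'k preproj_elem) module"
  interpret P: array_module n ?P l "proj_array n l" "\<lambda>x r c. coord n x l r c"
    by (rule array_module_proj_module[OF l])
  note qD = module_epiD[OF q] and LM = left_module_proj_module[OF l]
  have YP: "Y \<subseteq> proj_array n l" using Y unfolding pred_closed_subarray_def by blast
  define \<mu> where "\<mu> z r c = (if (r, c) \<in> Y then coord n (SOME x. x \<in> carrier ?P \<and> z = q x) l r c else 0)"
    for z r c
  have mu: "\<mu> (q x) r c = (if (r, c) \<in> Y then coord n x l r c else 0)" if x: "x \<in> carrier ?P" for x r c
  proof -
    define y where "y = (SOME y. y \<in> carrier ?P \<and> q x = q y)"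
    have y: "y \<in> carrier ?P" "q x = q y"
      using someI[of "\<lambda>y. y \<in> carrier ?P \<and> q x = q y" x] x unfolding y_def by blast+
    have "q (x \<ominus>\<^bsub>?P\<^esub> y) = \<zero>\<^bsub>M\<^esub>" using module_epi_eq_iff[OF LM q x y(1)] y(2) by blast
    then have "\<forall>r c. (r, c) \<in> Y \<longrightarrow> coord n (x \<ominus>\<^bsub>?P\<^esub> y) l r c = 0"
      using ker[of "x \<ominus>\<^bsub>?P\<^esub> y"] x y by blast
    then show ?thesis using P.mu_minus[OF x y(1)] by (simp add: \<mu>_def y_def[symmetric])
  qed
  have "array_module n M l Y \<mu>"
  proof (rule array_module.intro[OF left_module_epi[OF LM q] array_module_axioms.intro[OF l Y]])
    show "\<mu> x r c = 0" if "(r, c) \<notin> Y" for x r c using that by (simp add: \<mu>_def)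
    show "x = y" if xy: "x \<in> carrier M" "y \<in> carrier M" and eq: "\<And>r c. (r, c) \<in> Y \<Longrightarrow> \<mu> x r c = \<mu> y r c" for x y
    proof -
      obtain x' y' where x': "x' \<in> carrier ?P" "x = q x'" and y': "y' \<in> carrier ?P" "y = q y'"
        using qD(5) xy by blast
      have "coord n (x' \<ominus>\<^bsub>?P\<^esub> y') l r c = 0" if "(r, c) \<in> Y" for r c
        using eq[OF that] that x' y' by (simp add: mu P.mu_minus)
      then have "q (x' \<ominus>\<^bsub>?P\<^esub> y') = \<zero>\<^bsub>M\<^esub>" using ker[of "x' \<ominus>\<^bsub>?P\<^esub> y'"] x' y' by blast
      then show ?thesis using module_epi_eq_iff[OF LM q x'(1) y'(1)] x' y' by blast
    qed
    show "\<exists>x\<in>carrier M. \<forall>r c. (r, c) \<in> Y \<longrightarrow> \<mu> x r c = F r c" for F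
    proof -
      obtain x where "x \<in> carrier ?P" "\<forall>r c. (r, c) \<in> proj_array n l \<longrightarrow> coord n x l r c = F r c"
        using P.mu_exists by blast
      then show ?thesis using qD(1) YP mu by (intro bexI[of _ "q x"]) auto
    qed
    show "\<mu> (x \<oplus>\<^bsub>M\<^esub> y) r c = \<mu> x r c + \<mu> y r c" if xy: "x \<in> carrier M" "y \<in> carrier M" for x y r c
    proof -
      obtain x' y' where x': "x' \<in> carrier ?P" "x = q x'" and y': "y' \<in> carrier ?P" "y = q y'"
        using qD(5) xy by blast
      show ?thesis using x' y' P.mu_add[of x' y' r c]
        by (simp add: qD(3)[symmetric] mu)
    qed
    show "\<mu> (a \<odot>\<^bsub>M\<^esub> x) r c = (\<Sum>r'\<le>r. \<Sum>c'\<le>c. coord n a (l + r' - c') (r - r') (c - c') * \<mu> x r' c')"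
      if a: "a \<in> carrier (preproj n)" and x: "x \<in> carrier M" and rc: "(r, c) \<in> Y" for a x r c
    proof -
      obtain x' where x': "x' \<in> carrier ?P" "x = q x'" using qD(5) x by blast
      have ax: "a \<odot>\<^bsub>?P\<^esub> x' \<in> carrier ?P" using a x' P.smult_closed by blast
      have "\<mu> (a \<odot>\<^bsub>M\<^esub> x) r c = coord n (a \<odot>\<^bsub>?P\<^esub> x') l r c"
        using mu[OF ax] rc by (simp add: x' qD(4)[OF a x'(1), symmetric])
      also have "\<dots> = (\<Sum>r'\<le>r. \<Sum>c'\<le>c. coord n a (l + r' - c') (r - r') (c - c') * coord n x' l r' c')"
        using rc YP by (intro P.mu_smult[OF a x'(1)]) blast
      \<comment> \<open>All positions of the sum are predecessors of \<open>(r, c)\<close> and thus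
        in \<open>Y\<close>, where the coefficients of the preimage and of \<open>x\<close>
        coincide.\<close>
      also have "\<dots> = (\<Sum>r'\<le>r. \<Sum>c'\<le>c. coord n a (l + r' - c') (r - r') (c - c') * \<mu> x r' c')"
      proof (intro sum.cong refl)
        fix r' c' assume "r' \<in> {..r}" "c' \<in> {..c}"
        then have "(r', c') \<in> Y" using pred_closed_subarrayD[OF Y rc] by simp
        then show "coord n a (l + r' - c') (r - r') (c - c') * coord n x' l r' c' =
            coord n a (l + r' - c') (r - r') (c - c') * \<mu> x r' c'"
          using mu[OF x'(1), of r' c'] by (simp add: x')
      qed
      finally show ?thesis .
    qed
  qed
  then show ?thesis using mu by blast
qed

lemma proj_module_vec:
  assumes l: "1 \<le> l" "l \<le> n" and s: "s \<in> proj_array n l"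
  shows "array_module.vec (proj_module n l :: ('k::field preproj_elem, 'k preproj_elem) module) (proj_array n l)
    (\<lambda>x r c. coord n x l r c) s = array_vec n l s"
    and "array_vec n l s \<in> carrier (proj_module n l :: ('k preproj_elem, 'k preproj_elem) module)"
proof -
  interpret P: array_module n "proj_module n l :: ('k preproj_elem, 'k preproj_elem) module" l
    "proj_array n l" "\<lambda>x r c. coord n x l r c"
    by (rule array_module_proj_module[OF l])
  obtain r c where rc: "s = (r, c)" "(l, r, c) \<in> box n"
    using s proj_array_iff[OF l] by (cases s) auto
  show c: "array_vec n l s \<in> carrier (proj_module n l :: ('k preproj_elem, 'k preproj_elem) module)"
    using rc by (simp add: mem_proj_module[OF l] array_vec_carrier coord_array_vec)
  show "P.vec s = array_vec n l s"
    using s c rc by (intro P.mu_eqI P.vec(1)) (auto simp: P.mu_vec coord_array_vec)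
qed

lemma array_kernel_eq:
  assumes l: "1 \<le> l" "l \<le> n" and Y: "Y \<subseteq> proj_array n l"
  shows "array_kernel n l Y = {x \<in> carrier (proj_module n l :: ('k::field preproj_elem, 'k preproj_elem) module).
    \<forall>r c. (r, c) \<in> Y \<longrightarrow> coord n x l r c = 0}"
proof -
  let ?P = "proj_module n l :: ('k preproj_elem, 'k preproj_elem) module"
  interpret P: array_module n ?P l "proj_array n l" "\<lambda>x r c. coord n x l r c"
    by (rule array_module_proj_module[OF l])
  let ?S = "proj_array n l - Y"
  have "(\<Oplus>\<^bsub>?P\<^esub>s\<in>?S. scalar_elem n (k s) \<odot>\<^bsub>?P\<^esub> array_vec n l s) =
      (\<Oplus>\<^bsub>?P\<^esub>s\<in>?S. scalar_elem n (k s) \<odot>\<^bsub>?P\<^esub> P.vec s)" for k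
    by (rule P.M.finsum_cong')
       (auto simp: proj_module_vec(1)[OF l, symmetric] P.vec(1) intro!: P.smult_closed scalar_elem_carrier)
  then have "array_kernel n l Y = k_span (scalar_elem n) ?P ?S P.vec"
    unfolding array_kernel_def k_span_def by simp
  also have "\<dots> = {x \<in> carrier ?P. \<forall>(r, c) \<in> proj_array n l - ?S. coord n x l r c = 0}"
    by (rule P.k_span_vec) auto
  finally show ?thesis using Y by auto
qed

text \<open>A coefficient of \<open>a x\<close> at a position of \<open>Y\<close> only involves
  coefficients of \<open>x\<close> at predecessors, which are in \<open>Y\<close> again.\<close>

lemma vanishing_submodule:
  assumes l: "1 \<le> l" "l \<le> n" and Y: "pred_closed_subarray n l Y"
  shows "submodule {x \<in> carrier (proj_module n l :: ('k::field preproj_elem, 'k preproj_elem) module).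
    \<forall>r c. (r, c) \<in> Y \<longrightarrow> coord n x l r c = 0} (preproj n) (proj_module n l)"
proof -
  let ?P = "proj_module n l :: ('k preproj_elem, 'k preproj_elem) module"
  interpret P: array_module n ?P l "proj_array n l" "\<lambda>x r c. coord n x l r c"
    by (rule array_module_proj_module[OF l])
  have YP: "Y \<subseteq> proj_array n l" using Y unfolding pred_closed_subarray_def by blast
  show ?thesis
  proof (rule P.submoduleI)
    fix a x :: "'k preproj_elem" assume a: "a \<in> carrier (preproj n)"
      and x: "x \<in> {x \<in> carrier ?P. \<forall>r c. (r, c) \<in> Y \<longrightarrow> coord n x l r c = 0}"
    have "coord n (a \<odot>\<^bsub>?P\<^esub> x) l r c = 0" if rc: "(r, c) \<in> Y" for r c
    proof -
      have "coord n (a \<odot>\<^bsub>?P\<^esub> x) l r c =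
          (\<Sum>r'\<le>r. \<Sum>c'\<le>c. coord n a (l + r' - c') (r - r') (c - c') * coord n x l r' c')"
        using x rc YP by (intro P.mu_smult[OF a]) blast+
      also have "\<dots> = 0"
      proof (intro sum.neutral ballI)
        fix r' c' assume "r' \<in> {..r}" "c' \<in> {..c}"
        then have "(r', c') \<in> Y" using pred_closed_subarrayD[OF Y rc] by simp
        then show "coord n a (l + r' - c') (r - r') (c - c') * coord n x l r' c' = 0" using x by simp
      qed
      finally show ?thesis .
    qed
    then show "a \<odot>\<^bsub>?P\<^esub> x \<in> {x \<in> carrier ?P. \<forall>r c. (r, c) \<in> Y \<longrightarrow> coord n x l r c = 0}"
      using a x P.smult_closed by simp
  qed (auto simp: P.mu_zero P.mu_add)
qed

section \<open>The modules \<open>J(w)\<close> and arbitrary factors of P_l\<close>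

lemma (in array_module) represented_by_array_cong:
  assumes "\<And>s. s \<in> Y \<Longrightarrow> b s = vec s"
  shows "represented_by_array n l Y M b"
proof -
  have "(\<Oplus>\<^bsub>M\<^esub>s\<in>Y. scalar_elem n (k s) \<odot>\<^bsub>M\<^esub> b s) = (\<Oplus>\<^bsub>M\<^esub>s\<in>Y. scalar_elem n (k s) \<odot>\<^bsub>M\<^esub> vec s)" for k
    by (rule M.finsum_cong') (auto simp: assms vec(1) intro!: smult_closed scalar_elem_carrier)
  moreover have "b ` Y = vec ` Y" using assms by (intro image_cong) auto
  ultimately have "is_k_basis (scalar_elem n) M Y b"
    using is_k_basis_vec unfolding is_k_basis_def by simp
  then show ?thesis
    using represented_by_array_vec assms unfolding represented_by_array_def Let_def by simp
qed

text \<open>The product of the cosets of \<open>a\<close> and of \<open>e_l\<close> is the coset of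
  \<open>a e_l\<close>, so \<open>J(w)\<close> is the image of \<open>\<Pi> e_l\<close> under the
  coset map.\<close>

lemma J_module_epi:
  assumes l: "1 \<le> l" "l \<le> n" and I: "ideal (perm_ideal n w) (preproj n :: 'k::field preproj_elem ring)"
  shows "module_epi (preproj n) (proj_module n l :: ('k preproj_elem, 'k preproj_elem) module) (J_module n w l)
      (\<lambda>x. perm_ideal n w +>\<^bsub>preproj n\<^esub> x)"
    and "x \<in> carrier (preproj n) \<Longrightarrow>
      perm_ideal n w +>\<^bsub>preproj n\<^esub> x = \<zero>\<^bsub>J_module n w l :: ('k preproj_elem, 'k preproj_elem set) module\<^esub> \<longleftrightarrow> x \<in> perm_ideal n w"
proof -
  let ?A = "preproj n :: 'k preproj_elem ring" and ?I = "perm_ideal n w :: 'k preproj_elem set"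
  interpret ideal ?I ?A by (rule I)
  have zero: "\<zero>\<^bsub>J_module n w l\<^esub> = ?I"
    by (simp add: J_module_def Let_def FactRing_def)
  have e: "idem n l \<in> carrier ?A" using l by (rule idem_carrier)
  have cP: "carrier (proj_module n l) = (\<lambda>a. a \<otimes>\<^bsub>?A\<^esub> idem n l) ` carrier ?A"
    by (auto simp: proj_module_def)
  have Pc: "x \<in> carrier ?A" if "x \<in> carrier (proj_module n l)" for x
    using that e by (auto simp: cP)
  have mult: "(?I +>\<^bsub>?A\<^esub> x) \<otimes>\<^bsub>?A Quot ?I\<^esub> (?I +>\<^bsub>?A\<^esub> y) = ?I +>\<^bsub>?A\<^esub> (x \<otimes>\<^bsub>?A\<^esub> y)"
    if "x \<in> carrier ?A" "y \<in> carrier ?A" for x y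
    using that by (simp add: FactRing_def rcoset_mult_add)
  have "carrier (?A Quot ?I) = (\<lambda>a. ?I +>\<^bsub>?A\<^esub> a) ` carrier ?A"
    by (auto simp: FactRing_def A_RCOSETS_def')
  moreover have "carrier (J_module n w l) =
      (\<lambda>C. C \<otimes>\<^bsub>?A Quot ?I\<^esub> (?I +>\<^bsub>?A\<^esub> idem n l)) ` carrier (?A Quot ?I)"
    by (auto simp: J_module_def Let_def)
  ultimately have cJ: "carrier (J_module n w l) = (\<lambda>a. ?I +>\<^bsub>?A\<^esub> (a \<otimes>\<^bsub>?A\<^esub> idem n l)) ` carrier ?A"
    using mult e by (auto simp: image_image intro: image_cong)
  show "module_epi ?A (proj_module n l) (J_module n w l) (\<lambda>x. ?I +>\<^bsub>?A\<^esub> x)"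
    unfolding module_epi_def
  proof (intro conjI ballI)
    show "(\<lambda>x. ?I +>\<^bsub>?A\<^esub> x) ` carrier (proj_module n l) = carrier (J_module n w l)"
      unfolding cP cJ by (simp add: image_image)
    show "?I +>\<^bsub>?A\<^esub> \<zero>\<^bsub>proj_module n l\<^esub> = \<zero>\<^bsub>J_module n w l\<^esub>"
      unfolding zero proj_module_simps using a_subset by (simp add: a_coset_add_zero)
    show "?I +>\<^bsub>?A\<^esub> (x \<oplus>\<^bsub>proj_module n l\<^esub> y) = (?I +>\<^bsub>?A\<^esub> x) \<oplus>\<^bsub>J_module n w l\<^esub> (?I +>\<^bsub>?A\<^esub> y)"
      if "x \<in> carrier (proj_module n l)" "y \<in> carrier (proj_module n l)" for x y
      using that Pc by (simp add: proj_module_simps J_module_def Let_def FactRing_def a_rcos_sum)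
    show "?I +>\<^bsub>?A\<^esub> (a \<odot>\<^bsub>proj_module n l\<^esub> x) = a \<odot>\<^bsub>J_module n w l\<^esub> (?I +>\<^bsub>?A\<^esub> x)"
      if "a \<in> carrier ?A" "x \<in> carrier (proj_module n l)" for a x
      using that Pc by (simp add: proj_module_simps J_module_def Let_def mult)
  qed
  show "?I +>\<^bsub>?A\<^esub> x = \<zero>\<^bsub>J_module n w l\<^esub> \<longleftrightarrow> x \<in> ?I" if "x \<in> carrier ?A"
    unfolding zero using that rcos_const_imp_mem a_rcos_zero[OF is_ideal] by blast
qed

text \<open>Both modules are factors of P_l by the elements whose coefficients vanish on the array,
  so the isomorphism is induced by the identity of P_l.\<close>

theorem J_module_array:
  assumes w: "w permutes {1..n + 1}" and type: "of_type n w l"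
  shows "pred_closed_subarray n l (J_array n l w)"
    and "\<exists>h \<in> left_iso (preproj n :: 'k::field preproj_elem ring)
        (array_factor n l (J_array n l w)) (J_module n w l).
      \<forall>p \<in> carrier (proj_module n l).
        h (array_kernel n l (J_array n l w) +>\<^bsub>proj_module n l\<^esub> p) = perm_ideal n w +>\<^bsub>preproj n\<^esub> p"
    and "represented_by_array n l (J_array n l w)
      (J_module n w l :: ('k preproj_elem, 'k preproj_elem set) module)
      (\<lambda>rc. perm_ideal n w +>\<^bsub>preproj n\<^esub> array_vec n l rc)"
proof -
  let ?P = "proj_module n l :: ('k preproj_elem, 'k preproj_elem) module"
  let ?Y = "J_array n l w"
  let ?K = "array_kernel n l ?Y :: 'k preproj_elem set"
  let ?J = "J_module n w l :: ('k preproj_elem, 'k preproj_elem set) module"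
  have l: "1 \<le> l" "l \<le> n" using type by (auto simp: of_type_def)
  note Y = J_array_boundary[OF w type]
  have "(r, c) \<in> ?Y" if "(r', c') \<in> ?Y" "r \<le> r'" "c \<le> c'" for r c r' c'
    using that boundary_array_down[of r' c' l _ r c] unfolding Y by (auto simp: box_def)
  then show closed: "pred_closed_subarray n l ?Y"
    unfolding pred_closed_subarray_def
    by (meson Y proj_array_iff[OF l] subrelI le_add1 order_refl)
  then have YP: "?Y \<subseteq> proj_array n l" unfolding pred_closed_subarray_def by blast
  have I: "perm_ideal n w = (vanishing n (\<lambda>l. boundary_array l (w ` {l + 1..n + 1})) :: 'k preproj_elem set)"
    by (rule perm_ideal_vanishing(1)[OF w])
  note epi = J_module_epi[OF l perm_ideal_vanishing(2)[OF w, where ?'k='k]]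
  have ker: "perm_ideal n w +>\<^bsub>preproj n\<^esub> x = \<zero>\<^bsub>?J\<^esub> \<longleftrightarrow> (\<forall>r c. (r, c) \<in> ?Y \<longrightarrow> coord n x l r c = 0)"
    if "x \<in> carrier ?P" for x
  proof -
    have "x \<in> perm_ideal n w \<longleftrightarrow> (\<forall>r c. (r, c) \<in> ?Y \<longrightarrow> coord n x l r c = 0)"
      unfolding I vanishing_def Y using that unfolding mem_proj_module[OF l] by (auto; metis)
    then show ?thesis using epi(2) that mem_proj_module[OF l] by blast
  qed
  have K: "?K = {x \<in> carrier ?P. \<forall>r c. (r, c) \<in> ?Y \<longrightarrow> coord n x l r c = 0}"
    by (rule array_kernel_eq[OF l YP])
  have sub: "submodule ?K (preproj n) ?P" unfolding K by (rule vanishing_submodule[OF l closed])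
  note LM = left_module_proj_module[OF l, where ?'k='k]
  show "\<exists>h \<in> left_iso (preproj n) (array_factor n l ?Y) ?J.
      \<forall>p \<in> carrier ?P. h (?K +>\<^bsub>?P\<^esub> p) = perm_ideal n w +>\<^bsub>preproj n\<^esub> p"
    unfolding array_factor_def
  proof (rule left_iso_of_epis[OF LM quot_module_epi[OF LM sub] epi(1)])
    show "?K +>\<^bsub>?P\<^esub> x = \<zero>\<^bsub>quot_module ?P ?K\<^esub> \<longleftrightarrow> perm_ideal n w +>\<^bsub>preproj n\<^esub> x = \<zero>\<^bsub>?J\<^esub>"
      if "x \<in> carrier ?P" for x
    proof -
      have "x \<in> ?K \<longleftrightarrow> (\<forall>r c. (r, c) \<in> ?Y \<longrightarrow> coord n x l r c = 0)" using that by (simp add: K)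
      then show ?thesis using quot_module_kernel[OF LM sub that] ker[OF that] by blast
    qed
  qed
  obtain \<mu> where \<mu>: "array_module n ?J l ?Y \<mu>" and mu: "\<And>x r c. x \<in> carrier ?P \<Longrightarrow>
      \<mu> (perm_ideal n w +>\<^bsub>preproj n\<^esub> x) r c = (if (r, c) \<in> ?Y then coord n x l r c else 0)"
    using array_module_epi[OF l closed epi(1) ker] by blast
  interpret J: array_module n ?J l ?Y \<mu> by (rule \<mu>)
  show "represented_by_array n l ?Y ?J (\<lambda>rc. perm_ideal n w +>\<^bsub>preproj n\<^esub> array_vec n l rc)"
  proof (rule J.represented_by_array_cong)
    fix s assume s: "s \<in> ?Y"
    then obtain r c where rc: "s = (r, c)" "(l, r, c) \<in> box n" using J.in_box by (cases s) auto
    have c: "array_vec n l s \<in> carrier ?P" using proj_module_vec(2)[OF l] s YP by blast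
    show "perm_ideal n w +>\<^bsub>preproj n\<^esub> array_vec n l s = J.vec s"
    proof (rule J.mu_eqI[OF module_epiD(1)[OF epi(1) c] J.vec(1)])
      fix r' c' assume "(r', c') \<in> ?Y"
      then show "\<mu> (perm_ideal n w +>\<^bsub>preproj n\<^esub> array_vec n l s) r' c' = \<mu> (J.vec s) r' c'"
        unfolding mu[OF c] J.mu_vec[OF s] using rc by (simp add: coord_array_vec)
    qed
  qed
qed

text \<open>\<open>Y\<close> consists of the positions whose basis vectors are not in
  \<open>U\<close>. It contains the origin because \<open>U\<close> is proper.\<close>

lemma quot_module_array:
  fixes U :: "'k::field preproj_elem set"
  assumes l: "1 \<le> l" "l \<le> n" and U: "submodule U (preproj n) (proj_module n l)"
    and ne: "U \<noteq> carrier (proj_module n l)"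
  shows "\<exists>Y \<mu>. array_module n (quot_module (proj_module n l) U) l Y \<mu> \<and> (0, 0) \<in> Y"
proof -
  let ?P = "proj_module n l :: ('k preproj_elem, 'k preproj_elem) module"
  interpret P: array_module n ?P l "proj_array n l" "\<lambda>x r c. coord n x l r c"
    by (rule array_module_proj_module[OF l])
  note LM = left_module_proj_module[OF l, where ?'k='k]
  let ?Y = "{s \<in> proj_array n l. P.vec s \<notin> U}"
  have ker: "U +>\<^bsub>?P\<^esub> x = \<zero>\<^bsub>quot_module ?P U\<^esub> \<longleftrightarrow> (\<forall>r c. (r, c) \<in> ?Y \<longrightarrow> coord n x l r c = 0)"
    if "x \<in> carrier ?P" for x
    unfolding quot_module_kernel[OF LM U that] by (subst P.submodule_eq[OF U]) (use that in auto)
  have "(0, 0) \<in> ?Y"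
    using P.vec_origin_generates[OF U] ne l by (auto simp: proj_array_def)
  moreover obtain \<mu> where "array_module n (quot_module ?P U) l ?Y \<mu>"
    using array_module_epi[OF l P.submodule_complement_closed[OF U] quot_module_epi[OF LM U] ker] by blast
  ultimately show ?thesis by blast
qed


section \<open>Sums of indecomposable projective right modules\<close>

text \<open>At a vertex this is \<open>e_v\<close>, but for \<open>v = 0\<close> and
  \<open>v > n\<close> it is zero; in this way degenerate summands can be carried along.\<close>

definition vertex_idem :: "nat \<Rightarrow> nat \<Rightarrow> 'k::field preproj_elem" where
  "vertex_idem n v = basis_elem n 1 v 0 0"

lemma vertex_idem_carrier: "vertex_idem n v \<in> carrier (preproj n)"
  by (simp add: vertex_idem_def basis_elem_carrier)

lemma coord_mult_nonzero:
  assumes "x \<in> carrier (preproj n)" "y \<in> carrier (preproj n)" "coord n (x \<otimes>\<^bsub>preproj n\<^esub> y) s a b \<noteq> 0"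
  shows "\<exists>a' \<le> a. \<exists>b' \<le> b. coord n x (s + a' - b') (a - a') (b - b') \<noteq> 0 \<and> coord n y s a' b' \<noteq> 0"
proof (rule ccontr)
  assume no: "\<not> ?thesis"
  have sab: "(s, a, b) \<in> box n" using assms(3) coord_outside by blast
  have "(\<Sum>a'\<le>a. \<Sum>b'\<le>b. coord n x (s + a' - b') (a - a') (b - b') * coord n y s a' b') = 0"
    using no by (intro sum.neutral ballI) (simp; blast)
  then show False using assms(3) coord_mult[OF assms(1,2) sab] by simp
qed

lemma coord_basis_elem_mult:
  assumes "x \<in> carrier (preproj n)" "(s, a', b') \<in> box n"
  shows "coord n (basis_elem n 1 v a b \<otimes>\<^bsub>preproj n\<^esub> x) s a' b' =
    (if (v, a, b) \<in> box n \<and> a \<le> a' \<and> b \<le> b' \<and> s + (a' - a) - (b' - b) = v then coord n x s (a' - a) (b' - b) else 0)"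
proof (cases "(v, a, b) \<in> box n")
  case True
  from coord_array_vec_mult[OF True assms] show ?thesis using True
    by (simp only: array_vec_basis_elem[OF True] simp_thms)
next
  case False
  interpret ring "preproj n :: 'a preproj_elem ring" by (rule ring_preproj)
  have "basis_elem n 1 v a b = (\<zero>\<^bsub>preproj n\<^esub> :: 'a preproj_elem)"
    by (rule preproj_eqI[of _ n]) (use False in \<open>auto simp: basis_elem_carrier coord_basis_elem coord_zero\<close>)
  then show ?thesis using False assms(1) by (simp add: coord_zero)
qed

text \<open>Multiplication by \<open>e_v\<close> from the left selects the monomials ending at
  \<open>v\<close>. The additive condition also covers \<open>v = 0\<close> and
  \<open>v > n\<close>, where no triple of the box satisfies it and \<open>x\<close> must be
  zero.\<close>

lemma vertex_idem_mult_iff: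
  assumes x: "x \<in> carrier (preproj n)"
  shows "vertex_idem n v \<otimes>\<^bsub>preproj n\<^esub> x = x \<longleftrightarrow> (\<forall>s a b. coord n x s a b \<noteq> 0 \<longrightarrow> s + a = v + b)"
proof -
  interpret ring "preproj n :: 'a preproj_elem ring" by (rule ring_preproj)
  have c: "coord n (vertex_idem n v \<otimes>\<^bsub>preproj n\<^esub> x) s a b = (if s + a = v + b then coord n x s a b else 0)"
    if sab: "(s, a, b) \<in> box n" for s a b
    unfolding vertex_idem_def coord_basis_elem_mult[OF x sab] using sab by (auto simp: box_def)
  show ?thesis
  proof
    assume eq: "vertex_idem n v \<otimes>\<^bsub>preproj n\<^esub> x = x"
    show "\<forall>s a b. coord n x s a b \<noteq> 0 \<longrightarrow> s + a = v + b"
    proof (intro allI impI)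
      fix s a b assume nz: "coord n x s a b \<noteq> 0"
      then have "(s, a, b) \<in> box n" using coord_outside by blast
      from c[OF this] show "s + a = v + b" unfolding eq using nz by (auto split: if_splits)
    qed
  next
    assume "\<forall>s a b. coord n x s a b \<noteq> 0 \<longrightarrow> s + a = v + b"
    then show "vertex_idem n v \<otimes>\<^bsub>preproj n\<^esub> x = x"
      using x by (intro preproj_eqI[of _ n]) (auto simp: vertex_idem_carrier c)
  qed
qed

lemma vertex_idem_basis_elem:
  assumes "(s, a, b) \<in> box n \<Longrightarrow> s + a = v + b"
  shows "vertex_idem n v \<otimes>\<^bsub>preproj n\<^esub> basis_elem n k s a b = basis_elem n k s a b"
  unfolding vertex_idem_mult_iff[OF basis_elem_carrier] using assms by (auto simp: coord_basis_elem)

lemma vertex_idem_idem: "vertex_idem n v \<otimes>\<^bsub>preproj n\<^esub> vertex_idem n v = vertex_idem n v"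
  by (subst (2 3) vertex_idem_def, rule vertex_idem_basis_elem) simp

text \<open>The right module \<open>e\<^bsub>u(0)\<^esub>\<Pi> \<oplus> \<dots> \<oplus> e\<^bsub>u(m - 1)\<^esub>\<Pi>\<close>; the summands with \<open>u(i) \<notin> {1, \<dots>, n}\<close> are zero.\<close>

definition proj_sum :: "nat \<Rightarrow> nat \<Rightarrow> (nat \<Rightarrow> nat) \<Rightarrow> ('k::field preproj_elem, nat \<Rightarrow> 'k preproj_elem) module" where
  "proj_sum n m u = (free_module (op_ring (preproj n)) m)\<lparr>carrier :=
     {z \<in> {..<m} \<rightarrow>\<^sub>E carrier (preproj n). \<forall>i<m. vertex_idem n (u i) \<otimes>\<^bsub>preproj n\<^esub> z i = z i}\<rparr>"

lemma proj_sum_simps: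
  "\<zero>\<^bsub>proj_sum n m u\<^esub> = (\<lambda>i\<in>{..<m}. \<zero>\<^bsub>preproj n\<^esub>)"
  "z \<oplus>\<^bsub>proj_sum n m u\<^esub> z' = (\<lambda>i\<in>{..<m}. z i \<oplus>\<^bsub>preproj n\<^esub> z' i)"
  "a \<odot>\<^bsub>proj_sum n m u\<^esub> z = (\<lambda>i\<in>{..<m}. z i \<otimes>\<^bsub>preproj n\<^esub> a)"
  by (simp_all add: proj_sum_def free_module_def)

lemma proj_sum_memI:
  assumes "\<And>i. i < m \<Longrightarrow> z i \<in> carrier (preproj n)"
    and "\<And>i. i < m \<Longrightarrow> vertex_idem n (u i) \<otimes>\<^bsub>preproj n\<^esub> z i = z i" and "z \<in> extensional {..<m}"
  shows "z \<in> carrier (proj_sum n m u)"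
  using assms by (auto simp: proj_sum_def PiE_def)

lemma proj_sum_memD:
  assumes "z \<in> carrier (proj_sum n m u)"
  shows "i < m \<Longrightarrow> z i \<in> carrier (preproj n)"
    and "i < m \<Longrightarrow> vertex_idem n (u i) \<otimes>\<^bsub>preproj n\<^esub> z i = z i" and "z \<in> extensional {..<m}"
  using assms by (auto simp: proj_sum_def PiE_def)

lemma proj_sum_eqI:
  assumes "z \<in> extensional {..<m}" "z' \<in> extensional {..<m}" "\<And>i. i < m \<Longrightarrow> z i = z' i"
  shows "z = z'"
  using assms by (intro extensionalityI[where A = "{..<m}"]) auto

lemma left_module_free_part:
  fixes n :: nat and F :: "('k::field preproj_elem, nat \<Rightarrow> 'k preproj_elem) module"
  assumes carr: "\<And>z. z \<in> carrier F \<Longrightarrow> z \<in> extensional {..<m} \<and> (\<forall>i<m. z i \<in> carrier (preproj n))"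
    and F_zero: "\<zero>\<^bsub>F\<^esub> = (\<lambda>i\<in>{..<m}. \<zero>\<^bsub>preproj n\<^esub>)" "\<zero>\<^bsub>F\<^esub> \<in> carrier F"
    and F_add: "\<And>z z'. z \<oplus>\<^bsub>F\<^esub> z' = (\<lambda>i\<in>{..<m}. z i \<oplus>\<^bsub>preproj n\<^esub> z' i)"
      "\<And>z z'. z \<in> carrier F \<Longrightarrow> z' \<in> carrier F \<Longrightarrow> z \<oplus>\<^bsub>F\<^esub> z' \<in> carrier F"
    and F_smult: "\<And>a z. a \<odot>\<^bsub>F\<^esub> z = (\<lambda>i\<in>{..<m}. z i \<otimes>\<^bsub>preproj n\<^esub> a)"
      "\<And>a z. a \<in> carrier (preproj n) \<Longrightarrow> z \<in> carrier F \<Longrightarrow> a \<odot>\<^bsub>F\<^esub> z \<in> carrier F"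
  shows "left_module (op_ring (preproj n)) F"
proof -
  interpret ring "preproj n :: 'k preproj_elem ring" by (rule ring_preproj)
  note ext = proj_sum_eqI[where m = m]
  show ?thesis
  proof (rule left_moduleI[OF ring_op_ring[OF ring_preproj]])
    show "abelian_group F"
    proof (rule abelian_groupI)
      fix x y z assume "x \<in> carrier F" "y \<in> carrier F" "z \<in> carrier F"
      note c = this[THEN carr]
      show "x \<oplus>\<^bsub>F\<^esub> y \<oplus>\<^bsub>F\<^esub> z = x \<oplus>\<^bsub>F\<^esub> (y \<oplus>\<^bsub>F\<^esub> z)"
        by (rule ext) (use c in \<open>simp_all add: F_add(1) a_assoc\<close>)
    next
      fix x y assume "x \<in> carrier F" "y \<in> carrier F"
      note c = this[THEN carr]
      show "x \<oplus>\<^bsub>F\<^esub> y = y \<oplus>\<^bsub>F\<^esub> x"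
        by (rule ext) (use c in \<open>simp_all add: F_add(1) a_comm\<close>)
    next
      fix x assume x: "x \<in> carrier F"
      note c = carr[OF x]
      show "\<zero>\<^bsub>F\<^esub> \<oplus>\<^bsub>F\<^esub> x = x"
        by (rule ext) (use c in \<open>simp_all add: F_add(1) F_zero(1)\<close>)
      have "(\<ominus>\<^bsub>preproj n\<^esub> \<one>\<^bsub>preproj n\<^esub>) \<odot>\<^bsub>F\<^esub> x \<oplus>\<^bsub>F\<^esub> x = \<zero>\<^bsub>F\<^esub>"
        by (rule ext) (use c in \<open>simp_all add: F_add(1) F_smult(1) F_zero(1) r_minus l_neg\<close>)
      then show "\<exists>y\<in>carrier F. y \<oplus>\<^bsub>F\<^esub> x = \<zero>\<^bsub>F\<^esub>" using F_smult(2)[OF _ x] by blast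
    qed (rule F_add(2) F_zero(2); assumption?)+
  next
    fix a b :: "'k preproj_elem" and x y assume "a \<in> carrier (op_ring (preproj n))" and x: "x \<in> carrier F"
    then have a: "a \<in> carrier (preproj n)" by simp
    note c = carr[OF x]
    show "a \<odot>\<^bsub>F\<^esub> x \<in> carrier F" by (rule F_smult(2)[OF a x])
    show "a \<odot>\<^bsub>F\<^esub> (x \<oplus>\<^bsub>F\<^esub> y) = a \<odot>\<^bsub>F\<^esub> x \<oplus>\<^bsub>F\<^esub> a \<odot>\<^bsub>F\<^esub> y" if "y \<in> carrier F"
      by (rule ext) (use c carr[OF that] a in \<open>simp_all add: F_add(1) F_smult(1) l_distr\<close>)
    assume "b \<in> carrier (op_ring (preproj n))"
    then have b: "b \<in> carrier (preproj n)" by simp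
    show "(a \<oplus>\<^bsub>op_ring (preproj n)\<^esub> b) \<odot>\<^bsub>F\<^esub> x = a \<odot>\<^bsub>F\<^esub> x \<oplus>\<^bsub>F\<^esub> b \<odot>\<^bsub>F\<^esub> x"
      by (rule ext) (use c a b in \<open>simp_all add: F_add(1) F_smult(1) r_distr\<close>)
    show "(a \<otimes>\<^bsub>op_ring (preproj n)\<^esub> b) \<odot>\<^bsub>F\<^esub> x = a \<odot>\<^bsub>F\<^esub> (b \<odot>\<^bsub>F\<^esub> x)"
      by (rule ext) (use c a b in \<open>simp_all add: F_smult(1) m_assoc\<close>)
  next
    fix x assume x: "x \<in> carrier F"
    show "\<one>\<^bsub>op_ring (preproj n)\<^esub> \<odot>\<^bsub>F\<^esub> x = x"
      by (rule ext) (use carr[OF x] in \<open>simp_all add: F_smult(1)\<close>)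
  qed
qed

lemma left_module_proj_sum:
  "left_module (op_ring (preproj n)) (proj_sum n m u :: ('k::field preproj_elem, _) module)"
proof -
  interpret ring "preproj n :: 'k preproj_elem ring" by (rule ring_preproj)
  note D = proj_sum_memD[where n = n and m = m and u = u]
  note e = vertex_idem_carrier[where n = n]
  show ?thesis
  proof (rule left_module_free_part[where m = m])
    show "z \<in> extensional {..<m} \<and> (\<forall>i<m. z i \<in> carrier (preproj n))"
      if "z \<in> carrier (proj_sum n m u)" for z :: "nat \<Rightarrow> 'k preproj_elem"
      using D[OF that] by blast
    show "\<zero>\<^bsub>proj_sum n m u\<^esub> \<in> carrier (proj_sum n m u :: ('k preproj_elem, _) module)"
      by (rule proj_sum_memI) (simp_all add: proj_sum_simps e)
    show "z \<oplus>\<^bsub>proj_sum n m u\<^esub> z' \<in> carrier (proj_sum n m u)"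
      if "z \<in> carrier (proj_sum n m u)" "z' \<in> carrier (proj_sum n m u)" for z z' :: "nat \<Rightarrow> 'k preproj_elem"
      by (rule proj_sum_memI) (use D[OF that(1)] D[OF that(2)] in \<open>simp_all add: proj_sum_simps e r_distr\<close>)
    show "a \<odot>\<^bsub>proj_sum n m u\<^esub> z \<in> carrier (proj_sum n m u)"
      if "a \<in> carrier (preproj n)" "z \<in> carrier (proj_sum n m u)" for a and z :: "nat \<Rightarrow> 'k preproj_elem"
      by (rule proj_sum_memI)
         (use that(1) D[OF that(2)] in \<open>simp_all add: proj_sum_simps e m_assoc[symmetric]\<close>)
  qed (simp_all add: proj_sum_simps)
qed

text \<open>Multiplying the entries by their idempotents retracts the free module onto the
  sum.\<close>

lemma fg_projective_proj_sum:
  "fg_projective (op_ring (preproj n)) (proj_sum n m u :: ('k::field preproj_elem, _) module)"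
proof -
  interpret ring "preproj n :: 'k preproj_elem ring" by (rule ring_preproj)
  let ?R = "op_ring (preproj n) :: 'k preproj_elem ring"
  let ?P = "proj_sum n m u :: ('k preproj_elem, _) module" and ?F = "free_module ?R m"
  note D = proj_sum_memD[where n = n and m = m and u = u] and e = vertex_idem_carrier[where n = n]
  have F: "carrier ?F = {..<m} \<rightarrow>\<^sub>E carrier (preproj n)" "\<And>z z'. z \<oplus>\<^bsub>?F\<^esub> z' = z \<oplus>\<^bsub>?P\<^esub> z'"
    "\<And>a z. a \<odot>\<^bsub>?F\<^esub> z = a \<odot>\<^bsub>?P\<^esub> z"
    by (simp_all add: proj_sum_def free_module_def)
  have PF: "carrier ?P \<subseteq> carrier ?F" unfolding F(1) by (auto simp: proj_sum_def)
  interpret P: left_module ?R ?P by (rule left_module_proj_sum)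
  define s where "s = (\<lambda>z\<in>carrier ?P. z)"
  define p where "p = (\<lambda>z\<in>carrier ?F. \<lambda>i\<in>{..<m}. vertex_idem n (u i) \<otimes>\<^bsub>preproj n\<^esub> z i)"
  have Fc: "z i \<in> carrier (preproj n)" if "z \<in> carrier ?F" "i < m" for z i
    using that unfolding F(1) by (auto simp: PiE_def)
  have Fadd: "z \<oplus>\<^bsub>?P\<^esub> z' \<in> carrier ?F" if "z \<in> carrier ?F" "z' \<in> carrier ?F" for z z'
    using Fc[OF that(1)] Fc[OF that(2)] unfolding F(1) by (auto simp: proj_sum_simps)
  have Fsmult: "a \<odot>\<^bsub>?P\<^esub> z \<in> carrier ?F" if "a \<in> carrier (preproj n)" "z \<in> carrier ?F" for a z
    using Fc[OF that(2)] that(1) unfolding F(1) by (auto simp: proj_sum_simps)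
  have "s \<in> left_hom ?R ?P ?F"
    unfolding left_hom_def s_def using PF P.smult_closed
    by (auto simp: F(2,3))
  moreover have "p \<in> left_hom ?R ?F ?P"
    unfolding left_hom_def
  proof (intro CollectI conjI ballI)
    have "(\<lambda>i\<in>{..<m}. vertex_idem n (u i) \<otimes>\<^bsub>preproj n\<^esub> z i) \<in> carrier ?P" if "z \<in> carrier ?F" for z
      by (rule proj_sum_memI) (use Fc[OF that] in \<open>simp_all add: e m_assoc[symmetric] vertex_idem_idem\<close>)
    then show "p \<in> carrier ?F \<rightarrow>\<^sub>E carrier ?P" by (simp add: p_def)
    show "p (x \<oplus>\<^bsub>?F\<^esub> y) = p x \<oplus>\<^bsub>?P\<^esub> p y" if "x \<in> carrier ?F" "y \<in> carrier ?F" for x y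
      using Fc[OF that(1)] Fc[OF that(2)] that Fadd[OF that]
      by (auto simp: p_def F(2) proj_sum_simps(2) e r_distr intro!: restrict_ext)
    show "p (a \<odot>\<^bsub>?F\<^esub> x) = a \<odot>\<^bsub>?P\<^esub> p x" if "a \<in> carrier ?R" "x \<in> carrier ?F" for a x
      using Fc[OF that(2)] that Fsmult[of a x]
      by (auto simp: p_def F(3) proj_sum_simps(3) e m_assoc intro!: restrict_ext)
  qed
  moreover have "p (s x) = x" if "x \<in> carrier ?P" for x
  proof -
    have "x \<in> carrier ?F" using that PF by blast
    then show ?thesis using that D[OF that]
      by (intro proj_sum_eqI[where m = m]) (simp_all add: p_def s_def)
  qed
  ultimately show ?thesis unfolding fg_projective_def using left_module_proj_sum by blast
qed

definition single_entry :: "nat \<Rightarrow> nat \<Rightarrow> nat \<Rightarrow> 'k::field preproj_elem \<Rightarrow> nat \<Rightarrow> 'k preproj_elem" where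
  "single_entry n m i x = (\<lambda>j\<in>{..<m}. if j = i then x else \<zero>\<^bsub>preproj n\<^esub>)"

text \<open>The partial sums of the decomposition of \<open>z\<close> into its entries; they permit
  induction over the entries in place of finite sums of modules.\<close>

definition truncate :: "nat \<Rightarrow> nat \<Rightarrow> nat \<Rightarrow> (nat \<Rightarrow> 'k::field preproj_elem) \<Rightarrow> nat \<Rightarrow> 'k preproj_elem" where
  "truncate n m k z = (\<lambda>j\<in>{..<m}. if j < k then z j else \<zero>\<^bsub>preproj n\<^esub>)"

lemma single_entry_mem:
  assumes "x \<in> carrier (preproj n)" "vertex_idem n (u i) \<otimes>\<^bsub>preproj n\<^esub> x = x"
  shows "single_entry n m i x \<in> carrier (proj_sum n m u)"
proof -
  interpret ring "preproj n :: 'a preproj_elem ring" by (rule ring_preproj)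
  show ?thesis
    by (rule proj_sum_memI) (use assms in \<open>auto simp: single_entry_def vertex_idem_carrier\<close>)
qed

lemma truncate_mem:
  assumes "z \<in> carrier (proj_sum n m u)"
  shows "truncate n m k z \<in> carrier (proj_sum n m u)"
proof -
  interpret ring "preproj n :: 'a preproj_elem ring" by (rule ring_preproj)
  show ?thesis
    by (rule proj_sum_memI) (use proj_sum_memD[OF assms] in \<open>auto simp: truncate_def vertex_idem_carrier\<close>)
qed

lemma truncate_steps:
  assumes "z \<in> carrier (proj_sum n m u)"
  shows "truncate n m 0 z = \<zero>\<^bsub>proj_sum n m u\<^esub>" "truncate n m m z = z"
    "k < m \<Longrightarrow> truncate n m (Suc k) z = truncate n m k z \<oplus>\<^bsub>proj_sum n m u\<^esub> single_entry n m k (z k)"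
proof -
  interpret ring "preproj n :: 'a preproj_elem ring" by (rule ring_preproj)
  note D = proj_sum_memD[OF assms]
  show "truncate n m 0 z = \<zero>\<^bsub>proj_sum n m u\<^esub>" by (simp add: truncate_def proj_sum_simps)
  show "truncate n m m z = z"
    by (rule proj_sum_eqI[where m = m]) (use D in \<open>simp_all add: truncate_def\<close>)
  show "truncate n m (Suc k) z = truncate n m k z \<oplus>\<^bsub>proj_sum n m u\<^esub> single_entry n m k (z k)" if "k < m"
    by (rule proj_sum_eqI[where m = m])
       (use D(1) that in \<open>auto simp: truncate_def proj_sum_simps single_entry_def less_Suc_eq\<close>)
qed

lemma single_entry_smult:
  assumes "x \<in> carrier (preproj n)" "a \<in> carrier (preproj n)"
  shows "a \<odot>\<^bsub>proj_sum n m u\<^esub> single_entry n m i x = single_entry n m i (x \<otimes>\<^bsub>preproj n\<^esub> a)"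
proof -
  interpret ring "preproj n :: 'a preproj_elem ring" by (rule ring_preproj)
  show ?thesis using assms
    by (intro proj_sum_eqI[where m = m]) (auto simp: single_entry_def proj_sum_simps)
qed

text \<open>Nakayama's lemma for the ideal spanned by the paths of positive length.\<close>

lemma superfluous_proj_sum:
  fixes u :: "nat \<Rightarrow> nat" and K :: "(nat \<Rightarrow> 'k::field preproj_elem) set"
  assumes K: "submodule K (op_ring (preproj n)) (proj_sum n m u)"
    and rad: "\<And>z i. z \<in> K \<Longrightarrow> i < m \<Longrightarrow> coord n (z i) (u i) 0 0 = 0"
  shows "superfluous (op_ring (preproj n)) (proj_sum n m u) K"
  unfolding superfluous_def
proof (intro conjI allI impI K)
  let ?R = "op_ring (preproj n) :: 'k preproj_elem ring"
  let ?P = "proj_sum n m u :: ('k preproj_elem, _) module"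
  interpret ring "preproj n :: 'k preproj_elem ring" by (rule ring_preproj)
  interpret P: left_module ?R ?P by (rule left_module_proj_sum)
  note D = proj_sum_memD[where n = n and m = m and u = u]
  note KD = P.submoduleD[OF K]
  fix U assume "submodule U ?R ?P \<and> U <+>\<^bsub>?P\<^esub> K = carrier ?P"
  then have U: "submodule U ?R ?P" and UK: "U <+>\<^bsub>?P\<^esub> K = carrier ?P" by auto
  note UD = P.submoduleD[OF U]
  \<comment> \<open>The induction goes from long monomials to short ones. As
    \<open>2 * n + 1\<close> exceeds the length of every monomial in the box, only
    \<open>z = 0\<close> qualifies at the start.\<close>
  have long: "z \<in> U" if "z \<in> carrier ?P" "\<And>i s a b. i < m \<Longrightarrow> coord n (z i) s a b \<noteq> 0 \<Longrightarrow> 2 * n + 1 - k \<le> a + b" for k z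
    using that
  proof (induction k arbitrary: z)
    case 0
    have "z i = \<zero>\<^bsub>preproj n\<^esub>" if i: "i < m" for i
    proof (rule preproj_eqI[of _ n])
      fix s a b assume "(s, a, b) \<in> box n"
      then have "\<not> 2 * n + 1 - 0 \<le> a + b" by (auto simp: box_def)
      then show "coord n (z i) s a b = coord n \<zero>\<^bsub>preproj n\<^esub> s a b"
        using 0(2)[OF i, of s a b] by (auto simp: coord_zero)
    qed (use D(1)[OF 0(1) i] in simp_all)
    then have "z = \<zero>\<^bsub>?P\<^esub>"
      using D(3)[OF 0(1)] by (intro proj_sum_eqI[where m = m]) (simp_all add: proj_sum_simps)
    then show ?case using UD(2) by simp
  next
    case (Suc k)
    \<comment> \<open>The generator of the \<open>i\<close>-th summand is \<open>x + y\<close> with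
      \<open>x\<close> in \<open>U\<close> and \<open>y\<close> in \<open>K\<close>. Under the
      action of \<open>z i\<close> the part coming from \<open>y\<close> gets longer monomials, so
      the induction hypothesis puts it into \<open>U\<close>.\<close>
    have single: "single_entry n m i (z i) \<in> U" if i: "i < m" for i
    proof -
      let ?E = "single_entry n m i (vertex_idem n (u i))"
      have a: "z i \<in> carrier (preproj n)" by (rule D(1)[OF Suc.prems(1) i])
      have "?E \<in> carrier ?P" by (rule single_entry_mem[OF vertex_idem_carrier vertex_idem_idem])
      then have "?E \<in> U <+>\<^bsub>?P\<^esub> K" using UK by simp
      then obtain x y where xy: "x \<in> U" "y \<in> K" "?E = x \<oplus>\<^bsub>?P\<^esub> y"
        by (auto simp: set_add_def')
      have yP: "y \<in> carrier ?P" by (rule KD(1)[OF xy(2)])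
      have y: "z i \<odot>\<^bsub>?P\<^esub> y \<in> carrier ?P" using P.smult_closed a yP by simp
      have "z i \<odot>\<^bsub>?P\<^esub> y \<in> U"
      proof (rule Suc.IH[OF y])
        fix j s p q assume j: "j < m" and nz: "coord n ((z i \<odot>\<^bsub>?P\<^esub> y) j) s p q \<noteq> 0"
        have spq: "(s, p, q) \<in> box n" using nz coord_outside by blast
        have yj: "y j \<in> carrier (preproj n)" by (rule D(1)[OF yP j])
        have "coord n (y j \<otimes>\<^bsub>preproj n\<^esub> z i) s p q \<noteq> 0" using nz j by (simp add: proj_sum_simps)
        then obtain p' q' where pq: "p' \<le> p" "q' \<le> q"
          "coord n (y j) (s + p' - q') (p - p') (q - q') \<noteq> 0" "coord n (z i) s p' q' \<noteq> 0"
          using coord_mult_nonzero[OF yj a] by blast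
        have "2 * n + 1 - Suc k \<le> p' + q'" by (rule Suc.prems(2)[OF i pq(4)])
        \<comment> \<open>A factor of length 0 from \<open>y j\<close> can only be the idempotent at
          \<open>u j\<close>, whose coefficient is zero by \<open>rad\<close>.\<close>
        moreover have "p - p' \<noteq> 0 \<or> q - q' \<noteq> 0"
        proof (rule ccontr)
          assume "\<not> ?thesis"
          then have 0: "p - p' = 0" "q - q' = 0" by auto
          have "s + p' - q' + (p - p') = u j + (q - q')"
            using D(2)[OF yP j] pq(3) unfolding vertex_idem_mult_iff[OF yj] by blast
          then have "coord n (y j) (u j) 0 0 \<noteq> 0" using pq(3) 0 by simp
          then show False using rad[OF xy(2) j] by simp
        qed
        ultimately show "2 * n + 1 - k \<le> p + q" using pq(1,2) by linarith
      qed
      moreover have "z i \<odot>\<^bsub>?P\<^esub> x \<in> U" using UD(4)[of "z i" x] a xy(1) by simp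
      ultimately have "z i \<odot>\<^bsub>?P\<^esub> x \<oplus>\<^bsub>?P\<^esub> z i \<odot>\<^bsub>?P\<^esub> y \<in> U" by (rule UD(3)[rotated])
      also have "z i \<odot>\<^bsub>?P\<^esub> x \<oplus>\<^bsub>?P\<^esub> z i \<odot>\<^bsub>?P\<^esub> y = z i \<odot>\<^bsub>?P\<^esub> ?E"
        unfolding xy(3) using P.smult_r_distr[of "z i" x y] a UD(1)[OF xy(1)] yP by simp
      also have "\<dots> = single_entry n m i (z i)"
        unfolding single_entry_smult[OF vertex_idem_carrier a] D(2)[OF Suc.prems(1) i] ..
      finally show ?thesis .
    qed
    have "k' \<le> m \<Longrightarrow> truncate n m k' z \<in> U" for k'
    proof (induction k')
      case 0
      then show ?case using UD(2) truncate_steps(1)[OF Suc.prems(1)] by simp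
    next
      case (Suc k')
      then show ?case using truncate_steps(3)[OF \<open>z \<in> carrier ?P\<close>, of k'] UD(3) single by simp
    qed
    from this[of m] show ?case using truncate_steps(2)[OF Suc.prems(1)] by simp
  qed
  have "z \<in> U" if "z \<in> carrier ?P" for z
    by (rule long[OF that, of "2 * n + 1"]) simp
  then show "U = carrier ?P" using UD(1) by blast
qed

subsection \<open>Duals\<close>

definition coordinate :: "nat \<Rightarrow> nat \<Rightarrow> (nat \<Rightarrow> nat) \<Rightarrow> nat \<Rightarrow> (nat \<Rightarrow> 'k::field preproj_elem) \<Rightarrow> 'k preproj_elem" where
  "coordinate n m u i = (\<lambda>z\<in>carrier (proj_sum n m u). z i)"

lemma coordinate_mem:
  assumes "i < m"
  shows "coordinate n m u i \<in> carrier (ring_dual (op_ring (preproj n)) (proj_sum n m u :: ('k::field preproj_elem, _) module))"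
proof -
  interpret P: left_module "op_ring (preproj n)" "proj_sum n m u :: ('k preproj_elem, _) module"
    by (rule left_module_proj_sum)
  note add = P.M.a_closed and smult = P.smult_closed
  show ?thesis
  proof (rule ring_dualI)
    fix z z' :: "nat \<Rightarrow> 'k preproj_elem" and a :: "'k preproj_elem"
    assume z: "z \<in> carrier (proj_sum n m u)"
    show "coordinate n m u i z \<in> carrier (op_ring (preproj n))"
      using z proj_sum_memD(1)[OF z assms] by (simp add: coordinate_def)
    show "coordinate n m u i (z \<oplus>\<^bsub>proj_sum n m u\<^esub> z') =
        coordinate n m u i z \<oplus>\<^bsub>op_ring (preproj n)\<^esub> coordinate n m u i z'"
      if z': "z' \<in> carrier (proj_sum n m u)"
      using z z' add[OF z z'] assms by (simp add: coordinate_def) (simp add: proj_sum_simps)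
    show "coordinate n m u i (a \<odot>\<^bsub>proj_sum n m u\<^esub> z) = a \<otimes>\<^bsub>op_ring (preproj n)\<^esub> coordinate n m u i z"
      if "a \<in> carrier (op_ring (preproj n))"
      using z smult[OF that z] assms by (simp add: coordinate_def) (simp add: proj_sum_simps)
  qed (simp add: coordinate_def)
qed

text \<open>\<open>f\<close> is the sum of the coordinate functionals multiplied by the values of
  \<open>f\<close> on the generators of the summands. The form of an induction rule suits its use,
  which is to show that a homomorphism vanishes on the whole dual.\<close>

lemma dual_generated_by_coordinates:
  fixes u :: "nat \<Rightarrow> nat" and n m :: nat
  defines "P \<equiv> proj_sum n m u :: ('k::field preproj_elem, _) module"
  defines "D \<equiv> ring_dual (op_ring (preproj n)) P"
  assumes f: "f \<in> carrier D"
    and Q_zero: "Q \<zero>\<^bsub>D\<^esub>"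
    and Q_add: "\<And>g h. g \<in> carrier D \<Longrightarrow> h \<in> carrier D \<Longrightarrow> Q g \<Longrightarrow> Q h \<Longrightarrow> Q (g \<oplus>\<^bsub>D\<^esub> h)"
    and Q_smult: "\<And>a i. a \<in> carrier (preproj n) \<Longrightarrow> i < m \<Longrightarrow> Q (a \<odot>\<^bsub>D\<^esub> coordinate n m u i)"
  shows "Q f"
proof -
  let ?R = "op_ring (preproj n) :: 'k preproj_elem ring"
  interpret ring "preproj n :: 'k preproj_elem ring" by (rule ring_preproj)
  have P: "left_module ?R P" unfolding P_def by (rule left_module_proj_sum)
  interpret P: left_module ?R P by (rule P)
  have "left_module (preproj n) D" unfolding D_def using left_module_ring_dual[OF P] by simp
  then interpret D: left_module "preproj n" D .
  note fD = ring_dualD[OF f[unfolded D_def]]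
  define E where "E = (\<lambda>k. single_entry n m k (vertex_idem n (u k)) :: nat \<Rightarrow> 'k preproj_elem)"
  have E: "E k \<in> carrier P" for k
    unfolding E_def P_def by (rule single_entry_mem[OF vertex_idem_carrier vertex_idem_idem])
  have fE: "f (E k) \<in> carrier (preproj n)" for k using fD(1)[OF E] by simp
  \<comment> \<open>These functionals lead from 0 at \<open>k = 0\<close> to \<open>f\<close> at
    \<open>k = m\<close>, each step adding one multiple of a coordinate functional.\<close>
  define g where "g = (\<lambda>k. \<lambda>z\<in>carrier P. f (truncate n m k z))"
  have f0: "f \<zero>\<^bsub>P\<^esub> = \<zero>\<^bsub>preproj n\<^esub>"
  proof -
    have "f \<zero>\<^bsub>P\<^esub> \<oplus>\<^bsub>preproj n\<^esub> f \<zero>\<^bsub>P\<^esub> = f \<zero>\<^bsub>P\<^esub>"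
      using fD(2)[OF P.M.zero_closed P.M.zero_closed] by simp
    then show ?thesis using fD(1)[OF P.M.zero_closed] add.r_cancel_one by simp
  qed
  have g0: "g 0 = \<zero>\<^bsub>D\<^esub>"
    unfolding g_def D_def ring_dual_simps
    by (rule restrict_ext) (simp add: P_def truncate_steps(1)[where u = u] f0[unfolded P_def])
  have gS: "g (Suc k) = g k \<oplus>\<^bsub>D\<^esub> f (E k) \<odot>\<^bsub>D\<^esub> coordinate n m u k" if k: "k < m" for k
  proof (rule extensionalityI[where A = "carrier P"])
    show "g (Suc k) \<in> extensional (carrier P)" by (simp add: g_def)
    show "g k \<oplus>\<^bsub>D\<^esub> f (E k) \<odot>\<^bsub>D\<^esub> coordinate n m u k \<in> extensional (carrier P)"
      unfolding D_def by (rule ring_dual_extensional)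
    fix z assume z: "z \<in> carrier P"
    have zk: "z k \<in> carrier (preproj n)" "vertex_idem n (u k) \<otimes>\<^bsub>preproj n\<^esub> z k = z k"
      using proj_sum_memD(1,2)[OF z[unfolded P_def] k] by auto
    have s: "z k \<odot>\<^bsub>P\<^esub> E k = single_entry n m k (z k)"
      unfolding E_def P_def single_entry_smult[OF vertex_idem_carrier zk(1)] zk(2) ..
    have sP: "single_entry n m k (z k) \<in> carrier P" unfolding P_def by (rule single_entry_mem) (rule zk)+
    have tP: "truncate n m k z \<in> carrier P" using truncate_mem z unfolding P_def by blast
    have "f (truncate n m (Suc k) z) = f (truncate n m k z) \<oplus>\<^bsub>preproj n\<^esub> f (single_entry n m k (z k))"
      using truncate_steps(3)[OF z[unfolded P_def] k] fD(2)[OF tP sP] unfolding P_def by simp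
    also have "f (single_entry n m k (z k)) = f (E k) \<otimes>\<^bsub>preproj n\<^esub> z k"
      unfolding s[symmetric] using fD(3)[of "z k" "E k"] zk(1) E by simp
    finally show "g (Suc k) z = (g k \<oplus>\<^bsub>D\<^esub> f (E k) \<odot>\<^bsub>D\<^esub> coordinate n m u k) z"
      using z by (simp add: g_def D_def ring_dual_apply coordinate_def P_def)
  qed
  have "g k \<in> carrier D \<and> Q (g k)" if "k \<le> m" for k
    using that
  proof (induction k)
    case 0
    then show ?case using Q_zero by (simp add: g0)
  next
    case (Suc k)
    have c: "f (E k) \<odot>\<^bsub>D\<^esub> coordinate n m u k \<in> carrier D"
      using D.smult_closed[OF fE] coordinate_mem[of k m n u] Suc.prems unfolding D_def P_def by simp
    then show ?case using Suc D.M.a_closed Q_add Q_smult fE by (simp add: gS)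
  qed
  moreover have "g m = f"
  proof (rule extensionalityI[where A = "carrier P"])
    show "g m z = f z" if "z \<in> carrier P" for z
      using that truncate_steps(2)[OF that[unfolded P_def]] by (simp add: g_def)
  qed (use fD(4) in \<open>simp_all add: g_def\<close>)
  ultimately show ?thesis by auto
qed

text \<open>Instead of the module axioms for \<open>N\<close> only the behaviour of its zero is
  assumed, so that the lemma applies directly to the dual over \<open>k\<close>.\<close>

lemma submodule_hom_kernel:
  assumes "left_module R M" and f: "f \<in> left_hom R M N"
    and N: "\<zero>\<^bsub>N\<^esub> \<oplus>\<^bsub>N\<^esub> \<zero>\<^bsub>N\<^esub> = \<zero>\<^bsub>N\<^esub>" "\<And>a. a \<in> carrier R \<Longrightarrow> a \<odot>\<^bsub>N\<^esub> \<zero>\<^bsub>N\<^esub> = \<zero>\<^bsub>N\<^esub>" "f \<zero>\<^bsub>M\<^esub> = \<zero>\<^bsub>N\<^esub>"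
  shows "submodule (hom_kernel M N f) R M"
proof -
  interpret left_module R M by fact
  have "f (x \<oplus>\<^bsub>M\<^esub> y) = f x \<oplus>\<^bsub>N\<^esub> f y" if "x \<in> carrier M" "y \<in> carrier M" for x y
    using f that by (auto simp: left_hom_def)
  moreover have "f (a \<odot>\<^bsub>M\<^esub> x) = a \<odot>\<^bsub>N\<^esub> f x" if "a \<in> carrier R" "x \<in> carrier M" for a x
    using f that by (auto simp: left_hom_def)
  ultimately show ?thesis
    using N by (intro submoduleI) (auto simp: hom_kernel_def smult_closed)
qed

lemma submodule_dual_image:
  fixes R :: "'a ring"
  assumes P: "left_module R P" and Q: "left_module R Q" and d: "d \<in> left_hom R P Q"
  shows "submodule ((\<lambda>f. compose (carrier P) f d) ` carrier (ring_dual R Q)) (op_ring R) (ring_dual R P)"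
proof -
  interpret P: left_module R P by (rule P)
  interpret Q: left_module R Q by (rule Q)
  interpret DP: left_module "op_ring R" "ring_dual R P" by (rule left_module_ring_dual[OF P])
  interpret DQ: left_module "op_ring R" "ring_dual R Q" by (rule left_module_ring_dual[OF Q])
  have dc: "d x \<in> carrier Q" if "x \<in> carrier P" for x
    using d that by (auto simp: left_hom_def)
  have dadd: "d (x \<oplus>\<^bsub>P\<^esub> y) = d x \<oplus>\<^bsub>Q\<^esub> d y" if "x \<in> carrier P" "y \<in> carrier P" for x y
    using d that by (auto simp: left_hom_def)
  have dsm: "d (a \<odot>\<^bsub>P\<^esub> x) = a \<odot>\<^bsub>Q\<^esub> d x" if "a \<in> carrier R" "x \<in> carrier P" for a x
    using d that by (auto simp: left_hom_def)
  note ext = extensionalityI[where A = "carrier P"]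
  show ?thesis
  proof (rule DP.submoduleI)
    show "(\<lambda>f. compose (carrier P) f d) ` carrier (ring_dual R Q) \<subseteq> carrier (ring_dual R P)"
    proof (rule image_subsetI)
      fix f assume "f \<in> carrier (ring_dual R Q)"
      note f = ring_dualD[OF this]
      show "compose (carrier P) f d \<in> carrier (ring_dual R P)"
        by (rule ring_dualI)
           (use f dc dadd dsm P.smult_closed in \<open>simp_all add: compose_def\<close>)
    qed
    have "compose (carrier P) \<zero>\<^bsub>ring_dual R Q\<^esub> d = \<zero>\<^bsub>ring_dual R P\<^esub>"
      using dc by (intro ext ring_dual_extensional) (simp_all add: compose_def ring_dual_apply)
    then show "\<zero>\<^bsub>ring_dual R P\<^esub> \<in> (\<lambda>f. compose (carrier P) f d) ` carrier (ring_dual R Q)"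
      using DQ.M.zero_closed by (metis image_eqI)
  next
    fix f g
    assume "f \<in> (\<lambda>f. compose (carrier P) f d) ` carrier (ring_dual R Q)"
      "g \<in> (\<lambda>f. compose (carrier P) f d) ` carrier (ring_dual R Q)"
    then obtain f' g' where f': "f' \<in> carrier (ring_dual R Q)" "f = compose (carrier P) f' d"
      and g': "g' \<in> carrier (ring_dual R Q)" "g = compose (carrier P) g' d" by blast
    have "f \<oplus>\<^bsub>ring_dual R P\<^esub> g = compose (carrier P) (f' \<oplus>\<^bsub>ring_dual R Q\<^esub> g') d"
      using dc by (intro ext ring_dual_extensional) (simp_all add: compose_def ring_dual_apply f' g')
    then show "f \<oplus>\<^bsub>ring_dual R P\<^esub> g \<in> (\<lambda>f. compose (carrier P) f d) ` carrier (ring_dual R Q)"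
      using DQ.M.a_closed[OF f'(1) g'(1)] by blast
  next
    fix a f assume a: "a \<in> carrier (op_ring R)" and "f \<in> (\<lambda>f. compose (carrier P) f d) ` carrier (ring_dual R Q)"
    then obtain f' where f': "f' \<in> carrier (ring_dual R Q)" "f = compose (carrier P) f' d" by blast
    have "a \<odot>\<^bsub>ring_dual R P\<^esub> f = compose (carrier P) (a \<odot>\<^bsub>ring_dual R Q\<^esub> f') d"
      using dc by (intro ext ring_dual_extensional) (simp_all add: compose_def ring_dual_apply f')
    then show "a \<odot>\<^bsub>ring_dual R P\<^esub> f \<in> (\<lambda>f. compose (carrier P) f d) ` carrier (ring_dual R Q)"
      using DQ.smult_closed[OF a f'(1)] by blast
  qed
qed


section \<open>Rigidity\<close>

text \<open>Rows of equal length form blocks: block \<open>j\<close> has the rows from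
  \<open>row j\<close> to \<open>row (Suc j) - 1\<close> and the width \<open>col j\<close>. The
  value 0 of \<open>col\<close> at \<open>Suc q\<close> closes the boundary. The induction adds one
  row at the bottom.\<close>

lemma staircase_exists:
  fixes len :: "nat \<Rightarrow> nat"
  assumes anti: "\<And>a. len (Suc a) \<le> len a" and "0 < len N"
  shows "\<exists>q row col. row 0 = 0 \<and> col (Suc q) = 0 \<and> row (Suc q) = Suc N \<and> col q = len N \<and>
    (\<forall>j\<le>q. row j < row (Suc j) \<and> col (Suc j) < col j) \<and>
    (\<forall>a b. a \<le> N \<longrightarrow> (b < len a \<longleftrightarrow> (\<exists>j\<le>q. a < row (Suc j) \<and> b < col j)))"
  using assms(2)
proof (induction N)
  case 0
  show ?case
    by (rule exI[of _ 0], rule exI[of _ "\<lambda>i. i"], rule exI[of _ "\<lambda>i. if i = 0 then len 0 else 0"])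
       (use 0 in auto)
next
  case (Suc N)
  have "0 < len N" using Suc.prems anti[of N] by linarith
  from Suc.IH[OF this] obtain q row col where q: "row 0 = (0::nat)" "col (Suc q) = (0::nat)" "row (Suc q) = Suc N"
    "col q = len N" "\<And>j. j \<le> q \<Longrightarrow> row j < row (Suc j)" "\<And>j. j \<le> q \<Longrightarrow> col (Suc j) < col j"
    and Y: "\<And>a b. a \<le> N \<Longrightarrow> b < len a \<longleftrightarrow> (\<exists>j\<le>q. a < row (Suc j) \<and> b < col j)"
    by blast
  have row_le: "row j \<le> Suc N" if "j \<le> Suc q" for j
    using that
  proof (induction j rule: inc_induct)
    case (step j)
    then show ?case using q(5)[of j] by simp
  qed (simp add: q(3))
  show ?case
  proof (cases "len (Suc N) = len N")
    case True
    \<comment> \<open>A row as long as the previous one only prolongs the last block.\<close>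
    define row' where "row' = row(Suc q := Suc (Suc N))"
    have r: "row' j = row j" if "j \<le> q" for j using that by (simp add: row'_def)
    have rS: "row' (Suc j) = (if j = q then Suc (Suc N) else row (Suc j))" if "j \<le> q" for j
      using that by (simp add: row'_def)
    have step: "row' j < row' (Suc j)" if "j \<le> q" for j
      using q(5)[OF that] r[OF that] rS[OF that] row_le[of j] that by auto
    have iff: "b < len a \<longleftrightarrow> (\<exists>j\<le>q. a < row' (Suc j) \<and> b < col j)" if a: "a \<le> Suc N" for a b
    proof (cases "a \<le> N")
      case True
      have "a < row' (Suc j) \<longleftrightarrow> a < row (Suc j)" if "j \<le> q" for j
        using rS[OF that] True q(3) by auto
      then show ?thesis unfolding Y[OF True] by blast
    next
      case False
      then have aN: "a = Suc N" using a by simp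
      have "a < row' (Suc j) \<longleftrightarrow> j = q" if "j \<le> q" for j
        using rS[OF that] row_le[of "Suc j"] that by (auto simp: aN)
      then show ?thesis using \<open>len (Suc N) = len N\<close> q(4) aN by auto
    qed
    show ?thesis
      using q r[of 0] step iff True
      by (intro exI[of _ q] exI[of _ row'] exI[of _ col]) (simp add: row'_def)
  next
    case False
    then have less: "len (Suc N) < len N" using anti[of N] by simp
    \<comment> \<open>A shorter row opens a new block, and the closing value 0 of \<open>col\<close>
      moves one index further.\<close>
    define row' where "row' = row(Suc (Suc q) := Suc (Suc N))"
    define col' where "col' = col(Suc q := len (Suc N), Suc (Suc q) := 0)"
    have r: "row' j = row j" if "j \<le> Suc q" for j using that by (simp add: row'_def)
    have c: "col' j = col j" if "j \<le> q" for j using that by (simp add: col'_def)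
    have step: "row' j < row' (Suc j) \<and> col' (Suc j) < col' j" if "j \<le> Suc q" for j
    proof (cases "j = Suc q")
      case True
      then show ?thesis using q(3) Suc.prems by (simp add: row'_def col'_def)
    next
      case False
      then have j: "j \<le> q" using that by simp
      show ?thesis using q(5)[OF j] q(6)[OF j] r[of j] r[of "Suc j"] c[OF j] c[of "Suc j"] j less q(4)
        by (cases "j = q") (auto simp: col'_def)
    qed
    have iff: "b < len a \<longleftrightarrow> (\<exists>j\<le>Suc q. a < row' (Suc j) \<and> b < col' j)" if a: "a \<le> Suc N" for a b
    proof (cases "a \<le> N")
      case True
      have old: "a < row' (Suc j) \<and> b < col' j \<longleftrightarrow> a < row (Suc j) \<and> b < col j" if "j \<le> q" for j
        using r[of "Suc j"] c[of j] that by simp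
      have new: "a < row (Suc q) \<and> b < col q" if "b < col' (Suc q)"
        using that less q(3,4) True by (simp add: col'_def)
      show ?thesis unfolding Y[OF True]
      proof
        assume "\<exists>j\<le>q. a < row (Suc j) \<and> b < col j"
        then show "\<exists>j\<le>Suc q. a < row' (Suc j) \<and> b < col' j" using old le_SucI by blast
      next
        assume "\<exists>j\<le>Suc q. a < row' (Suc j) \<and> b < col' j"
        then obtain j where j: "j \<le> Suc q" "a < row' (Suc j)" "b < col' j" by blast
        show "\<exists>j\<le>q. a < row (Suc j) \<and> b < col j"
        proof (cases "j = Suc q")
          case True
          then show ?thesis using new j by blast
        next
          case False
          then have "j \<le> q" using j(1) by simp
          then show ?thesis using old[of j] j by blast
        qed
      qed
    next
      case False
      then have aN: "a = Suc N" using a by simp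
      have "a < row' (Suc j) \<longleftrightarrow> j = Suc q" if "j \<le> Suc q" for j
        using r[of "Suc j"] row_le[of "Suc j"] that by (cases "j = Suc q") (auto simp: aN row'_def)
      then show ?thesis using aN by (auto simp: col'_def)
    qed
    show ?thesis
      using q(1) r[of 0] step iff
      by (intro exI[of _ "Suc q"] exI[of _ row'] exI[of _ col']) (simp add: row'_def col'_def)
  qed
qed

lemma basis_elem_outside: "(s, a, b) \<notin> box n \<Longrightarrow> basis_elem n k s a b = \<zero>\<^bsub>preproj n\<^esub>"
proof -
  interpret ring "preproj n :: 'a preproj_elem ring" by (rule ring_preproj)
  show "(s, a, b) \<notin> box n \<Longrightarrow> basis_elem n k s a b = \<zero>\<^bsub>preproj n\<^esub>"
    by (rule preproj_eqI[of _ n]) (auto simp: basis_elem_carrier coord_basis_elem coord_zero)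
qed

section \<open>Actions on basis vectors, and linear functionals\<close>

context array_module
begin

lemma mu_basis_elem_smult:
  assumes "x \<in> carrier M" "(r, c) \<in> Y"
  shows "\<mu> (basis_elem n 1 v a b \<odot>\<^bsub>M\<^esub> x) r c =
    (if (v, a, b) \<in> box n \<and> a \<le> r \<and> b \<le> c \<and> l + (r - a) - (c - b) = v then \<mu> x (r - a) (c - b) else 0)"
proof (cases "(v, a, b) \<in> box n")
  case True
  from mu_array_vec_smult[OF True assms] show ?thesis using True
    by (simp only: array_vec_basis_elem[OF True] simp_thms)
next
  case False
  then show ?thesis using assms(1) by (simp add: basis_elem_outside smult_zero_left mu_zero)
qed

lemma mu_smult_vec:
  assumes x: "x \<in> carrier (preproj n)" and rc: "(r, c) \<in> Y" and rc': "(r', c') \<in> Y"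
  shows "\<mu> (x \<odot>\<^bsub>M\<^esub> vec (r, c)) r' c' =
    (if r \<le> r' \<and> c \<le> c' then coord n x (l + r - c) (r' - r) (c' - c) else 0)"
proof -
  let ?v = "if r \<le> r' \<and> c \<le> c' then coord n x (l + r - c) (r' - r) (c' - c) else 0"
  have "\<mu> (x \<odot>\<^bsub>M\<^esub> vec (r, c)) r' c' =
      (\<Sum>p\<le>r'. \<Sum>q\<le>c'. coord n x (l + p - q) (r' - p) (c' - q) * (if (p, q) = (r, c) then 1 else 0))"
    using mu_smult[OF x vec(1) rc', of "(r, c)"] by (simp only: mu_vec[OF rc])
  also have "\<dots> = (\<Sum>p\<le>r'. \<Sum>q\<le>c'. if q = c then if p = r then ?v else 0 else 0)"
    by (intro sum.cong refl) auto
  also have "\<dots> = (\<Sum>p\<le>r'. if p = r then if c \<le> c' then ?v else 0 else 0)"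
    by (intro sum.cong refl) (subst sum.delta, simp, simp)
  also have "\<dots> = ?v"
    by (subst sum.delta) simp_all
  finally show ?thesis .
qed

lemma k_dual_simps:
  "\<phi> \<in> carrier (k_dual (scalar_elem n) M) \<longleftrightarrow> \<phi> \<in> extensional (carrier M) \<and>
     (\<forall>x \<in> carrier M. \<forall>y \<in> carrier M. \<phi> (x \<oplus>\<^bsub>M\<^esub> y) = \<phi> x + \<phi> y) \<and>
     (\<forall>c. \<forall>x \<in> carrier M. \<phi> (scalar_elem n c \<odot>\<^bsub>M\<^esub> x) = c * \<phi> x)"
  "\<zero>\<^bsub>k_dual (scalar_elem n) M\<^esub> = (\<lambda>x\<in>carrier M. 0)"
  "\<phi> \<oplus>\<^bsub>k_dual (scalar_elem n) M\<^esub> \<psi> = (\<lambda>x\<in>carrier M. \<phi> x + \<psi> x)"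
  "a \<odot>\<^bsub>k_dual (scalar_elem n) M\<^esub> \<phi> = (\<lambda>x\<in>carrier M. \<phi> (a \<odot>\<^bsub>M\<^esub> x))"
  by (auto simp: k_dual_def)

lemma k_dual_eqI:
  assumes \<phi>: "\<phi> \<in> carrier (k_dual (scalar_elem n) M)" and \<psi>: "\<psi> \<in> carrier (k_dual (scalar_elem n) M)"
    and eq: "\<And>s. s \<in> Y \<Longrightarrow> \<phi> (vec s) = \<psi> (vec s)"
  shows "\<phi> = \<psi>"
proof (rule extensionalityI[where A = "carrier M"])
  show "\<phi> \<in> extensional (carrier M)" "\<psi> \<in> extensional (carrier M)"
    using \<phi> \<psi> unfolding k_dual_simps by blast+
  fix x assume x: "x \<in> carrier M"
  have add: "\<phi> (y \<oplus>\<^bsub>M\<^esub> z) = \<phi> y + \<phi> z" "\<psi> (y \<oplus>\<^bsub>M\<^esub> z) = \<psi> y + \<psi> z" if "y \<in> carrier M" "z \<in> carrier M" for y z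
    using \<phi> \<psi> that unfolding k_dual_simps by blast+
  have smult: "\<phi> (scalar_elem n k \<odot>\<^bsub>M\<^esub> y) = k * \<phi> y" "\<psi> (scalar_elem n k \<odot>\<^bsub>M\<^esub> y) = k * \<psi> y"
    if "y \<in> carrier M" for k y
    using \<phi> \<psi> that unfolding k_dual_simps by blast+
  show "\<phi> x = \<psi> x"
  proof (rule support_induct[where P = "\<lambda>x. \<phi> x = \<psi> x" and S = Y, OF order_refl x mu_outside])
    have z: "scalar_elem n 0 \<odot>\<^bsub>M\<^esub> \<zero>\<^bsub>M\<^esub> = \<zero>\<^bsub>M\<^esub>"
      by (rule smult_zero_right[OF scalar_elem_carrier])
    show "\<phi> \<zero>\<^bsub>M\<^esub> = \<psi> \<zero>\<^bsub>M\<^esub>"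
      using smult[OF M.zero_closed, of 0] unfolding z by simp
  qed (simp_all add: add smult vec(1) eq)
qed

end

text \<open>The points \<open>(row i, col i)\<close> with \<open>i \<le> p\<close> are the addable
  boxes, the first one in row 0 and the last one in column 0. Between two consecutive ones lies the
  corner \<open>(row (Suc j) - 1, col j - 1)\<close>, and \<open>Y\<close> is the union of the
  rectangles spanned by the corners.\<close>

locale staircase_module = array_module n M l Y \<mu>
  for n and M :: "('k::field preproj_elem, 'm) module" and l Y \<mu> +
  fixes p :: nat and row col :: "nat \<Rightarrow> nat"
  assumes p_pos: "0 < p" and row_0: "row 0 = 0" and col_p: "col p = 0"
    and row_step: "j < p \<Longrightarrow> row j < row (Suc j)" and col_step: "j < p \<Longrightarrow> col (Suc j) < col j"
    and mem_Y: "(a, b) \<in> Y \<longleftrightarrow> (\<exists>j<p. a < row (Suc j) \<and> b < col j)"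
begin

section \<open>A projective presentation of the dual of a staircase module\<close>

lemma row_mono: "i \<le> j \<Longrightarrow> j \<le> p \<Longrightarrow> row i \<le> row j"
proof (induction j rule: dec_induct)
  case (step j)
  then show ?case using row_step[of j] by simp
qed simp

lemma col_mono: "i \<le> j \<Longrightarrow> j \<le> p \<Longrightarrow> col j \<le> col i"
proof (induction j rule: dec_induct)
  case (step j)
  then show ?case using col_step[of j] by simp
qed simp

lemma corner:
  assumes "j < p"
  shows "0 < row (Suc j)" "0 < col j" "(row (Suc j) - 1, col j - 1) \<in> Y"
    "l + row (Suc j) \<le> n + 1" "col j \<le> l"
proof -
  show r: "0 < row (Suc j)" and c: "0 < col j" using row_step[OF assms] col_step[OF assms] by auto
  then show Y: "(row (Suc j) - 1, col j - 1) \<in> Y" unfolding mem_Y using assms by (intro exI[of _ j]) auto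
  show "l + row (Suc j) \<le> n + 1" "col j \<le> l" using in_box[OF Y] r c by (auto simp: box_def)
qed

lemma col_le: "i \<le> p \<Longrightarrow> col i \<le> l"
  using corner(5)[of i] col_p by (cases "i = p") auto

text \<open>The generators of \<open>D M\<close> are dual to the corners of the array; its relations sit at the addable
  boxes. Addable boxes outside of the array of \<open>P\<^sub>l\<close> have the vertex 0 or \<open>n + 1\<close>.\<close>

definition gen :: "nat \<Rightarrow> nat" where "gen j = l + row (Suc j) - col j"
definition rel :: "nat \<Rightarrow> nat" where "rel i = l + row i - col i"

abbreviation "Rop \<equiv> op_ring (preproj n) :: 'k preproj_elem ring"
abbreviation "P0 \<equiv> proj_sum n p gen :: ('k preproj_elem, nat \<Rightarrow> 'k preproj_elem) module"
abbreviation "P1 \<equiv> proj_sum n (Suc p) rel :: ('k preproj_elem, nat \<Rightarrow> 'k preproj_elem) module"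
abbreviation "DM \<equiv> k_dual (scalar_elem n) M"

text \<open>The straight pieces of the boundary: a power of y leads from the vertex of the addable
  box \<open>Suc j\<close> to that of the corner \<open>j\<close>, a power of x from the addable box
  \<open>j\<close> to the same corner. Such a path is zero if it starts at the vertex 0 or
  \<open>n + 1\<close>.\<close>

definition y_path :: "nat \<Rightarrow> 'k preproj_elem" where
  "y_path j = basis_elem n 1 (rel (Suc j)) 0 (col j - col (Suc j))"
definition x_path :: "nat \<Rightarrow> 'k preproj_elem" where
  "x_path j = basis_elem n 1 (rel j) (row (Suc j) - row j) 0"

text \<open>Entry \<open>t i\<close> occurs with \<open>y_path\<close> at the corner
  \<open>i - 1\<close> and, with the opposite sign, with \<open>x_path\<close> at the corner
  \<open>i\<close>. At the two ends only one of these corners exists, and the relation kills a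
  multiple of it.\<close>

definition diff :: "(nat \<Rightarrow> 'k preproj_elem) \<Rightarrow> nat \<Rightarrow> 'k preproj_elem" where
  "diff = (\<lambda>t\<in>carrier P1. \<lambda>j\<in>{..<p}.
     y_path j \<otimes>\<^bsub>preproj n\<^esub> t (Suc j) \<ominus>\<^bsub>preproj n\<^esub> x_path j \<otimes>\<^bsub>preproj n\<^esub> t j)"

text \<open>The \<open>j\<close>-th generator goes to the functional that reads the coefficient at
  the \<open>j\<close>-th corner, and \<open>z j\<close> acts on it through the argument.\<close>

definition aug :: "(nat \<Rightarrow> 'k preproj_elem) \<Rightarrow> 'm \<Rightarrow> 'k" where
  "aug = (\<lambda>z\<in>carrier P0. \<lambda>x\<in>carrier M. \<Sum>j<p. \<mu> (z j \<odot>\<^bsub>M\<^esub> x) (row (Suc j) - 1) (col j - 1))"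

lemma gen_rel:
  assumes "j < p"
  shows "1 \<le> gen j" "gen j \<le> n" "gen j + col j = l + row (Suc j)"
    "rel (Suc j) = gen j + (col j - col (Suc j))" "gen j = rel j + (row (Suc j) - row j)"
  using corner[OF assms] row_step[OF assms] col_step[OF assms] by (auto simp: gen_def rel_def)

lemma path_carrier: "y_path j \<in> carrier (preproj n)" "x_path j \<in> carrier (preproj n)"
  by (simp_all add: y_path_def x_path_def basis_elem_carrier)

lemma path_idem:
  assumes "j < p"
  shows "vertex_idem n (gen j) \<otimes>\<^bsub>preproj n\<^esub> y_path j = y_path j"
    "vertex_idem n (gen j) \<otimes>\<^bsub>preproj n\<^esub> x_path j = x_path j"
  unfolding y_path_def x_path_def
  by (rule vertex_idem_basis_elem; use gen_rel(4,5)[OF assms] in simp)+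

text \<open>That the start of \<open>y_path j\<close> is a genuine vertex need not be asked: it
  follows from \<open>(s, a, b)\<close> being in the box and ending at \<open>gen j\<close>, as soon
  as the shift fits into \<open>b\<close>.\<close>

lemma coord_y_path_mult:
  assumes j: "j < p" and x: "x \<in> carrier (preproj n)" and sab: "(s, a, b) \<in> box n" "s + a = gen j + b"
  shows "coord n (y_path j \<otimes>\<^bsub>preproj n\<^esub> x) s a b =
    (if col j - col (Suc j) \<le> b then coord n x s a (b - (col j - col (Suc j))) else 0)"
proof -
  have "(rel (Suc j), 0, col j - col (Suc j)) \<in> box n \<and>
      s + (a - 0) - (b - (col j - col (Suc j))) = rel (Suc j)" if "col j - col (Suc j) \<le> b"
    using that sab gen_rel[OF j] by (auto simp: box_def)
  then show ?thesis unfolding y_path_def coord_basis_elem_mult[OF x sab(1)] by simp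
qed

lemma coord_x_path_mult:
  assumes j: "j < p" and x: "x \<in> carrier (preproj n)" and sab: "(s, a, b) \<in> box n" "s + a = gen j + b"
  shows "coord n (x_path j \<otimes>\<^bsub>preproj n\<^esub> x) s a b =
    (if row (Suc j) - row j \<le> a then coord n x s (a - (row (Suc j) - row j)) b else 0)"
proof -
  have "(rel j, row (Suc j) - row j, 0) \<in> box n \<and>
      s + (a - (row (Suc j) - row j)) - (b - 0) = rel j" if "row (Suc j) - row j \<le> a"
    using that sab gen_rel[OF j] by (auto simp: box_def)
  then show ?thesis unfolding x_path_def coord_basis_elem_mult[OF x sab(1)] by simp
qed

lemma diff_hom: "diff \<in> left_hom Rop P1 P0"
proof -
  interpret ring "preproj n :: 'k preproj_elem ring" by (rule ring_preproj)
  interpret P1: left_module Rop P1 by (rule left_module_proj_sum)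
  note e = vertex_idem_carrier[where n = n] and pc = path_carrier
  have T: "t i \<in> carrier (preproj n)" if "t \<in> carrier P1" "i \<le> p" for t i
    using proj_sum_memD(1)[OF that(1), of i] that(2) by simp
  show ?thesis
    unfolding left_hom_def
  proof (intro CollectI conjI ballI)
    have "(\<lambda>j\<in>{..<p}. y_path j \<otimes>\<^bsub>preproj n\<^esub> t (Suc j) \<ominus>\<^bsub>preproj n\<^esub> x_path j \<otimes>\<^bsub>preproj n\<^esub> t j) \<in> carrier P0"
      if t: "t \<in> carrier P1" for t
    proof (rule proj_sum_memI)
      fix j assume j: "j < p"
      have tj: "t (Suc j) \<in> carrier (preproj n)" "t j \<in> carrier (preproj n)" using T[OF t] j by auto
      have "vertex_idem n (gen j) \<otimes>\<^bsub>preproj n\<^esub> (y_path j \<otimes>\<^bsub>preproj n\<^esub> t (Suc j) \<ominus>\<^bsub>preproj n\<^esub> x_path j \<otimes>\<^bsub>preproj n\<^esub> t j)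
        = (vertex_idem n (gen j) \<otimes>\<^bsub>preproj n\<^esub> y_path j) \<otimes>\<^bsub>preproj n\<^esub> t (Suc j)
          \<ominus>\<^bsub>preproj n\<^esub> (vertex_idem n (gen j) \<otimes>\<^bsub>preproj n\<^esub> x_path j) \<otimes>\<^bsub>preproj n\<^esub> t j"
        using tj by (simp add: a_minus_def r_distr r_minus m_assoc e pc)
      then show "vertex_idem n (gen j) \<otimes>\<^bsub>preproj n\<^esub>
          (\<lambda>j\<in>{..<p}. y_path j \<otimes>\<^bsub>preproj n\<^esub> t (Suc j) \<ominus>\<^bsub>preproj n\<^esub> x_path j \<otimes>\<^bsub>preproj n\<^esub> t j) j =
          (\<lambda>j\<in>{..<p}. y_path j \<otimes>\<^bsub>preproj n\<^esub> t (Suc j) \<ominus>\<^bsub>preproj n\<^esub> x_path j \<otimes>\<^bsub>preproj n\<^esub> t j) j"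
        using j by (simp add: path_idem[OF j])
      show "(\<lambda>j\<in>{..<p}. y_path j \<otimes>\<^bsub>preproj n\<^esub> t (Suc j) \<ominus>\<^bsub>preproj n\<^esub> x_path j \<otimes>\<^bsub>preproj n\<^esub> t j) j \<in> carrier (preproj n)"
        using j tj by (simp add: pc)
    qed simp
    then show "diff \<in> carrier P1 \<rightarrow>\<^sub>E carrier P0" by (simp add: diff_def)
    fix t assume t: "t \<in> carrier P1"
    show "diff (t \<oplus>\<^bsub>P1\<^esub> t') = diff t \<oplus>\<^bsub>P0\<^esub> diff t'" if t': "t' \<in> carrier P1" for t'
    proof -
      have "y_path j \<otimes>\<^bsub>preproj n\<^esub> (t (Suc j) \<oplus>\<^bsub>preproj n\<^esub> t' (Suc j)) \<ominus>\<^bsub>preproj n\<^esub> x_path j \<otimes>\<^bsub>preproj n\<^esub> (t j \<oplus>\<^bsub>preproj n\<^esub> t' j)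
        = (y_path j \<otimes>\<^bsub>preproj n\<^esub> t (Suc j) \<ominus>\<^bsub>preproj n\<^esub> x_path j \<otimes>\<^bsub>preproj n\<^esub> t j) \<oplus>\<^bsub>preproj n\<^esub>
          (y_path j \<otimes>\<^bsub>preproj n\<^esub> t' (Suc j) \<ominus>\<^bsub>preproj n\<^esub> x_path j \<otimes>\<^bsub>preproj n\<^esub> t' j)" if j: "j < p" for j
      proof -
        have "t (Suc j) \<in> carrier (preproj n)" "t j \<in> carrier (preproj n)"
          "t' (Suc j) \<in> carrier (preproj n)" "t' j \<in> carrier (preproj n)"
          using T[OF t] T[OF t'] j by auto
        then show ?thesis by (simp add: a_minus_def R.r_distr R.minus_add R.a_ac pc)
      qed
      then show ?thesis
        using t t' P1.M.a_closed[OF t t']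
        by (simp add: diff_def) (auto simp: proj_sum_simps intro!: restrict_ext)
    qed
    fix a assume "a \<in> carrier Rop"
    then have a: "a \<in> carrier (preproj n)" by simp
    have "y_path j \<otimes>\<^bsub>preproj n\<^esub> (t (Suc j) \<otimes>\<^bsub>preproj n\<^esub> a) \<ominus>\<^bsub>preproj n\<^esub> x_path j \<otimes>\<^bsub>preproj n\<^esub> (t j \<otimes>\<^bsub>preproj n\<^esub> a)
      = (y_path j \<otimes>\<^bsub>preproj n\<^esub> t (Suc j) \<ominus>\<^bsub>preproj n\<^esub> x_path j \<otimes>\<^bsub>preproj n\<^esub> t j) \<otimes>\<^bsub>preproj n\<^esub> a" if j: "j < p" for j
    proof -
      have "t (Suc j) \<in> carrier (preproj n)" "t j \<in> carrier (preproj n)"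
        using T[OF t] j by auto
      then show ?thesis using a by (simp add: a_minus_def l_distr l_minus m_assoc pc)
    qed
    then show "diff (a \<odot>\<^bsub>P1\<^esub> t) = a \<odot>\<^bsub>P0\<^esub> diff t"
      using t a P1.smult_closed[of a t]
      by (simp add: diff_def) (auto simp: proj_sum_simps intro!: restrict_ext)
  qed
qed

lemma aug_apply:
  "z \<in> carrier P0 \<Longrightarrow> x \<in> carrier M \<Longrightarrow> aug z x = (\<Sum>j<p. \<mu> (z j \<odot>\<^bsub>M\<^esub> x) (row (Suc j) - 1) (col j - 1))"
  by (simp add: aug_def)

text \<open>The convolution is linear in the coefficients of the vector, so scalars can be pulled
  out past \<open>a\<close>.\<close>

lemma mu_smult_scalar:
  assumes a: "a \<in> carrier (preproj n)" and x: "x \<in> carrier M"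
  shows "\<mu> (a \<odot>\<^bsub>M\<^esub> (scalar_elem n k \<odot>\<^bsub>M\<^esub> x)) r c = k * \<mu> (a \<odot>\<^bsub>M\<^esub> x) r c"
proof (cases "(r, c) \<in> Y")
  case True
  show ?thesis
    unfolding mu_smult[OF a smult_closed[OF scalar_elem_carrier x] True] mu_smult[OF a x True] mu_scalar[OF x]
    by (simp add: sum_distrib_left mult.left_commute)
qed (simp add: mu_outside)

lemma aug_hom: "aug \<in> left_hom Rop P0 DM"
proof -
  interpret P0: left_module Rop P0 by (rule left_module_proj_sum)
  have Z: "z j \<in> carrier (preproj n)" if "z \<in> carrier P0" "j < p" for z j
    using proj_sum_memD(1)[OF that] .
  show ?thesis
    unfolding left_hom_def
  proof (intro CollectI conjI ballI)
    have "aug z \<in> carrier DM" if z: "z \<in> carrier P0" for z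
      unfolding k_dual_simps
    proof (intro conjI ballI allI)
      show "aug z \<in> extensional (carrier M)" using z by (simp add: aug_def)
      show "aug z (x \<oplus>\<^bsub>M\<^esub> y) = aug z x + aug z y" if "x \<in> carrier M" "y \<in> carrier M" for x y
        unfolding aug_apply[OF z that(1)] aug_apply[OF z that(2)] aug_apply[OF z M.a_closed[OF that]] sum.distrib[symmetric]
        by (intro sum.cong refl) (use that Z[OF z] in \<open>simp add: smult_r_distr mu_add smult_closed\<close>)
      show "aug z (scalar_elem n k \<odot>\<^bsub>M\<^esub> x) = k * aug z x" if "x \<in> carrier M" for k x
        unfolding aug_apply[OF z that] aug_apply[OF z smult_closed[OF scalar_elem_carrier that]] sum_distrib_left
        by (intro sum.cong refl) (use that Z[OF z] in \<open>simp add: mu_smult_scalar\<close>)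
    qed
    then show "aug \<in> carrier P0 \<rightarrow>\<^sub>E carrier DM" by (auto simp: aug_def PiE_def)
    fix z assume z: "z \<in> carrier P0"
    show "aug (z \<oplus>\<^bsub>P0\<^esub> z') = aug z \<oplus>\<^bsub>DM\<^esub> aug z'" if z': "z' \<in> carrier P0" for z'
    proof (rule extensionalityI[where A = "carrier M"])
      fix x assume x: "x \<in> carrier M"
      have "aug (z \<oplus>\<^bsub>P0\<^esub> z') x = aug z x + aug z' x"
        unfolding aug_apply[OF z x] aug_apply[OF z' x] aug_apply[OF P0.M.a_closed[OF z z'] x] sum.distrib[symmetric]
        by (intro sum.cong refl)
           (use x Z[OF z] Z[OF z'] in \<open>simp add: proj_sum_simps smult_l_distr mu_add smult_closed\<close>)
      then show "aug (z \<oplus>\<^bsub>P0\<^esub> z') x = (aug z \<oplus>\<^bsub>DM\<^esub> aug z') x" using x by (simp add: k_dual_simps)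
    qed (use P0.M.a_closed[OF z z'] in \<open>simp_all add: k_dual_simps aug_def\<close>)
    fix a assume a: "a \<in> carrier Rop"
    show "aug (a \<odot>\<^bsub>P0\<^esub> z) = a \<odot>\<^bsub>DM\<^esub> aug z"
    proof (rule extensionalityI[where A = "carrier M"])
      fix x assume x: "x \<in> carrier M"
      have ax: "a \<odot>\<^bsub>M\<^esub> x \<in> carrier M" using a x smult_closed by simp
      have "aug (a \<odot>\<^bsub>P0\<^esub> z) x = aug z (a \<odot>\<^bsub>M\<^esub> x)"
        unfolding aug_apply[OF z ax] aug_apply[OF P0.smult_closed[OF a z] x]
        by (intro sum.cong refl) (use x a Z[OF z] in \<open>simp add: proj_sum_simps smult_assoc1\<close>)
      then show "aug (a \<odot>\<^bsub>P0\<^esub> z) x = (a \<odot>\<^bsub>DM\<^esub> aug z) x" using x by (simp add: k_dual_simps)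
    qed (use P0.smult_closed[OF a z] in \<open>simp_all add: k_dual_simps aug_def\<close>)
  qed
qed

section \<open>Exactness and minimality of the presentation\<close>

lemma aug_vec:
  assumes z: "z \<in> carrier P0" and rc: "(r, c) \<in> Y"
  shows "aug z (vec (r, c)) = (\<Sum>j<p. if r < row (Suc j) \<and> c < col j
    then coord n (z j) (l + r - c) (row (Suc j) - 1 - r) (col j - 1 - c) else 0)"
  unfolding aug_apply[OF z vec(1)]
proof (intro sum.cong refl)
  fix j assume "j \<in> {..<p}"
  then have j: "j < p" by simp
  have "r \<le> row (Suc j) - 1 \<longleftrightarrow> r < row (Suc j)" "c \<le> col j - 1 \<longleftrightarrow> c < col j"
    using corner(1,2)[OF j] by auto
  then show "\<mu> (z j \<odot>\<^bsub>M\<^esub> vec (r, c)) (row (Suc j) - 1) (col j - 1) = (if r < row (Suc j) \<and> c < col j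
    then coord n (z j) (l + r - c) (row (Suc j) - 1 - r) (col j - 1 - c) else 0)"
    unfolding mu_smult_vec[OF proj_sum_memD(1)[OF z j] rc corner(3)[OF j]] by simp
qed

text \<open>Each position of \<open>Y\<close> lies in the rectangle of some corner, so the basis
  functional there is a multiple of the functional of this corner.\<close>

lemma aug_surj: "aug ` carrier P0 = carrier DM"
proof
  show "aug ` carrier P0 \<subseteq> carrier DM" using aug_hom by (auto simp: left_hom_def)
  show "carrier DM \<subseteq> aug ` carrier P0"
  proof
    fix \<phi> assume \<phi>: "\<phi> \<in> carrier DM"
    \<comment> \<open>A position may belong to several rectangles; choosing one corner for it makes
      its value enter the sum once.\<close>
    define J where "J r c = (LEAST j. j < p \<and> r < row (Suc j) \<and> c < col j)" for r c
    \<comment> \<open>The counts \<open>(a, b)\<close> are measured back from the corner: they lead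
      from the position \<open>(row (Suc j) - 1 - a, col j - 1 - b)\<close> to the corner
      \<open>j\<close>.\<close>
    define F where "F j s a b = (if a < row (Suc j) \<and> b < col j \<and> s + a = gen j + b \<and>
        J (row (Suc j) - 1 - a) (col j - 1 - b) = j
      then \<phi> (vec (row (Suc j) - 1 - a, col j - 1 - b)) else 0)" for j s a b
    define z :: "nat \<Rightarrow> 'k preproj_elem" where "z = (\<lambda>j\<in>{..<p}. of_coord n (F j))"
    have z: "z \<in> carrier P0"
    proof (rule proj_sum_memI)
      fix j assume j: "j < p"
      show "z j \<in> carrier (preproj n)" using j by (simp add: z_def of_coord_carrier)
      show "vertex_idem n (gen j) \<otimes>\<^bsub>preproj n\<^esub> z j = z j"
        using j vertex_idem_mult_iff[OF of_coord_carrier, of n "gen j" "F j"]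
        by (auto simp: z_def coord_of_coord F_def)
    qed (simp add: z_def)
    have "aug z = \<phi>"
    proof (rule k_dual_eqI[OF _ \<phi>])
      show "aug z \<in> carrier DM" using aug_hom z by (auto simp: left_hom_def)
      fix s assume s: "s \<in> Y"
      obtain r c where rc: "s = (r, c)" "(r, c) \<in> Y" using s by (cases s) auto
      have J: "J r c < p \<and> r < row (Suc (J r c)) \<and> c < col (J r c)"
        using rc(2) unfolding mem_Y J_def by (rule LeastI_ex)
      have "aug z (vec (r, c)) = (\<Sum>j<p. if j = J r c then \<phi> (vec (r, c)) else 0)"
        unfolding aug_vec[OF z rc(2)]
      proof (intro sum.cong refl)
        fix j assume "j \<in> {..<p}"
        then have j: "j < p" by simp
        show "(if r < row (Suc j) \<and> c < col j
            then coord n (z j) (l + r - c) (row (Suc j) - 1 - r) (col j - 1 - c) else 0) =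
          (if j = J r c then \<phi> (vec (r, c)) else 0)"
        proof (cases "r < row (Suc j) \<and> c < col j")
          case True
          have b: "(l + r - c, row (Suc j) - 1 - r, col j - 1 - c) \<in> box n"
            using in_box[OF rc(2)] corner[OF j] True by (auto simp: box_def)
          have e: "l + r - c + (row (Suc j) - 1 - r) = gen j + (col j - 1 - c)"
            using in_box[OF rc(2)] gen_rel(3)[OF j] True by (auto simp: box_def)
          have rr: "row (Suc j) - 1 - (row (Suc j) - 1 - r) = r" "col j - 1 - (col j - 1 - c) = c"
            "row (Suc j) - 1 - r < row (Suc j)" "col j - 1 - c < col j"
            using True by auto
          have "F j (l + r - c) (row (Suc j) - 1 - r) (col j - 1 - c) = (if J r c = j then \<phi> (vec (r, c)) else 0)"
            using rr(3,4) e by (simp only: F_def rr(1,2) simp_thms)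
          moreover have "coord n (z j) (l + r - c) (row (Suc j) - 1 - r) (col j - 1 - c) =
              F j (l + r - c) (row (Suc j) - 1 - r) (col j - 1 - c)"
            using b j by (simp add: z_def coord_of_coord)
          ultimately show ?thesis using True by auto
        next
          case False
          then show ?thesis using J by auto
        qed
      qed
      also have "\<dots> = \<phi> (vec (r, c))" using J by simp
      finally show "aug z (vec s) = \<phi> (vec s)" by (simp add: rc)
    qed
    then show "\<phi> \<in> aug ` carrier P0" using z by blast
  qed
qed

text \<open>Going along \<open>y_path\<close> or \<open>x_path\<close> to a corner shows the
  coefficient at the diagonal predecessor of the adjacent addable box. Each such coefficient is seen
  from two neighbouring corners with opposite signs, and the sum telescopes.\<close>

lemma aug_diff:
  assumes t: "t \<in> carrier P1"
  shows "aug (diff t) = \<zero>\<^bsub>DM\<^esub>"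
proof (rule extensionalityI[where A = "carrier M"])
  interpret ring "preproj n :: 'k preproj_elem ring" by (rule ring_preproj)
  have dt: "diff t \<in> carrier P0" using diff_hom t by (auto simp: left_hom_def)
  show "aug (diff t) \<in> extensional (carrier M)" using dt by (simp add: aug_def)
  show "\<zero>\<^bsub>DM\<^esub> \<in> extensional (carrier M)" by (simp add: k_dual_simps)
  fix x assume x: "x \<in> carrier M"
  \<comment> \<open>The value 0 for \<open>row i = 0\<close> or \<open>col i = 0\<close> represents
    a position with a negative index; it makes both ends of the telescoping sum vanish.\<close>
  define g where "g i = (if 0 < row i \<and> 0 < col i then \<mu> (t i \<odot>\<^bsub>M\<^esub> x) (row i - 1) (col i - 1) else 0)" for i
  have T: "t i \<in> carrier (preproj n)" if "i \<le> p" for i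
    using proj_sum_memD(1)[OF t, of i] that by simp
  have "\<mu> (diff t j \<odot>\<^bsub>M\<^esub> x) (row (Suc j) - 1) (col j - 1) = g (Suc j) - g j" if j: "j < p" for j
  proof -
    note k = corner[OF j]
    have tj: "t (Suc j) \<odot>\<^bsub>M\<^esub> x \<in> carrier M" "t j \<odot>\<^bsub>M\<^esub> x \<in> carrier M"
      using T[of "Suc j"] T[of j] j x smult_closed by auto
    have "diff t j \<odot>\<^bsub>M\<^esub> x = y_path j \<odot>\<^bsub>M\<^esub> (t (Suc j) \<odot>\<^bsub>M\<^esub> x) \<ominus>\<^bsub>M\<^esub> x_path j \<odot>\<^bsub>M\<^esub> (t j \<odot>\<^bsub>M\<^esub> x)"
    proof -
      have tc: "t (Suc j) \<in> carrier (preproj n)" "t j \<in> carrier (preproj n)" using T j by auto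
      have neg: "(\<ominus>\<^bsub>preproj n\<^esub> a) \<odot>\<^bsub>M\<^esub> x = \<ominus>\<^bsub>M\<^esub> (a \<odot>\<^bsub>M\<^esub> x)" if "a \<in> carrier (preproj n)" for a
        by (rule M.minus_equality[symmetric])
           (use that x in \<open>simp_all add: smult_l_distr[symmetric] smult_closed R.l_neg smult_zero_left\<close>)
      show ?thesis using t j tc x
        by (simp add: diff_def a_minus_def smult_l_distr neg smult_assoc1 path_carrier)
    qed
    moreover have "\<mu> (y_path j \<odot>\<^bsub>M\<^esub> (t (Suc j) \<odot>\<^bsub>M\<^esub> x)) (row (Suc j) - 1) (col j - 1) = g (Suc j)"
    proof (cases "0 < col (Suc j)")
      case True
      have "(rel (Suc j), 0, col j - col (Suc j)) \<in> box n" "col j - col (Suc j) \<le> col j - 1"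
        "l + (row (Suc j) - 1 - 0) - (col j - 1 - (col j - col (Suc j))) = rel (Suc j)"
        "col j - 1 - (col j - col (Suc j)) = col (Suc j) - 1"
        using True k gen_rel[OF j] col_step[OF j] by (auto simp: box_def rel_def)
      then show ?thesis using True k(1) unfolding y_path_def mu_basis_elem_smult[OF tj(1) k(3)] by (simp add: g_def)
    next
      case False
      then have "\<not> col j - col (Suc j) \<le> col j - 1" using k by auto
      then show ?thesis using False unfolding y_path_def mu_basis_elem_smult[OF tj(1) k(3)] by (simp add: g_def)
    qed
    moreover have "\<mu> (x_path j \<odot>\<^bsub>M\<^esub> (t j \<odot>\<^bsub>M\<^esub> x)) (row (Suc j) - 1) (col j - 1) = g j"
    proof (cases "0 < row j")
      case True
      have "(rel j, row (Suc j) - row j, 0) \<in> box n" "row (Suc j) - row j \<le> row (Suc j) - 1"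
        "l + (row (Suc j) - 1 - (row (Suc j) - row j)) - (col j - 1 - 0) = rel j"
        "row (Suc j) - 1 - (row (Suc j) - row j) = row j - 1"
        using True k gen_rel[OF j] row_step[OF j] by (auto simp: box_def rel_def)
      then show ?thesis using True k(2) unfolding x_path_def mu_basis_elem_smult[OF tj(2) k(3)] by (simp add: g_def)
    next
      case False
      then have "\<not> row (Suc j) - row j \<le> row (Suc j) - 1" using k by auto
      then show ?thesis using False unfolding x_path_def mu_basis_elem_smult[OF tj(2) k(3)] by (simp add: g_def)
    qed
    ultimately show ?thesis
      using tj smult_closed[OF path_carrier(1)] smult_closed[OF path_carrier(2)] by (simp add: mu_minus)
  qed
  then have "aug (diff t) x = (\<Sum>j<p. g (Suc j) - g j)" unfolding aug_apply[OF dt x] by simp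
  also have "\<dots> = g p - g 0" by (rule sum_lessThan_telescope)
  also have "\<dots> = 0" by (simp add: g_def row_0 col_p)
  finally show "aug (diff t) x = \<zero>\<^bsub>DM\<^esub> x" using x by (simp add: k_dual_simps)
qed

text \<open>The coefficient of \<open>z j\<close> at the position \<open>(r, c)\<close> of the rectangle of \<open>e\<^bsub>gen j\<^esub>\<Pi>\<close>, which is
  placed so that its generator lies on the \<open>j\<close>-th corner; positions may be negative.\<close>

definition position_coord :: "(nat \<Rightarrow> 'k preproj_elem) \<Rightarrow> nat \<Rightarrow> int \<Rightarrow> int \<Rightarrow> 'k" where
  "position_coord z j r c = (if r < int (row (Suc j)) \<and> c < int (col j)
     then coord n (z j) (nat (int l + r - c)) (nat (int (row (Suc j)) - 1 - r)) (nat (int (col j) - 1 - c)) else 0)"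

lemma kernel_position_coord:
  assumes z: "z \<in> hom_kernel P0 DM aug" and rc: "(r, c) \<in> Y"
  shows "(\<Sum>j<p. position_coord z j (int r) (int c)) = 0"
proof -
  have "z \<in> carrier P0" "aug z (vec (r, c)) = 0"
    using z vec(1) by (auto simp: hom_kernel_def k_dual_simps)
  moreover have "position_coord z j (int r) (int c) = (if r < row (Suc j) \<and> c < col j
    then coord n (z j) (l + r - c) (row (Suc j) - 1 - r) (col j - 1 - c) else 0)" for j
  proof -
    have "nat (int l + int r - int c) = l + r - c" by linarith
    moreover have "nat (int (row (Suc j)) - 1 - int r) = row (Suc j) - 1 - r"
      "nat (int (col j) - 1 - int c) = col j - 1 - c" by linarith+
    ultimately show ?thesis unfolding position_coord_def by simp
  qed
  ultimately show ?thesis using aug_vec[OF _ rc] by simp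
qed

text \<open>A corner lies in no rectangle but its own. At its basis vector \<open>aug z\<close>
  therefore reduces to the coefficient of \<open>z j\<close> at the idempotent.\<close>

lemma kernel_rad:
  assumes z: "z \<in> hom_kernel P0 DM aug" and j: "j < p"
  shows "coord n (z j) (gen j) 0 0 = 0"
proof -
  note k = corner[OF j]
  have P0: "z \<in> carrier P0" and 0: "aug z (vec (row (Suc j) - 1, col j - 1)) = 0"
    using z vec(1) by (auto simp: hom_kernel_def k_dual_simps)
  have "(\<Sum>i<p. if row (Suc j) - 1 < row (Suc i) \<and> col j - 1 < col i
      then coord n (z i) (l + (row (Suc j) - 1) - (col j - 1)) (row (Suc i) - 1 - (row (Suc j) - 1)) (col i - 1 - (col j - 1))
      else 0) = (\<Sum>i<p. if i = j then coord n (z j) (gen j) 0 0 else 0)"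
  proof (intro sum.cong refl)
    fix i assume "i \<in> {..<p}"
    then have i: "i < p" by simp
    have "row (Suc i) \<le> row j \<and> row j < row (Suc j)" if "i < j" using that row_mono[of "Suc i" j] row_step[OF j] j by auto
    moreover have "col i \<le> col (Suc j) \<and> col (Suc j) < col j" if "j < i"
      using that col_mono[of "Suc j" i] col_step[OF j] i by auto
    ultimately have "row (Suc j) - 1 < row (Suc i) \<and> col j - 1 < col i \<longleftrightarrow> i = j"
      using k by (cases i j rule: linorder_cases) auto
    moreover have "l + (row (Suc j) - 1) - (col j - 1) = gen j" using k by (auto simp: gen_def)
    ultimately show "(if row (Suc j) - 1 < row (Suc i) \<and> col j - 1 < col i
      then coord n (z i) (l + (row (Suc j) - 1) - (col j - 1)) (row (Suc i) - 1 - (row (Suc j) - 1)) (col i - 1 - (col j - 1))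
      else 0) = (if i = j then coord n (z j) (gen j) 0 0 else 0)" by simp
  qed
  then show ?thesis using 0 j unfolding aug_vec[OF P0 k(3)] by simp
qed

text \<open>Multiplication by the two kinds of paths preserves positions, so
  \<open>diff t = z\<close> can be solved at each position \<open>(r, c)\<close> separately. The
  contribution of \<open>t (Suc j)\<close> is available only for \<open>c < col (Suc j)\<close>,
  that of \<open>t j\<close> only for \<open>r < row j\<close>; elsewhere the solution must vanish
  by itself. The kernel condition provides a vanishing total at the positions of
  \<open>Y\<close>.\<close>

lemma kernel_subset_image:
  assumes z: "z \<in> hom_kernel P0 DM aug"
  shows "z \<in> diff ` carrier P1"
proof -
  interpret ring "preproj n :: 'k preproj_elem ring" by (rule ring_preproj)
  have zP: "z \<in> carrier P0" using z by (simp add: hom_kernel_def)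
  let ?Z = "position_coord z"
  \<comment> \<open>At a fixed position this solves \<open>T (Suc j) - T j = Z j\<close>: by partial
    sums to the left of the array and by negative tail sums elsewhere. The two expressions agree if
    the total is zero.\<close>
  define T where "T i r c = (if c < 0 then \<Sum>j<i. ?Z j r c else - (\<Sum>j=i..<p. ?Z j r c))" for i :: nat and r c :: int
  \<comment> \<open>The generator of the \<open>i\<close>-th summand is placed at
    \<open>(row i - 1, col i - 1)\<close>, the diagonal predecessor of the addable box; with this
    choice \<open>diff\<close> preserves positions.\<close>
  define F where "F i s a b = (if s + a = rel i + b then T i (int (row i) - 1 - int a) (int (col i) - 1 - int b) else 0)"
    for i s a b :: nat
  define t :: "nat \<Rightarrow> 'k preproj_elem" where "t = (\<lambda>i\<in>{..<Suc p}. of_coord n (F i))"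
  have t: "t \<in> carrier P1"
  proof (rule proj_sum_memI)
    fix i assume i: "i < Suc p"
    show "t i \<in> carrier (preproj n)" using i by (simp add: t_def of_coord_carrier)
    show "vertex_idem n (rel i) \<otimes>\<^bsub>preproj n\<^esub> t i = t i"
      using i vertex_idem_mult_iff[OF of_coord_carrier, of n "rel i" "F i"]
      by (auto simp: t_def coord_of_coord F_def)
  qed (simp add: t_def)
  have dt: "diff t \<in> carrier P0" using diff_hom t by (auto simp: left_hom_def)
  have split: "(\<Sum>j<p. f j) = (\<Sum>j<i. f j) + (\<Sum>j=i..<p. f j)" if "i \<le> p" for f :: "nat \<Rightarrow> 'k" and i
    using sum.atLeastLessThan_concat[of 0 i p f] that by (simp add: atLeast0LessThan)
  have "diff t = z"
  proof (rule proj_sum_eqI[where m = p])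
    show "diff t \<in> extensional {..<p}" "z \<in> extensional {..<p}"
      using proj_sum_memD(3)[OF dt] proj_sum_memD(3)[OF zP] by auto
    fix j assume j: "j < p"
    note k = corner[OF j]
    show "diff t j = z j"
    proof (rule preproj_eqI[of _ n])
      show "diff t j \<in> carrier (preproj n)" "z j \<in> carrier (preproj n)"
        using proj_sum_memD(1)[OF dt j] proj_sum_memD(1)[OF zP j] by auto
      fix s a b assume sab: "(s, a, b) \<in> box n"
      show "coord n (diff t j) s a b = coord n (z j) s a b"
      proof (cases "s + a = gen j + b")
        case False
        then have "coord n (diff t j) s a b = 0" "coord n (z j) s a b = 0"
          using proj_sum_memD(1,2)[OF dt j] proj_sum_memD(1,2)[OF zP j] vertex_idem_mult_iff by blast+
        then show ?thesis by simp
      next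
        case e: True
        define r where "r = int (row (Suc j)) - 1 - int a"
        define c where "c = int (col j) - 1 - int b"
        have lrc: "int l + r - c = int s" using e gen_rel(3)[OF j] by (simp add: r_def c_def)
        have Zj: "?Z j r c = coord n (z j) s a b"
          using lrc by (simp add: position_coord_def) (simp add: r_def c_def)
        have tc: "t (Suc j) \<in> carrier (preproj n)" "t j \<in> carrier (preproj n)"
          using j by (auto simp: t_def of_coord_carrier)
        have y: "coord n (y_path j \<otimes>\<^bsub>preproj n\<^esub> t (Suc j)) s a b = (if c < int (col (Suc j)) then T (Suc j) r c else 0)"
        proof (cases "col j - col (Suc j) \<le> b")
          case True
          have "(s, a, b - (col j - col (Suc j))) \<in> box n" using sab by (auto simp: box_def)
          moreover have "s + a = rel (Suc j) + (b - (col j - col (Suc j)))"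
            using e gen_rel(4)[OF j] True by simp
          moreover have "int (col (Suc j)) - 1 - int (b - (col j - col (Suc j))) = c"
            using True col_step[OF j] by (simp add: c_def of_nat_diff)
          moreover have "c < int (col (Suc j))" using True col_step[OF j] by (simp add: c_def)
          ultimately show ?thesis using True j
            unfolding coord_y_path_mult[OF j tc(1) sab e]
            by (simp add: t_def coord_of_coord F_def) (simp add: r_def)
        next
          case False
          then have "\<not> c < int (col (Suc j))" using col_step[OF j] by (simp add: c_def)
          then show ?thesis using False unfolding coord_y_path_mult[OF j tc(1) sab e] by simp
        qed
        have x: "coord n (x_path j \<otimes>\<^bsub>preproj n\<^esub> t j) s a b = (if r < int (row j) then T j r c else 0)"
        proof (cases "row (Suc j) - row j \<le> a")
          case True
          have "(s, a - (row (Suc j) - row j), b) \<in> box n" using sab by (auto simp: box_def)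
          moreover have "s + (a - (row (Suc j) - row j)) = rel j + b"
            using e gen_rel(5)[OF j] True by simp
          moreover have "int (row j) - 1 - int (a - (row (Suc j) - row j)) = r"
            using True row_step[OF j] by (simp add: r_def of_nat_diff)
          moreover have "r < int (row j)" using True row_step[OF j] by (simp add: r_def)
          ultimately show ?thesis using True j
            unfolding coord_x_path_mult[OF j tc(2) sab e]
            by (simp add: t_def coord_of_coord F_def) (simp add: c_def)
        next
          case False
          then have "\<not> r < int (row j)" using row_step[OF j] by (simp add: r_def)
          then show ?thesis using False unfolding coord_x_path_mult[OF j tc(2) sab e] by simp
        qed
        have low: "(\<Sum>i<j. ?Z i r c) = 0" if "\<not> r < int (row j)"
        proof (rule sum.neutral, rule ballI)
          fix i assume "i \<in> {..<j}"
          then have "row (Suc i) \<le> row j" using row_mono[of "Suc i" j] j by simp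
          then show "?Z i r c = 0" using that by (simp add: position_coord_def)
        qed
        have high: "(\<Sum>i=Suc j..<p. ?Z i r c) = 0" if "\<not> c < int (col (Suc j))"
        proof (rule sum.neutral, rule ballI)
          fix i assume "i \<in> {Suc j..<p}"
          then have "col i \<le> col (Suc j)" using col_mono[of "Suc j" i] by simp
          then show "?Z i r c = 0" using that by (simp add: position_coord_def)
        qed
        have "(if c < int (col (Suc j)) then T (Suc j) r c else 0) - (if r < int (row j) then T j r c else 0) = ?Z j r c"
        proof (cases "c < 0")
          case True
          then have "c < int (col (Suc j))" by simp
          moreover have "(if r < int (row j) then T j r c else 0) = (\<Sum>i<j. ?Z i r c)"
            using low True by (simp add: T_def)
          ultimately show ?thesis using True by (simp add: T_def)
        next
          case c: False
          \<comment> \<open>Now both indices are non-negative and the position is in the rectangle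
            of the corner \<open>j\<close>, hence in \<open>Y\<close>, where the kernel condition
            applies.\<close>
          have all: "(\<Sum>i<p. ?Z i r c) = 0" if "\<not> r < int (row j)"
          proof -
            have r: "0 \<le> r" using that by simp
            have "nat r < row (Suc j)" "nat c < col j" using r c by (auto simp: r_def c_def)
            then have "(nat r, nat c) \<in> Y" unfolding mem_Y using j by blast
            from kernel_position_coord[OF z this] show ?thesis using r c by simp
          qed
          have "(if r < int (row j) then T j r c else 0) = - (\<Sum>i=j..<p. ?Z i r c)"
            using all low split[of j "\<lambda>i. ?Z i r c"] c j by (simp add: T_def)
          moreover have "(if c < int (col (Suc j)) then T (Suc j) r c else 0) = - (\<Sum>i=Suc j..<p. ?Z i r c)"
            using high c by (simp add: T_def)
          moreover have "(\<Sum>i=j..<p. ?Z i r c) = ?Z j r c + (\<Sum>i=Suc j..<p. ?Z i r c)"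
            using j by (simp add: sum.atLeast_Suc_lessThan)
          ultimately show ?thesis by simp
        qed
        then have "coord n (y_path j \<otimes>\<^bsub>preproj n\<^esub> t (Suc j) \<ominus>\<^bsub>preproj n\<^esub> x_path j \<otimes>\<^bsub>preproj n\<^esub> t j) s a b = coord n (z j) s a b"
          using tc path_carrier x y Zj by (simp add: coord_minus)
        then show ?thesis using t j by (simp add: diff_def)
      qed
    qed
  qed
  then show ?thesis using t by blast
qed

lemma diff_image: "diff ` carrier P1 = hom_kernel P0 DM aug"
proof
  show "diff ` carrier P1 \<subseteq> hom_kernel P0 DM aug"
    using aug_diff diff_hom by (auto simp: hom_kernel_def left_hom_def)
  show "hom_kernel P0 DM aug \<subseteq> diff ` carrier P1"
    using kernel_subset_image by blast
qed

text \<open>The coefficient of \<open>t i\<close> at the idempotent reappears in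
  \<open>x_path i\<close> times \<open>t i\<close> at a pure power of x. The term with
  \<open>y_path\<close> has no such monomial, since its exponent is positive. For
  \<open>i = p\<close> the roles of x and y are exchanged.\<close>

lemma diff_kernel_rad:
  assumes t: "t \<in> hom_kernel P1 P0 diff" and i: "i < Suc p"
  shows "coord n (t i) (rel i) 0 0 = 0"
proof (cases "(rel i, 0, 0) \<in> box n")
  case True
  interpret ring "preproj n :: 'k preproj_elem ring" by (rule ring_preproj)
  have tP: "t \<in> carrier P1" and 0: "diff t = \<zero>\<^bsub>P0\<^esub>" using t by (auto simp: hom_kernel_def)
  have T: "t i \<in> carrier (preproj n)" if "i \<le> p" for i
    using proj_sum_memD(1)[OF tP, of i] that by simp
  have d0: "coord n (y_path j \<otimes>\<^bsub>preproj n\<^esub> t (Suc j)) s a b = coord n (x_path j \<otimes>\<^bsub>preproj n\<^esub> t j) s a b"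
    if j: "j < p" for j s a b
  proof -
    have "diff t j = \<zero>\<^bsub>preproj n\<^esub>" using 0 j by (simp add: proj_sum_simps)
    then have "y_path j \<otimes>\<^bsub>preproj n\<^esub> t (Suc j) \<ominus>\<^bsub>preproj n\<^esub> x_path j \<otimes>\<^bsub>preproj n\<^esub> t j = \<zero>\<^bsub>preproj n\<^esub>"
      using tP j by (simp add: diff_def)
    from arg_cong[OF this, of "\<lambda>x. coord n x s a b"] show ?thesis
      using T[of "Suc j"] T[of j] j path_carrier by (simp add: coord_minus coord_zero)
  qed
  show ?thesis
  proof (cases "i < p")
    case i: True
    have b: "(rel i, row (Suc i) - row i, 0) \<in> box n" "rel i + (row (Suc i) - row i) = gen i + 0"
      using True gen_rel[OF i] by (auto simp: box_def)
    have "t (Suc i) \<in> carrier (preproj n)" "t i \<in> carrier (preproj n)" using T i by auto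
    from coord_y_path_mult[OF i this(1) b] coord_x_path_mult[OF i this(2) b] d0[OF i]
    show ?thesis using col_step[OF i] by simp
  next
    case False
    then have ip: "i = p" using i by simp
    show ?thesis
    proof (cases p)
      case 0
      then show ?thesis using p_pos by simp
    next
      case (Suc j)
      have j: "j < p" using Suc by simp
      have b: "(rel p, 0, col j - col (Suc j)) \<in> box n" "rel p + 0 = gen j + (col j - col (Suc j))"
        using True ip Suc gen_rel[OF j] by (auto simp: box_def)
      have "t (Suc j) \<in> carrier (preproj n)" "t j \<in> carrier (preproj n)" using T j by auto
      from coord_y_path_mult[OF j this(1) b] coord_x_path_mult[OF j this(2) b] d0[OF j]
      show ?thesis using row_step[OF j] by (simp add: ip Suc)
    qed
  qed
qed (simp add: coord_outside)

lemma min_proj_presentation: "min_proj_presentation Rop P1 P0 diff aug DM"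
  unfolding min_proj_presentation_def
proof (intro conjI fg_projective_proj_sum diff_hom aug_hom aug_surj diff_image)
  interpret P0: left_module Rop P0 by (rule left_module_proj_sum)
  interpret P1: left_module Rop P1 by (rule left_module_proj_sum)
  have aug0: "aug \<zero>\<^bsub>P0\<^esub> = \<zero>\<^bsub>DM\<^esub>"
  proof (rule extensionalityI[where A = "carrier M"])
    fix x assume x: "x \<in> carrier M"
    have "aug \<zero>\<^bsub>P0\<^esub> x = 0"
      unfolding aug_apply[OF P0.M.zero_closed x]
      by (rule sum.neutral) (use x in \<open>simp add: proj_sum_simps smult_zero_left mu_zero\<close>)
    then show "aug \<zero>\<^bsub>P0\<^esub> x = \<zero>\<^bsub>DM\<^esub> x" using x by (simp add: k_dual_simps)
  qed (use P0.M.zero_closed in \<open>simp_all add: aug_def k_dual_simps\<close>)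
  have diff0: "diff \<zero>\<^bsub>P1\<^esub> = \<zero>\<^bsub>P0\<^esub>"
  proof -
    have c: "diff \<zero>\<^bsub>P1\<^esub> \<in> carrier P0" using diff_hom P1.M.zero_closed by (auto simp: left_hom_def)
    have "diff (\<zero>\<^bsub>P1\<^esub> \<oplus>\<^bsub>P1\<^esub> \<zero>\<^bsub>P1\<^esub>) = diff \<zero>\<^bsub>P1\<^esub> \<oplus>\<^bsub>P0\<^esub> diff \<zero>\<^bsub>P1\<^esub>"
      using diff_hom P1.M.zero_closed unfolding left_hom_def by blast
    then show ?thesis using c P0.M.add.r_cancel_one[OF c c] P1.M.l_zero[OF P1.M.zero_closed] by simp
  qed
  show "superfluous Rop P0 (hom_kernel P0 DM aug)"
  proof (rule superfluous_proj_sum)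
    show "submodule (hom_kernel P0 DM aug) Rop P0"
    proof (rule submodule_hom_kernel[OF P0.left_module_axioms aug_hom])
      show "aug \<zero>\<^bsub>P0\<^esub> = \<zero>\<^bsub>DM\<^esub>" by (rule aug0)
    qed (auto simp: k_dual_simps smult_closed intro!: restrict_ext)
  qed (rule kernel_rad)
  show "superfluous Rop P1 (hom_kernel P1 P0 diff)"
  proof (rule superfluous_proj_sum)
    show "submodule (hom_kernel P1 P0 diff) Rop P1"
    proof (rule submodule_hom_kernel[OF P1.left_module_axioms diff_hom])
      show "diff \<zero>\<^bsub>P1\<^esub> = \<zero>\<^bsub>P0\<^esub>" by (rule diff0)
    qed (simp_all add: P0.smult_zero_right)
  qed (rule diff_kernel_rad)
qed

text \<open>The coordinate functionals generate the dual of P1, so only their images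
  \<open>m i\<close> matter. The injectivity used in the induction is geometric: a position of
  \<open>Y\<close> at the vertex of the addable box \<open>Suc j\<close> lies above the row
  \<open>row (Suc j)\<close>, and moving it to the right by the length of \<open>y_path j\<close>
  does not leave the rectangle of the corner \<open>j\<close>.\<close>

lemma hom_from_transpose_zero:
  defines "D1 \<equiv> ring_dual Rop P1" and "I \<equiv> (\<lambda>f. compose (carrier P1) f diff) ` carrier (ring_dual Rop P0)"
  assumes g: "g \<in> left_hom (preproj n) (quot_module D1 I) M"
    and x: "x \<in> carrier (quot_module D1 I)"
  shows "g x = \<zero>\<^bsub>M\<^esub>"
proof -
  interpret P1: left_module Rop P1 by (rule left_module_proj_sum)
  have LD: "left_module (preproj n) D1"
    unfolding D1_def using left_module_ring_dual[OF P1.left_module_axioms] by simp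
  interpret D1: left_module "preproj n" D1 by (rule LD)
  have sub: "submodule I (preproj n) D1"
    unfolding D1_def I_def
    using submodule_dual_image[OF P1.left_module_axioms left_module_proj_sum diff_hom] by simp
  note epi = quot_module_epi[OF LD sub]
  note q = module_epiD[OF epi]
  have gc: "g y \<in> carrier M" if "y \<in> carrier (quot_module D1 I)" for y
    using g that by (auto simp: left_hom_def)
  have gadd: "g (y \<oplus>\<^bsub>quot_module D1 I\<^esub> z) = g y \<oplus>\<^bsub>M\<^esub> g z"
    if "y \<in> carrier (quot_module D1 I)" "z \<in> carrier (quot_module D1 I)" for y z
    using g that by (auto simp: left_hom_def)
  have gsm: "g (a \<odot>\<^bsub>quot_module D1 I\<^esub> y) = a \<odot>\<^bsub>M\<^esub> g y"
    if "a \<in> carrier (preproj n)" "y \<in> carrier (quot_module D1 I)" for a y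
    using g that by (auto simp: left_hom_def)
  \<comment> \<open>The homomorphism is pulled back to the whole dual, where it can be evaluated on
    functionals rather than on cosets.\<close>
  define G where "G f = g (I +>\<^bsub>D1\<^esub> f)" for f
  have Gc: "G f \<in> carrier M" if "f \<in> carrier D1" for f
    using gc q(1)[OF that] by (simp add: G_def)
  have Gadd: "G (f \<oplus>\<^bsub>D1\<^esub> f') = G f \<oplus>\<^bsub>M\<^esub> G f'" if "f \<in> carrier D1" "f' \<in> carrier D1" for f f'
    using gadd q(1)[OF that(1)] q(1)[OF that(2)] by (simp add: G_def q(3)[OF that])
  have Gsm: "G (a \<odot>\<^bsub>D1\<^esub> f) = a \<odot>\<^bsub>M\<^esub> G f" if "a \<in> carrier (preproj n)" "f \<in> carrier D1" for a f
    using gsm[OF that(1)] q(1)[OF that(2)] by (simp add: G_def q(4)[OF that])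
  have G0: "G \<zero>\<^bsub>D1\<^esub> = \<zero>\<^bsub>M\<^esub>"
  proof -
    have "G \<zero>\<^bsub>D1\<^esub> \<oplus>\<^bsub>M\<^esub> G \<zero>\<^bsub>D1\<^esub> = G \<zero>\<^bsub>D1\<^esub>"
      using Gadd[OF D1.M.zero_closed D1.M.zero_closed] D1.M.l_zero[OF D1.M.zero_closed] by simp
    then show ?thesis using Gc[OF D1.M.zero_closed] M.add.r_cancel_one by simp
  qed
  have GI: "G f = \<zero>\<^bsub>M\<^esub>" if f: "f \<in> I" for f
  proof -
    have fD: "f \<in> carrier D1" using D1.submoduleD(1)[OF sub f] .
    have "I +>\<^bsub>D1\<^esub> f = I +>\<^bsub>D1\<^esub> \<zero>\<^bsub>D1\<^esub>"
      using quot_module_kernel[OF LD sub fD] f q(2) by simp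
    then show ?thesis using G0 by (simp add: G_def)
  qed
  let ?\<epsilon> = "\<lambda>i. coordinate n (Suc p) rel i :: (nat \<Rightarrow> 'k preproj_elem) \<Rightarrow> 'k preproj_elem"
  have \<epsilon>: "?\<epsilon> i \<in> carrier D1" if "i \<le> p" for i
    unfolding D1_def using coordinate_mem[of i "Suc p" n rel] that by simp
  define m where "m i = G (?\<epsilon> i)" for i
  have mc: "m i \<in> carrier M" if "i \<le> p" for i using Gc[OF \<epsilon>[OF that]] by (simp add: m_def)
  have e: "vertex_idem n (rel i) \<odot>\<^bsub>M\<^esub> m i = m i" if i: "i \<le> p" for i
  proof -
    have "vertex_idem n (rel i) \<odot>\<^bsub>D1\<^esub> ?\<epsilon> i = ?\<epsilon> i"
    proof (rule extensionalityI[where A = "carrier P1"])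
      show "vertex_idem n (rel i) \<odot>\<^bsub>D1\<^esub> ?\<epsilon> i \<in> extensional (carrier P1)"
        unfolding D1_def by (rule ring_dual_extensional)
      show "(vertex_idem n (rel i) \<odot>\<^bsub>D1\<^esub> ?\<epsilon> i) t = ?\<epsilon> i t" if t: "t \<in> carrier P1" for t
        unfolding D1_def ring_dual_apply[OF t] using t i proj_sum_memD(2)[OF t, of i] by (simp add: coordinate_def)
    qed (simp add: coordinate_def)
    then show ?thesis using Gsm[OF vertex_idem_carrier[of n "rel i"] \<epsilon>[OF i]] unfolding m_def by metis
  qed
  have mu_m: "l + r = rel i + c" if "i \<le> p" "(r, c) \<in> Y" "\<mu> (m i) r c \<noteq> 0" for i r c
  proof -
    have "\<mu> (vertex_idem n (rel i) \<odot>\<^bsub>M\<^esub> m i) r c \<noteq> 0" unfolding e[OF that(1)] by (rule that(3))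
    then have "l + (r - 0) - (c - 0) = rel i"
      unfolding vertex_idem_def mu_basis_elem_smult[OF mc[OF that(1)] that(2)] by (auto split: if_splits)
    then show ?thesis using in_box[OF that(2)] by (auto simp: box_def)
  qed
  have rels: "y_path j \<odot>\<^bsub>M\<^esub> m (Suc j) = x_path j \<odot>\<^bsub>M\<^esub> m j" if j: "j < p" for j
  proof -
    \<comment> \<open>The \<open>j\<close>-th component of \<open>diff\<close> is in the image that
      is factored out; it is the difference of multiples of two neighbouring coordinate
      functionals.\<close>
    let ?h = "compose (carrier P1) (coordinate n p gen j) diff"
    have h: "?h \<in> I" unfolding I_def using coordinate_mem[OF j] by blast
    have hD: "?h \<in> carrier D1" using D1.submoduleD(1)[OF sub h] .
    have \<epsilon>j: "?\<epsilon> j \<in> carrier D1" "?\<epsilon> (Suc j) \<in> carrier D1" using \<epsilon> j by auto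
    have "y_path j \<odot>\<^bsub>D1\<^esub> ?\<epsilon> (Suc j) = ?h \<oplus>\<^bsub>D1\<^esub> x_path j \<odot>\<^bsub>D1\<^esub> ?\<epsilon> j"
    proof (rule extensionalityI[where A = "carrier P1"])
      show "y_path j \<odot>\<^bsub>D1\<^esub> ?\<epsilon> (Suc j) \<in> extensional (carrier P1)"
        "?h \<oplus>\<^bsub>D1\<^esub> x_path j \<odot>\<^bsub>D1\<^esub> ?\<epsilon> j \<in> extensional (carrier P1)"
        unfolding D1_def by (rule ring_dual_extensional)+
      fix t assume t: "t \<in> carrier P1"
      have dt: "diff t \<in> carrier P0" using diff_hom t by (auto simp: left_hom_def)
      have tc: "t (Suc j) \<in> carrier (preproj n)" "t j \<in> carrier (preproj n)"
        using proj_sum_memD(1)[OF t] j by auto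
      have ht: "?h t = y_path j \<otimes>\<^bsub>preproj n\<^esub> t (Suc j) \<ominus>\<^bsub>preproj n\<^esub> x_path j \<otimes>\<^bsub>preproj n\<^esub> t j"
        using t dt j by (simp add: compose_def coordinate_def) (simp add: diff_def)
      have "?h t \<oplus>\<^bsub>preproj n\<^esub> x_path j \<otimes>\<^bsub>preproj n\<^esub> t j = y_path j \<otimes>\<^bsub>preproj n\<^esub> t (Suc j)"
        unfolding ht using tc path_carrier[of j] by (simp add: a_minus_def R.a_assoc R.l_neg)
      then show "(y_path j \<odot>\<^bsub>D1\<^esub> ?\<epsilon> (Suc j)) t = (?h \<oplus>\<^bsub>D1\<^esub> x_path j \<odot>\<^bsub>D1\<^esub> ?\<epsilon> j) t"
        unfolding D1_def ring_dual_apply[OF t] using t by (simp add: coordinate_def)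
    qed
    then have "G (y_path j \<odot>\<^bsub>D1\<^esub> ?\<epsilon> (Suc j)) = G ?h \<oplus>\<^bsub>M\<^esub> G (x_path j \<odot>\<^bsub>D1\<^esub> ?\<epsilon> j)"
      using Gadd[OF hD D1.smult_closed[OF path_carrier(2) \<epsilon>j(1)]] by simp
    then show ?thesis
      unfolding GI[OF h] Gsm[OF path_carrier(1) \<epsilon>j(2)] Gsm[OF path_carrier(2) \<epsilon>j(1)] m_def
      using smult_closed[OF path_carrier(2) Gc[OF \<epsilon>j(1)]] by simp
  qed
  have "i \<le> p \<Longrightarrow> m i = \<zero>\<^bsub>M\<^esub>" for i
  proof (induction i)
    case 0
    show ?case
    proof (rule mu_eqI[OF mc M.zero_closed])
      fix r c assume rc: "(r, c) \<in> Y"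
      then obtain j where "j < p" "c < col j" unfolding mem_Y by blast
      \<comment> \<open>Every position of \<open>Y\<close> has a column before \<open>col 0\<close>,
        so its vertex is larger than \<open>rel 0 = l - col 0\<close>.\<close>
      then have "c < col 0" using col_mono[of 0 j] by simp
      then have "\<not> l + r = rel 0 + c" using col_le[of 0] by (simp add: rel_def row_0)
      then show "\<mu> (m 0) r c = \<mu> \<zero>\<^bsub>M\<^esub> r c" using mu_m[OF _ rc, of 0] by (auto simp: mu_zero)
    qed simp
  next
    case (Suc j)
    then have j: "j < p" by simp
    have "y_path j \<odot>\<^bsub>M\<^esub> m (Suc j) = \<zero>\<^bsub>M\<^esub>"
      using rels[OF j] Suc smult_zero_right[OF path_carrier(2)] by simp
    note zero = arg_cong[OF this, of "\<lambda>x. \<mu> x r c" for r c]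
    show ?case
    proof (rule mu_eqI[OF mc[OF Suc.prems] M.zero_closed])
      fix r c assume rc: "(r, c) \<in> Y"
      let ?d = "col j - col (Suc j)"
      have "\<mu> (m (Suc j)) r c = 0"
      proof (rule ccontr)
        assume nz: "\<mu> (m (Suc j)) r c \<noteq> 0"
        have v: "l + r = rel (Suc j) + c" by (rule mu_m[OF Suc.prems rc nz])
        have relS: "rel (Suc j) + col (Suc j) = l + row (Suc j)" using col_le[OF Suc.prems] by (simp add: rel_def)
        \<comment> \<open>Further down on this diagonal also \<open>c \<ge> col (Suc j)\<close>
          would hold, and such a position is in none of the rectangles.\<close>
        have "r < row (Suc j)"
        proof (rule ccontr)
          assume ge: "\<not> r < row (Suc j)"
          then have "col (Suc j) \<le> c" using v relS by linarith
          moreover obtain i where i: "i < p" "r < row (Suc i)" "c < col i" using rc unfolding mem_Y by blast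
          moreover have "Suc j \<le> i"
          proof (rule ccontr)
            assume "\<not> Suc j \<le> i"
            then have "row (Suc i) \<le> row (Suc j)" using row_mono[of "Suc i" "Suc j"] Suc.prems by simp
            then show False using ge i by simp
          qed
          ultimately show False using col_mono[of "Suc j" i] by simp
        qed
        then have "r < row (Suc j) \<and> c + ?d < col j" using v relS col_step[OF j] by linarith
        then have Y: "(r, c + ?d) \<in> Y" unfolding mem_Y using j by blast
        have b: "(rel (Suc j), 0, ?d) \<in> box n"
          using gen_rel(1,4)[OF j] in_box[OF rc] v by (auto simp: box_def)
        have "l + (r - 0) - (c + ?d - ?d) = rel (Suc j)" using v by simp
        then have "\<mu> (y_path j \<odot>\<^bsub>M\<^esub> m (Suc j)) r (c + ?d) = \<mu> (m (Suc j)) r c"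
          unfolding y_path_def mu_basis_elem_smult[OF mc[OF Suc.prems] Y] using b by simp
        then show False using nz zero[of r "c + ?d"] by (simp add: mu_zero)
      qed
      then show "\<mu> (m (Suc j)) r c = \<mu> \<zero>\<^bsub>M\<^esub> r c" by (simp add: mu_zero)
    qed
  qed
  then have m0: "G (?\<epsilon> i) = \<zero>\<^bsub>M\<^esub>" if "i < Suc p" for i using that by (simp add: m_def)
  have "G f = \<zero>\<^bsub>M\<^esub>" if f: "f \<in> carrier D1" for f
    using f unfolding D1_def
  proof (rule dual_generated_by_coordinates[where Q = "\<lambda>f. G f = \<zero>\<^bsub>M\<^esub>"])
    show "G \<zero>\<^bsub>ring_dual Rop P1\<^esub> = \<zero>\<^bsub>M\<^esub>" using G0 unfolding D1_def .
    show "G (f \<oplus>\<^bsub>ring_dual Rop P1\<^esub> h) = \<zero>\<^bsub>M\<^esub>"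
      if "f \<in> carrier (ring_dual Rop P1)" "h \<in> carrier (ring_dual Rop P1)" "G f = \<zero>\<^bsub>M\<^esub>" "G h = \<zero>\<^bsub>M\<^esub>" for f h
      using Gadd[of f h] that unfolding D1_def by simp
    show "G (a \<odot>\<^bsub>ring_dual Rop P1\<^esub> ?\<epsilon> i) = \<zero>\<^bsub>M\<^esub>" if "a \<in> carrier (preproj n)" "i < Suc p" for a i
      using Gsm[OF that(1) \<epsilon>[of i]] that m0[OF that(2)] smult_zero_right[OF that(1)] unfolding D1_def by simp
  qed
  moreover obtain f where "f \<in> carrier D1" "x = I +>\<^bsub>D1\<^esub> f" using q(5)[OF x] by blast
  ultimately show ?thesis by (simp add: G_def)
qed

text \<open>One representative of tau^- M is enough; it is the cokernel computed from the
  presentation above.\<close>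

lemma staircase_rigid: "Defs.tau_inverse_rigid (preproj n) (scalar_elem n) M"
  unfolding tau_inverse_rigid_def
proof (intro exI conjI)
  let ?T = "quot_module (ring_dual Rop P1)
    ((\<lambda>f. compose (carrier P1) f diff) ` carrier (ring_dual Rop P0))"
  show "is_tau_inverse (preproj n) (scalar_elem n) M ?T"
    unfolding is_tau_inverse_def is_transpose_def using min_proj_presentation by blast
  show "hom_vanishes (preproj n) ?T M"
    unfolding hom_vanishes_def using hom_from_transpose_zero by blast
qed

end

text \<open>A set closed under predecessors is determined by its row lengths, which decrease; the
  staircase is read off from them.\<close>

lemma (in array_module) tau_inverse_rigid:
  assumes "(0, 0) \<in> Y"
  shows "Defs.tau_inverse_rigid (preproj n) (scalar_elem n) M"
proof -
  define len where "len a = card {b. (a, b) \<in> Y}" for a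
  have fin: "finite {b. (a, b) \<in> Y}" for a
    by (rule finite_subset[OF _ finite_imageI[OF finite_Y, of snd]]) force
  have Y_len: "(a, b) \<in> Y \<longleftrightarrow> b < len a" for a b
  proof
    assume "(a, b) \<in> Y"
    then have "{..b} \<subseteq> {b. (a, b) \<in> Y}" using down[of a b a] by auto
    then have "card {..b} \<le> len a" unfolding len_def by (intro card_mono fin)
    then show "b < len a" by simp
  next
    assume b: "b < len a"
    show "(a, b) \<in> Y"
    proof (rule ccontr)
      assume n: "(a, b) \<notin> Y"
      have "{b. (a, b) \<in> Y} \<subseteq> {..<b}"
      proof
        fix b' assume b': "b' \<in> {b. (a, b) \<in> Y}"
        then have "\<not> b \<le> b'" using n down[of a b' a b] by auto
        then show "b' \<in> {..<b}" by simp
      qed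
      then have "len a \<le> card {..<b}" unfolding len_def by (intro card_mono) auto
      then show False using b by simp
    qed
  qed
  have anti: "len (Suc a) \<le> len a" for a
    unfolding len_def by (intro card_mono fin) (use down[of "Suc a" _ a] in auto)
  \<comment> \<open>The last non-empty row; it exists because the origin is in
    \<open>Y\<close>.\<close>
  define N where "N = Max {a. (a, 0) \<in> Y}"
  have fin0: "finite {a. (a, 0) \<in> Y}"
    by (rule finite_subset[OF _ finite_imageI[OF finite_Y, of fst]]) force
  have "N \<in> {a. (a, 0) \<in> Y}" unfolding N_def by (rule Max_in[OF fin0]) (use assms in auto)
  then have N: "0 < len N" using Y_len by simp
  have N_max: "a \<le> N" if "(a, b) \<in> Y" for a b
    unfolding N_def by (rule Max_ge[OF fin0]) (use down[OF that, of a 0] in simp)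
  obtain q row col where q: "row 0 = (0::nat)" "col (Suc q) = (0::nat)" "row (Suc q) = Suc N"
    "\<And>j. j \<le> q \<Longrightarrow> row j < row (Suc j) \<and> col (Suc j) < col j"
    and iff: "\<And>a b. a \<le> N \<Longrightarrow> b < len a \<longleftrightarrow> (\<exists>j\<le>q. a < row (Suc j) \<and> b < col j)"
    using staircase_exists[of len N, OF anti N] by blast
  have row_le: "row j \<le> Suc N" if "j \<le> Suc q" for j
    using that
  proof (induction j rule: inc_induct)
    case (step j)
    then show ?case using q(4)[of j] by simp
  qed (simp add: q(3))
  have mem: "(a, b) \<in> Y \<longleftrightarrow> (\<exists>j<Suc q. a < row (Suc j) \<and> b < col j)" for a b
  proof (cases "a \<le> N")
    case True
    then show ?thesis using iff[OF True, of b] Y_len by (simp add: less_Suc_eq_le)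
  next
    case False
    then have "\<not> a < row (Suc j)" if "j < Suc q" for j using row_le[of "Suc j"] that by auto
    then show ?thesis using False N_max by blast
  qed
  \<comment> \<open>The corners are numbered from 0 to \<open>q\<close>, so there are
    \<open>Suc q\<close> of them.\<close>
  interpret staircase_module n M l Y \<mu> "Suc q" row col
    by unfold_locales (use q mem in \<open>auto simp: less_Suc_eq_le\<close>)
  show ?thesis by (rule staircase_rigid)
qed

theorem theorem6p1:
  fixes n :: nat
  assumes "n \<ge> 1"
  shows "(\<forall>w l. join_irreducible_perm n w \<and> of_type n w l \<longrightarrow>
            pred_closed_subarray n l (J_array n l w) \<and>
            (\<exists>h \<in> left_iso (preproj n :: 'k::field preproj_elem ring)
                    (array_factor n l (J_array n l w)) (J_module n w l).
               \<forall>p \<in> carrier (proj_module n l).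
                 h (array_kernel n l (J_array n l w) +>\<^bsub>proj_module n l\<^esub> p)
                   = perm_ideal n w +>\<^bsub>preproj n\<^esub> p) \<and>
            represented_by_array n l (J_array n l w)
              (J_module n w l :: ('k preproj_elem, 'k preproj_elem set) module)
              (\<lambda>rc. perm_ideal n w +>\<^bsub>preproj n\<^esub> array_vec n l rc))
       \<and> (\<forall>l \<in> {1..n}. \<forall>U :: 'k preproj_elem set.
            submodule U (preproj n) (proj_module n l) \<and> U \<noteq> carrier (proj_module n l) \<longrightarrow>
              indecomposable_module (preproj n) (quot_module (proj_module n l) U) \<and>
              tau_inverse_rigid (preproj n) (scalar_elem n :: 'k \<Rightarrow> 'k preproj_elem)
                (quot_module (proj_module n l) U))"
proof (intro conjI allI impI ballI)
  fix w l assume "join_irreducible_perm n w \<and> of_type n w l"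
  then have w: "w permutes {1..n + 1}" and l: "of_type n w l"
    by (auto simp: join_irreducible_perm_def)
  show "pred_closed_subarray n l (J_array n l w)" by (rule J_module_array(1)[OF w l])
  show "\<exists>h \<in> left_iso (preproj n :: 'k preproj_elem ring)
      (array_factor n l (J_array n l w)) (J_module n w l).
    \<forall>p \<in> carrier (proj_module n l).
      h (array_kernel n l (J_array n l w) +>\<^bsub>proj_module n l\<^esub> p) = perm_ideal n w +>\<^bsub>preproj n\<^esub> p"
    by (rule J_module_array(2)[OF w l])
  show "represented_by_array n l (J_array n l w)
      (J_module n w l :: ('k preproj_elem, 'k preproj_elem set) module)
      (\<lambda>rc. perm_ideal n w +>\<^bsub>preproj n\<^esub> array_vec n l rc)"
    by (rule J_module_array(3)[OF w l])
next
  fix l and U :: "'k preproj_elem set"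
  assume l: "l \<in> {1..n}"
    and U: "submodule U (preproj n) (proj_module n l) \<and> U \<noteq> carrier (proj_module n l)"
  then obtain Y \<mu> where Y: "array_module n (quot_module (proj_module n l) U) l Y \<mu>" "(0, 0) \<in> Y"
    using quot_module_array[of l n U] by auto
  show "indecomposable_module (preproj n) (quot_module (proj_module n l) U)"
    by (rule array_module.indecomposable[OF Y])
  show "tau_inverse_rigid (preproj n) (scalar_elem n :: 'k \<Rightarrow> 'k preproj_elem) (quot_module (proj_module n l) U)"
    by (rule array_module.tau_inverse_rigid[OF Y])
qed

end
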